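(* Let $j\ge 1$ be an integer. Let $\{Z_i\}_{i\ge1}$ be iid real random variables with $Z_1\in\mathcal{RV}_{-\alpha}$, $\alpha>0$; in case the expectation of $Z_1$ exists, assume it is zero. Let $\lambda_n$ be a positive regularly varying sequence with index $\rho$, $\lambda_n\to\infty$ as $n\to\infty$, such that $\rho>\tfrac12$ in case $\mathrm{Var}[Z_1]<\infty$, and $\alpha\rho>1$ in case $\mathrm{Var}[Z_1]=\infty$. Let $X^{(n)}(t)=\sum_{k=1}^{\lfloor nt\rfloor}Z_k$ for $t\in[0,1]$, and let $\gamma_n^{(j)}=\left[n\,\mathrm{P}(|Z_1|>\lambda_n)\right]^{-j}$. Then, as $n\to\infty$, $$\gamma_n^{(j)}\,\mathrm{P}\left(X^{(n)}/\lambda_n\in\cdot\right)\to(\nu_\alpha^j\times\mathrm{Leb}_j)\circ h_j^{-1}(\cdot)$$ in $\mathbb{M}(\mathbb{D}\setminus\mathbb{D}_{\le(j-1)})$.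
   Context: **Regular variation.** A positive sequence $\{a_n\}$ is regularly varying with index $\rho\in\mathbb{R}$ if $a_{\lfloor cn\rfloor}/a_n\to c^\rho$ for all $c>0$. A real random variable $X$ is in $\mathcal{RV}_{-\alpha}$ ($\alpha>0$) if $x\mapsto\mathrm{P}(|X|>x)$ is regularly varying at infinity with index $-\alpha$ (i.e. $\mathrm{P}(|X|>tx)/\mathrm{P}(|X|>t)\to x^{-\alpha}$ as $t\to\infty$ for all $x>0$) and the tail balance condition holds: $\mathrm{P}(X>n)/\mathrm{P}(|X|>n)\to p$ and $\mathrm{P}(X<-n)/\mathrm{P}(|X|>n)\to q=1-p$ for some $p\in[0,1]$. With $p,q$ those of $Z_1$, $\nu_\alpha$ is the Borel measure on $\mathbb{R}\setminus\{0\}$ with $\nu_\alpha((-\infty,-y)\cup(x,\infty))=qy^{-\alpha}+px^{-\alpha}$ for $x,y>0$ (so $\nu_\alpha((x,\infty))=px^{-\alpha}$ and $\nu_\alpha((-\infty,-y))=qy^{-\alpha}$). $\nu_\alpha^j$ is the $j$-fold product measure on $(\mathbb{R}\setminus\{0\})^j$, and $\mathrm{Leb}_j$ is Lebesgue measure on $\mathbb{R}^j$. **Path space.** $\mathbb{D}=\mathbb{D}([0,1],\mathbb{R})$ is the space of real càdlàg functions on $[0,1]$ with the Skorohod $J_1$ metric $d_{J_1}(f,g)=\inf_{\lambda\in\Lambda}\max\{\sup_t|f(t)-g(\lambda(t))|,\sup_t|\lambda(t)-t|\}$, where $\Lambda$ is the set of strictly increasing continuous $\lambda:[0,1]\to[0,1]$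 with $\lambda(0)=0,\lambda(1)=1$. Let $U_j^\uparrow=\{u\in[0,1]^j:0\le u_1<\dots<u_j\le1\}$ and $h_j:(\mathbb{R}\setminus\{0\})^j\times U_j^\uparrow\to\mathbb{D}$, $h_j(z,u)(t)=\sum_{i=1}^j z_i\mathbf{1}[u_i\le t]$. Let $\mathbb{D}_{=0}$ consist of the zero function only, $\mathbb{D}_{=j}=h_j((\mathbb{R}\setminus\{0\})^j\times U_j^\uparrow)$ for $j\ge1$, and $\mathbb{D}_{\le j}=\bigcup_{i=0}^j\mathbb{D}_{=i}$. **Convergence.** For a metric space $(\mathbb{S},d)$ and closed $\mathbb{C}\subset\mathbb{S}$, a set $A$ is bounded away from $\mathbb{C}$ if $\inf\{d(x,y):x\in\mathbb{C},y\in A\}>0$. $\mathbb{M}(\mathbb{S}\setminus\mathbb{C})$ is the set of Borel measures on $\mathbb{S}\setminus\mathbb{C}$ that are finite on Borel sets bounded away from $\mathbb{C}$. $\mu_n\to\mu$ in $\mathbb{M}(\mathbb{S}\setminus\mathbb{C})$ means: $\limsup_n\mu_n(F)\le\mu(F)$ for every closed $F$ and $\liminf_n\mu_n(G)\ge\mu(G)$ for every open $G$, both bounded away from $\mathbb{C}$. *)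

theory Defs
  imports "HOL-Probability.Probability"
begin

section \<open>Regular variation\<close>

definition regularly_varying_seq :: "(nat \<Rightarrow> real) \<Rightarrow> real \<Rightarrow> bool" where
  "regularly_varying_seq a \<rho> \<longleftrightarrow>
     (\<forall>n\<ge>1. a n > 0) \<and>
     (\<forall>c>0. (\<lambda>n. a (nat \<lfloor>c * real n\<rfloor>) / a n) \<longlonglongrightarrow> c powr \<rho>)"

text \<open>
  The parameter \<open>p\<close> is the constant of the tail balance condition; it is determined by \<open>X\<close>.
  Division by zero causes no harm: if \<open>P(|X| > t)\<close> vanished for large \<open>t\<close>, the first limit would
  be \<open>0\<close> rather than \<open>x powr (- \<alpha>)\<close>.
\<close>
definition regularly_varying_rv :: "'a measure \<Rightarrow> ('a \<Rightarrow> real) \<Rightarrow> real \<Rightarrow> real \<Rightarrow> bool" where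
  "regularly_varying_rv M X \<alpha> p \<longleftrightarrow>
     (\<forall>x>0. ((\<lambda>t. \<P>(\<omega> in M. \<bar>X \<omega>\<bar> > t * x) / \<P>(\<omega> in M. \<bar>X \<omega>\<bar> > t))
               \<longlongrightarrow> x powr (- \<alpha>)) at_top) \<and>
     0 \<le> p \<and> p \<le> 1 \<and>
     (\<lambda>n::nat. \<P>(\<omega> in M. X \<omega> > real n) / \<P>(\<omega> in M. \<bar>X \<omega>\<bar> > real n)) \<longlonglongrightarrow> p \<and>
     (\<lambda>n::nat. \<P>(\<omega> in M. X \<omega> < - real n) / \<P>(\<omega> in M. \<bar>X \<omega>\<bar> > real n)) \<longlonglongrightarrow> 1 - p"

text \<open>
  \<open>\<nu>\<close> is the measure \<open>\<nu>\<^sub>\<alpha>\<close> on the punctured line. The stated values determine it: they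
  give the masses of \<open>(x, \<infinity>)\<close> and \<open>(-\<infinity>, -y)\<close> on letting \<open>y\<close> or \<open>x\<close> tend to infinity.
\<close>
definition is_nu :: "real \<Rightarrow> real \<Rightarrow> real measure \<Rightarrow> bool" where
  "is_nu \<alpha> p \<nu> \<longleftrightarrow>
     sets \<nu> = sets (restrict_space borel (- {0})) \<and>
     (\<forall>x>0. \<forall>y>0. emeasure \<nu> ({..< - y} \<union> {x <..}) =
        ennreal ((1 - p) * y powr (- \<alpha>) + p * x powr (- \<alpha>)))"

definition finite_variance :: "'a measure \<Rightarrow> ('a \<Rightarrow> real) \<Rightarrow> bool" where
  "finite_variance M X \<longleftrightarrow>
     integrable M X \<and> integrable M (\<lambda>\<omega>. (X \<omega> - integral\<^sup>L M X)\<^sup>2)"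


section \<open>The Skorohod space and step functions\<close>

text \<open>
  Functions on \<open>[0,1]\<close> are represented by functions on the reals that are \<open>extensional\<close> on
  \<open>{0..1}\<close>.
\<close>
definition skorohod :: "(real \<Rightarrow> real) set" where
  "skorohod = {f \<in> extensional {0..1}.
     (\<forall>t\<in>{0..<1}. (f \<longlongrightarrow> f t) (at_right t)) \<and>
     (\<forall>t\<in>{0<..1}. \<exists>l. (f \<longlongrightarrow> l) (at_left t))}"

definition time_changes :: "(real \<Rightarrow> real) set" where
  "time_changes = {l \<in> {0..1} \<rightarrow> {0..1}.
     strict_mono_on {0..1} l \<and> continuous_on {0..1} l \<and> l 0 = 0 \<and> l 1 = 1}"

text \<open>The suprema are over bounded sets since functions in \<open>skorohod\<close> are bounded on \<open>[0,1]\<close>.\<close>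
definition d_J1 :: "(real \<Rightarrow> real) \<Rightarrow> (real \<Rightarrow> real) \<Rightarrow> real" where
  "d_J1 f g = (INF l\<in>time_changes.
     max (SUP t\<in>{0..1}. \<bar>f t - g (l t)\<bar>) (SUP t\<in>{0..1}. \<bar>l t - t\<bar>))"

definition U_up :: "nat \<Rightarrow> (nat \<Rightarrow> real) set" where
  "U_up j = {u \<in> {1..j} \<rightarrow>\<^sub>E {0..1}. strict_mono_on {1..j} u}"

definition h_map :: "nat \<Rightarrow> (nat \<Rightarrow> real) \<times> (nat \<Rightarrow> real) \<Rightarrow> real \<Rightarrow> real" where
  "h_map j = (\<lambda>(z, u). \<lambda>t\<in>{0..1}. \<Sum>i=1..j. z i * indicator {u i ..} t)"

definition D_eq :: "nat \<Rightarrow> (real \<Rightarrow> real) set" where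
  "D_eq j = (if j = 0 then {\<lambda>t\<in>{0..1}. 0}
     else h_map j ` (({1..j} \<rightarrow>\<^sub>E - {0}) \<times> U_up j))"

definition D_le :: "nat \<Rightarrow> (real \<Rightarrow> real) set" where
  "D_le j = (\<Union>i\<le>j. D_eq i)"


section \<open>Convergence in the space of measures on S minus C\<close>

text \<open>With the infimum taken in the extended reals, the empty set is bounded away from every set.\<close>
definition bounded_away :: "('a \<Rightarrow> 'a \<Rightarrow> real) \<Rightarrow> 'a set \<Rightarrow> 'a set \<Rightarrow> bool" where
  "bounded_away d C A \<longleftrightarrow> (INF (x, y)\<in>C \<times> A. ereal (d x y)) > 0"

definition borel_of :: "'a topology \<Rightarrow> 'a measure" where
  "borel_of T = sigma (topspace T) {U. openin T U}"

definition M_space :: "'a set \<Rightarrow> ('a \<Rightarrow> 'a \<Rightarrow> real) \<Rightarrow> 'a set \<Rightarrow> 'a measure set" where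
  "M_space S d C = {\<mu>.
     sets \<mu> = sets (borel_of (subtopology (Metric_space.mtopology S d) (S - C))) \<and>
     (\<forall>A\<in>sets \<mu>. bounded_away d C A \<longrightarrow> emeasure \<mu> A < \<infinity>)}"

text \<open>
  Open and closed sets are those of the subspace \<open>S - C\<close>. As \<open>C\<close> is closed in \<open>S\<close>, a subset of
  \<open>S - C\<close> that is bounded away from \<open>C\<close> is open (closed) in \<open>S - C\<close> iff it is so in \<open>S\<close>.
\<close>
definition M_converges ::
  "'a set \<Rightarrow> ('a \<Rightarrow> 'a \<Rightarrow> real) \<Rightarrow> 'a set \<Rightarrow> (nat \<Rightarrow> 'a measure) \<Rightarrow> 'a measure \<Rightarrow> bool" where
  "M_converges S d C \<mu> \<mu>' \<longleftrightarrow>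
     (\<forall>n. \<mu> n \<in> M_space S d C) \<and> \<mu>' \<in> M_space S d C \<and>
     (\<forall>F. closedin (subtopology (Metric_space.mtopology S d) (S - C)) F \<longrightarrow> bounded_away d C F \<longrightarrow>
        limsup (\<lambda>n. emeasure (\<mu> n) F) \<le> emeasure \<mu>' F) \<and>
     (\<forall>G. openin (subtopology (Metric_space.mtopology S d) (S - C)) G \<longrightarrow> bounded_away d C G \<longrightarrow>
        liminf (\<lambda>n. emeasure (\<mu> n) G) \<ge> emeasure \<mu>' G)"


section \<open>The random walk and the limit measure\<close>

abbreviation skorohod_borel :: "(real \<Rightarrow> real) measure" where
  "skorohod_borel \<equiv> borel_of (Metric_space.mtopology skorohod d_J1)"

definition walk :: "(nat \<Rightarrow> 'a \<Rightarrow> real) \<Rightarrow> nat \<Rightarrow> 'a \<Rightarrow> real \<Rightarrow> real" where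
  "walk Z n \<omega> = (\<lambda>t\<in>{0..1}. \<Sum>k=1..nat \<lfloor>real n * t\<rfloor>. Z k \<omega>)"

definition scaled_law ::
  "'a measure \<Rightarrow> (nat \<Rightarrow> 'a \<Rightarrow> real) \<Rightarrow> (nat \<Rightarrow> real) \<Rightarrow> nat \<Rightarrow> (real \<Rightarrow> real) measure" where
  "scaled_law M Z lam n = distr M skorohod_borel (\<lambda>\<omega>. \<lambda>t\<in>{0..1}. walk Z n \<omega> t / lam n)"

definition gamma_seq :: "'a measure \<Rightarrow> (nat \<Rightarrow> 'a \<Rightarrow> real) \<Rightarrow> (nat \<Rightarrow> real) \<Rightarrow> nat \<Rightarrow> nat \<Rightarrow> real" where
  "gamma_seq M Z lam j n = inverse ((real n * \<P>(\<omega> in M. \<bar>Z 1 \<omega>\<bar> > lam n)) ^ j)"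

text \<open>
  The push-forward under \<open>h_map j\<close> of the product of \<open>\<nu>\<^sup>j\<close> and Lebesgue measure, where the
  product is restricted to the domain of \<open>h_map j\<close>, i.e. to increasing time vectors.
\<close>
definition limit_measure :: "real measure \<Rightarrow> nat \<Rightarrow> (real \<Rightarrow> real) measure" where
  "limit_measure \<nu> j =
     distr (restrict_space ((\<Pi>\<^sub>M i\<in>{1..j}. \<nu>) \<Otimes>\<^sub>M (\<Pi>\<^sub>M i\<in>{1..j}. lborel))
              (({1..j} \<rightarrow>\<^sub>E - {0}) \<times> U_up j))
       skorohod_borel (h_map j)"

end

theory Submission imports Defs
begin

text \<open>
  The theorem is a quantitative form of the principle that a heavy-tailed walk is large because of a
  few big jumps. A step function at a positive distance from \<open>D_le (j - 1)\<close> has at least \<open>j\<close> jumps. Each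
  big jump costs a factor \<open>n * P(\<bar>Z 1\<bar> > lam n)\<close>, called \<open>big_rate n\<close> below, which tends to zero, but it
  is far more expensive to replace a big jump by an accumulation of small ones. So the cheapest way to
  stay away from \<open>D_le (j - 1)\<close> is to have exactly \<open>j\<close> big jumps, and the scaling by \<open>gamma_seq\<close>
  compensates precisely for their probability.

  Fix \<open>\<epsilon> > 0\<close> and call a step big if it exceeds \<open>\<delta> * lam n\<close> in absolute value, where \<open>\<delta>\<close> is small
  compared with \<open>\<epsilon>\<close>. The proof rests on three estimates.

  \<^item> The sum of the small steps stays below \<open>\<epsilon> * lam n\<close> except on an event whose probability is
    negligible against any power of \<open>big_rate n\<close> (\<open>small_jumps_negligible\<close>). Kolmogorov's inequality
    gives a bound by a negative power of \<open>n\<close>. As the steps are bounded by \<open>\<delta> * lam n\<close>, the walk can only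
    get to level \<open>\<epsilon> * lam n\<close> through \<open>r\<close> consecutive passages of a fixed fraction of it, which raises the
    bound to the power \<open>r\<close> (\<open>exceed_power\<close>). On the other hand \<open>big_rate n\<close> is bounded from below by some
    negative power of \<open>n\<close> (\<open>big_rate_lower\<close>). The hypotheses on \<open>\<rho>\<close> enter through an exponent \<open>\<beta>\<close> with
    \<open>\<beta> * \<rho> > 1\<close> for which \<open>Z 1\<close> has a moment (\<open>moment_exponent\<close>).

  \<^item> More than \<open>j\<close> big steps have probability of order \<open>big_rate n ^ (j + 1)\<close>, whereas fewer than \<open>j\<close>
    big steps keep the walk close to \<open>D_le (j - 1)\<close>. So up to negligible errors the walk is within \<open>\<epsilon>\<close> of
    the path formed by exactly \<open>j\<close> big steps (\<open>prob_path_upper\<close>, \<open>prob_path_lower\<close>).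

  \<^item> Given the positions of \<open>j\<close> big steps, their sizes are independent with the conditional law of a
    big step (\<open>sum_big_paths\<close>). By regular variation and tail balance this law converges weakly to the
    normalized restriction of \<open>\<nu>\<close> to \<open>\<bar>x\<bar> > \<delta>\<close>. Skorohod's representation makes the sizes converge
    pointwise, and the positions are obtained from uniform times by rounding up to the grid, so that
    the positions converge pointwise, too. As \<open>h_map j\<close> is continuous where no jump time is \<open>0\<close> or \<open>1\<close>
    (\<open>h_map_continuous\<close>; a time at \<open>1\<close> stays there on rounding), the coupled step functions converge in
    the metric \<open>d_J1\<close> whenever the times are positive and increasing. Fatou's lemma then compares
    probabilities before and in the limit (\<open>coupling_nbhd_upper\<close>, \<open>coupling_core_lower\<close>).

  The limit of the coupling is the limit measure: on sets farther than \<open>\<delta>\<close> from \<open>D_le (j - 1)\<close> only jumps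
  beyond \<open>\<delta>\<close> contribute, and the mass of these jumps under \<open>\<nu>\<close> supplies the normalizing
  constant (\<open>emeasure_limit_measure\<close>). All comparisons lose a bit of distance: the limsup is bounded by the
  mass of a neighbourhood, the liminf by that of an inner parallel set. As \<open>\<epsilon>\<close> tends to zero, these
  shrink to a closed set or exhaust an open one.

  The topological part supplies the setting: \<open>d_J1\<close> is a metric, \<open>h_map j\<close> is Borel measurable, and
  \<open>D_le m\<close> is closed. The last of these holds because having more than \<open>m\<close> changes of value is an open
  condition (\<open>changes_open\<close>), which characterizes the complement (\<open>skorohod_minus_D_le\<close>).
\<close>

section \<open>The Skorohod metric\<close>

lemma time_changes_bij:
  assumes "l \<in> time_changes"
  shows "bij_betw l {0..1} {0..1}"
proof -
  have m: "strict_mono_on {0..1} l" and c: "continuous_on {0..1} l" and f: "l ` {0..1} \<subseteq> {0..1}"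
    and l: "l 0 = 0" "l 1 = 1"
    using assms by (auto simp: time_changes_def)
  have "{0..1} \<subseteq> l ` {0..1}"
  proof
    fix y :: real assume "y \<in> {0..1}"
    then show "y \<in> l ` {0..1}"
      using IVT'[of l 0 y 1] c l by auto
  qed
  then show ?thesis
    using f strict_mono_on_imp_inj_on[OF m] by (auto simp: bij_betw_def)
qed

lemma id_in_time_changes: "(\<lambda>t. t) \<in> time_changes"
  by (auto simp: time_changes_def strict_mono_on_def)

lemma time_changes_comp:
  assumes "l \<in> time_changes" "k \<in> time_changes"
  shows "(\<lambda>t. k (l t)) \<in> time_changes"
proof -
  have l: "l t \<in> {0..1}" if "t \<in> {0..1}" for t using assms(1) that by (auto simp: time_changes_def)
  have "continuous_on {0..1} (\<lambda>t. k (l t))"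
    using assms l by (intro continuous_on_compose2[of "{0..1}" k "{0..1}" l]) (auto simp: time_changes_def)
  moreover have "strict_mono_on {0..1} (\<lambda>t. k (l t))"
  proof (rule strict_mono_onI)
    fix r s :: real assume rs: "r \<in> {0..1}" "s \<in> {0..1}" "r < s"
    have ml: "strict_mono_on {0..1} l" and mk: "strict_mono_on {0..1} k"
      using assms by (simp_all add: time_changes_def)
    show "k (l r) < k (l s)"
      by (rule strict_mono_onD[OF mk l[OF rs(1)] l[OF rs(2)] strict_mono_onD[OF ml rs]])
  qed
  moreover have "k (l t) \<in> {0..1}" if "t \<in> {0..1}" for t
    using assms(2) l[OF that] by (auto simp: time_changes_def)
  ultimately show ?thesis using assms by (simp add: time_changes_def)
qed

lemma time_changes_inverse:
  assumes "l \<in> time_changes"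
  obtains k where "k \<in> time_changes" "\<And>t. t \<in> {0..1} \<Longrightarrow> k (l t) = t"
    "\<And>t. t \<in> {0..1} \<Longrightarrow> l (k t) = t"
proof
  define k where "k = inv_into {0..1} l"
  have bij: "bij_betw l {0..1} {0..1}" using assms by (rule time_changes_bij)
  show kl: "\<And>t. t \<in> {0..1} \<Longrightarrow> k (l t) = t"
    using bij by (simp add: k_def bij_betw_inv_into_left)
  show lk: "\<And>t. t \<in> {0..1} \<Longrightarrow> l (k t) = t"
    using bij by (simp add: k_def bij_betw_inv_into_right)
  have kr: "\<And>t. t \<in> {0..1} \<Longrightarrow> k t \<in> {0..1}"
    using bij_betwE[OF bij_betw_inv_into[OF bij]] by (simp add: k_def)
  have m: "strict_mono_on {0..1} l" and c: "continuous_on {0..1} l"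
    and l: "l 0 = 0" "l 1 = 1"
    using assms by (auto simp: time_changes_def)
  have "strict_mono_on {0..1} k"
  proof (rule strict_mono_onI)
    fix r s :: real assume rs: "r \<in> {0..1}" "s \<in> {0..1}" "r < s"
    show "k r < k s"
    proof (rule ccontr)
      assume "\<not> k r < k s"
      then have "l (k s) \<le> l (k r)"
        using kr rs strict_mono_on_leD[OF m, of "k s" "k r"] by auto
      then show False using lk rs by auto
    qed
  qed
  moreover have "continuous_on {0..1} k"
    using continuous_on_inv[OF c compact_Icc, of k] kl bij
    by (simp add: bij_betw_def)
  ultimately show "k \<in> time_changes"
    using kr kl[of 0] kl[of 1] l by (auto simp: time_changes_def)
qed

lemma bdd_dist_path:
  assumes "bounded (f ` {0..1::real})" "bounded (g ` {0..1::real})" "l ` {0..1} \<subseteq> {0..1::real}"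
  shows "bdd_above ((\<lambda>t. \<bar>f t - g (l t) :: real\<bar>) ` {0..1})"
proof -
  from assms(1) obtain a where a: "\<And>t. t \<in> {0..1} \<Longrightarrow> \<bar>f t\<bar> \<le> a"
    unfolding bounded_iff by (metis imageI real_norm_def)
  from assms(2) obtain b where b: "\<And>t. t \<in> {0..1} \<Longrightarrow> \<bar>g t\<bar> \<le> b"
    unfolding bounded_iff by (metis imageI real_norm_def)
  have "\<bar>f t - g (l t)\<bar> \<le> a + b" if "t \<in> {0..1}" for t
    using a[OF that] b[of "l t"] assms(3) that by fastforce
  then show ?thesis by (rule bdd_aboveI2)
qed

lemma bdd_time_shift:
  assumes "l \<in> time_changes"
  shows "bdd_above ((\<lambda>t. \<bar>l t - t\<bar>) ` {0..1::real})"
proof -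
  have "\<bar>l t - t\<bar> \<le> 1" if "t \<in> {0..1}" for t
    using assms that by (force simp: time_changes_def abs_le_iff)
  then show ?thesis by (rule bdd_aboveI2)
qed

text \<open>A function with one-sided limits is locally bounded; bisection makes this global.\<close>
lemma skorohod_bounded:
  assumes "f \<in> skorohod"
  shows "bounded (f ` {0..1})"
proof -
  define P where "P a b \<longleftrightarrow> bounded (f ` ({a..b} \<inter> {0..1}))" for a b
  have "P 0 1"
  proof (rule Bolzano)
    show "(0::real) \<le> 1" by simp
    fix a b c :: real assume "P a b" "P b c" "a \<le> b" "b \<le> c"
    moreover have "f ` ({a..c} \<inter> {0..1}) \<subseteq> f ` ({a..b} \<inter> {0..1}) \<union> f ` ({b..c} \<inter> {0..1})"
      by (rule order_trans[OF image_mono[of _ "({a..b} \<inter> {0..1}) \<union> ({b..c} \<inter> {0..1})"]]) auto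
    ultimately show "P a c" unfolding P_def by (meson bounded_Un bounded_subset)
  next
    fix x :: real assume x: "0 \<le> x" "x \<le> 1"
    have "\<exists>d>0. \<exists>B. \<forall>y. x < y \<and> y < x + d \<and> y \<le> 1 \<longrightarrow> \<bar>f y\<bar> \<le> B"
    proof (cases "x < 1")
      case True
      then have "(f \<longlongrightarrow> f x) (at_right x)" using assms x by (auto simp: skorohod_def)
      then have "\<forall>\<^sub>F y in at_right x. dist (f y) (f x) < 1"
        by (rule tendstoD) simp
      then obtain b where "b > x" "\<And>y. x < y \<Longrightarrow> y < b \<Longrightarrow> dist (f y) (f x) < 1"
        unfolding eventually_at_right_field by auto
      then have "\<forall>y. x < y \<and> y < x + (b - x) \<and> y \<le> 1 \<longrightarrow> \<bar>f y\<bar> \<le> \<bar>f x\<bar> + 1"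
        by (force simp: dist_real_def)
      then show ?thesis using \<open>b > x\<close> by (intro exI[of _ "b - x"]) auto
    next
      case False
      then show ?thesis by (intro exI[of _ 1]) auto
    qed
    then obtain d B where d: "d > 0" "\<And>y. x < y \<Longrightarrow> y < x + d \<Longrightarrow> y \<le> 1 \<Longrightarrow> \<bar>f y\<bar> \<le> B" by blast
    have "\<exists>d>0. \<exists>B. \<forall>y. y < x \<and> x - d < y \<and> y \<ge> 0 \<longrightarrow> \<bar>f y\<bar> \<le> B"
    proof (cases "x > 0")
      case True
      then have "x \<in> {0<..1}" using x by simp
      then obtain l where "(f \<longlongrightarrow> l) (at_left x)" using assms unfolding skorohod_def by blast
      then have "\<forall>\<^sub>F y in at_left x. dist (f y) l < 1"
        by (rule tendstoD) simp
      then obtain b where "b < x" "\<And>y. b < y \<Longrightarrow> y < x \<Longrightarrow> dist (f y) l < 1"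
        unfolding eventually_at_left_field by auto
      then have "\<forall>y. y < x \<and> x - (x - b) < y \<and> y \<ge> 0 \<longrightarrow> \<bar>f y\<bar> \<le> \<bar>l\<bar> + 1"
        by (force simp: dist_real_def)
      then show ?thesis using \<open>b < x\<close> by (intro exI[of _ "x - b"]) auto
    next
      case False
      then show ?thesis by (intro exI[of _ 1]) auto
    qed
    then obtain d' B' where d': "d' > 0" "\<And>y. y < x \<Longrightarrow> x - d' < y \<Longrightarrow> 0 \<le> y \<Longrightarrow> \<bar>f y\<bar> \<le> B'" by blast
    show "\<exists>d>0. \<forall>a b. a \<le> x \<and> x \<le> b \<and> b - a < d \<longrightarrow> P a b"
    proof (intro exI[of _ "min d d'"] conjI allI impI)
      show "min d d' > 0" using d d' by simp
      fix a b :: real assume ab: "a \<le> x \<and> x \<le> b \<and> b - a < min d d'"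
      have "\<bar>f y\<bar> \<le> \<bar>B\<bar> + \<bar>B'\<bar> + \<bar>f x\<bar>" if "y \<in> {a..b} \<inter> {0..1}" for y
        using d(2)[of y] d'(2)[of y] ab that by (cases "y < x"; cases "y = x") auto
      then show "P a b" unfolding P_def bounded_iff by (intro exI[of _ "\<bar>B\<bar> + \<bar>B'\<bar> + \<bar>f x\<bar>"]) auto
    qed
  qed
  then show ?thesis by (simp add: P_def)
qed

definition time_cost :: "(real \<Rightarrow> real) \<Rightarrow> (real \<Rightarrow> real) \<Rightarrow> (real \<Rightarrow> real) \<Rightarrow> real" where
  "time_cost f g l = max (SUP t\<in>{0..1}. \<bar>f t - g (l t)\<bar>) (SUP t\<in>{0..1}. \<bar>l t - t\<bar>)"

lemma d_J1_eq: "d_J1 f g = (INF l\<in>time_changes. time_cost f g l)"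
  by (simp add: d_J1_def time_cost_def)

lemma time_cost_nonneg:
  assumes "l \<in> time_changes"
  shows "0 \<le> time_cost f g l"
proof -
  have "\<bar>l 0 - 0\<bar> \<le> (SUP t\<in>{0..1}. \<bar>l t - t\<bar>)"
    by (rule cSUP_upper[OF _ bdd_time_shift[OF assms]]) simp
  then show ?thesis by (simp add: time_cost_def)
qed

lemma time_cost_bdd: "bdd_below (time_cost f g ` time_changes)"
  by (rule bdd_belowI2[of _ 0]) (rule time_cost_nonneg)

lemma d_J1_le_cost: "l \<in> time_changes \<Longrightarrow> d_J1 f g \<le> time_cost f g l"
  unfolding d_J1_eq by (rule cINF_lower[OF time_cost_bdd])

lemma d_J1_leI:
  assumes "l \<in> time_changes" "\<And>t. t \<in> {0..1} \<Longrightarrow> \<bar>f t - g (l t)\<bar> \<le> e"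
    "\<And>t. t \<in> {0..1} \<Longrightarrow> \<bar>l t - t\<bar> \<le> e"
  shows "d_J1 f g \<le> e"
proof -
  have "time_cost f g l \<le> e"
    unfolding time_cost_def using assms(2,3) by (intro max.boundedI cSUP_least) auto
  then show ?thesis using d_J1_le_cost[OF assms(1)] order_trans by blast
qed

lemma d_J1_le_sup:
  assumes "\<And>t. t \<in> {0..1} \<Longrightarrow> \<bar>f t - g t\<bar> \<le> e" 
  shows "d_J1 f g \<le> e"
proof -
  have "0 \<le> e" using assms[of 0] by auto
  then show ?thesis using d_J1_leI[OF id_in_time_changes, of f g e] assms by auto
qed

lemma d_J1_lessD:
  assumes "d_J1 f g < e" "f \<in> skorohod" "g \<in> skorohod"
  shows "\<exists>l\<in>time_changes. \<forall>t\<in>{0..1}. \<bar>f t - g (l t)\<bar> < e \<and> \<bar>l t - t\<bar> < e"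
proof -
  have ne: "time_changes \<noteq> {}" using id_in_time_changes by blast
  obtain l where l: "l \<in> time_changes" "time_cost f g l < e"
    using assms(1) unfolding d_J1_eq by (subst (asm) cINF_less_iff[OF ne time_cost_bdd]) auto
  have im: "l ` {0..1} \<subseteq> {0..1}" using l(1) by (auto simp: time_changes_def)
  show ?thesis
  proof (intro bexI[of _ l] ballI conjI)
    show "l \<in> time_changes" by fact
    fix t :: real assume t: "t \<in> {0..1}"
    show "\<bar>f t - g (l t)\<bar> < e"
      using cSUP_upper[OF t bdd_dist_path[OF skorohod_bounded[OF assms(2)] skorohod_bounded[OF assms(3)] im]] l(2)
      by (simp add: time_cost_def)
    show "\<bar>l t - t\<bar> < e"
      using cSUP_upper[OF t bdd_time_shift[OF l(1)]] l(2) by (simp add: time_cost_def)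
  qed
qed

lemma time_cost_inverse:
  assumes "l \<in> time_changes" "k \<in> time_changes" "\<And>t. t \<in> {0..1} \<Longrightarrow> k (l t) = t"
  shows "time_cost g f k = time_cost f g l"
proof -
  have im: "l ` {0..1} = {0..1}" using time_changes_bij[OF assms(1)] by (simp add: bij_betw_def)
  have 1: "(\<lambda>t. \<bar>g t - f (k t)\<bar>) ` {0..1} = (\<lambda>t. \<bar>f t - g (l t)\<bar>) ` {0..1}"
  proof -
    have "(\<lambda>t. \<bar>g t - f (k t)\<bar>) ` {0..1} = (\<lambda>t. \<bar>g t - f (k t)\<bar>) ` (l ` {0..1})" by (simp add: im)
    also have "\<dots> = (\<lambda>t. \<bar>g (l t) - f (k (l t))\<bar>) ` {0..1}" by (simp add: image_image)
    also have "\<dots> = (\<lambda>t. \<bar>f t - g (l t)\<bar>) ` {0..1}"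
      by (intro image_cong) (auto simp: assms(3) abs_minus_commute)
    finally show ?thesis .
  qed
  have 2: "(\<lambda>t. \<bar>k t - t\<bar>) ` {0..1} = (\<lambda>t. \<bar>l t - t\<bar>) ` {0..1}"
  proof -
    have "(\<lambda>t. \<bar>k t - t\<bar>) ` {0..1} = (\<lambda>t. \<bar>k t - t\<bar>) ` (l ` {0..1})" by (simp add: im)
    also have "\<dots> = (\<lambda>t. \<bar>k (l t) - l t\<bar>) ` {0..1}" by (simp add: image_image)
    also have "\<dots> = (\<lambda>t. \<bar>l t - t\<bar>) ` {0..1}"
      by (intro image_cong) (auto simp: assms(3) abs_minus_commute)
    finally show ?thesis .
  qed
  show ?thesis by (simp add: time_cost_def 1 2)
qed

lemma d_J1_commute: "d_J1 f g = d_J1 g f"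
proof -
  have "d_J1 g f \<le> d_J1 f g" for f g
    unfolding d_J1_eq[of f g]
  proof (rule cINF_greatest)
    show "time_changes \<noteq> {}" using id_in_time_changes by blast
    fix l assume l: "l \<in> time_changes"
    obtain k where "k \<in> time_changes" "\<And>t. t \<in> {0..1} \<Longrightarrow> k (l t) = t"
      using time_changes_inverse[OF l] by metis
    then show "d_J1 g f \<le> time_cost f g l"
      using time_cost_inverse[OF l, of k g f] d_J1_le_cost[of k g f] by simp
  qed
  then show ?thesis by (metis order_antisym)
qed

text \<open>
  A time \<open>s\<close> slightly to the right of \<open>t\<close> is moved by a good time change to a time \<open>r\<close> that is still to
  the right of \<open>t\<close>, and \<open>f s\<close> is close to \<open>g r\<close>. By right-continuity these values are close to \<open>f t\<close> and
  \<open>g t\<close>. The end points are fixed by every time change.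
\<close>
lemma d_J1_zero_imp_eq:
  assumes "f \<in> skorohod" "g \<in> skorohod" "d_J1 f g = 0"
  shows "f = g"
proof -
  have ex: "\<exists>l. l 0 = 0 \<and> l 1 = 1 \<and> (\<forall>t\<in>{0..1}. l t \<in> {0..1} \<and> \<bar>f t - g (l t)\<bar> < e \<and> \<bar>l t - t\<bar> < e)" if "e > 0" for e
  proof -
    have "d_J1 f g < e" using assms(3) that by simp
    then obtain l where "l \<in> time_changes" "\<forall>t\<in>{0..1}. \<bar>f t - g (l t)\<bar> < e \<and> \<bar>l t - t\<bar> < e"
      using d_J1_lessD[OF _ assms(1,2)] by blast
    then show ?thesis by (intro exI[of _ l]) (auto simp: time_changes_def)
  qed
  have ends: "f t = g t" if "t = 0 \<or> t = 1" for t
  proof -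
    have "\<bar>f t - g t\<bar> \<le> 0"
    proof (rule field_le_epsilon)
      fix e :: real assume "e > 0"
      from ex[OF this] obtain l where l: "l 0 = 0" "l 1 = 1" "\<forall>t\<in>{0..1}. \<bar>f t - g (l t)\<bar> < e" by blast
      have "\<bar>f t - g (l t)\<bar> < e" using l(3) that by auto
      then show "\<bar>f t - g t\<bar> \<le> 0 + e" using that l by auto
    qed
    then show ?thesis by simp
  qed
  have mid: "f t = g t" if t: "0 < t" "t < 1" for t
  proof -
    have gr: "(g \<longlongrightarrow> g t) (at_right t)" and fr: "(f \<longlongrightarrow> f t) (at_right t)"
      using assms t by (auto simp: skorohod_def)
    have "\<bar>f t - g t\<bar> \<le> 0"
    proof (rule field_le_epsilon)
      fix e :: real assume e: "e > 0"
      have "\<forall>\<^sub>F s in at_right t. dist (g s) (g t) < e/3" "\<forall>\<^sub>F s in at_right t. dist (f s) (f t) < e/3"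
        using tendstoD[OF gr, of "e/3"] tendstoD[OF fr, of "e/3"] e by simp_all
      then have "\<forall>\<^sub>F s in at_right t. dist (g s) (g t) < e/3 \<and> dist (f s) (f t) < e/3"
        by eventually_elim auto
      then obtain b where b: "b > t" "\<And>s. t < s \<Longrightarrow> s < b \<Longrightarrow> dist (g s) (g t) < e/3 \<and> dist (f s) (f t) < e/3"
        unfolding eventually_at_right_field by auto
      have "t < min b 1" using b t by simp
      then obtain s where "t < s" "s < min b 1" using dense by blast
      then have s: "t < s" "s < b" "s < 1" by auto
      define e' where "e' = min (e/3) (min (s - t) (b - s))"
      have "e' > 0" using e s by (simp add: e'_def)
      from ex[OF this] obtain r where r: "\<bar>f s - g r\<bar> < e'" "\<bar>r - s\<bar> < e'" using s t by force
      have "t < r" "r < b" using r(2) by (auto simp: e'_def)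
      then have "dist (g r) (g t) < e/3" using b by auto
      moreover have "dist (f s) (f t) < e/3" using b s by auto
      moreover have "\<bar>f s - g r\<bar> < e/3" using r by (auto simp: e'_def)
      ultimately show "\<bar>f t - g t\<bar> \<le> 0 + e" unfolding dist_real_def by linarith
    qed
    then show ?thesis by simp
  qed
  show ?thesis
  proof (rule extensionalityI[of _ "{0..1}"])
    show "f \<in> extensional {0..1}" "g \<in> extensional {0..1}"
      using assms by (auto simp: skorohod_def)
    fix t :: real assume "t \<in> {0..1}"
    then show "f t = g t" using ends[of t] mid[of t] by fastforce
  qed
qed

lemma Metric_space_skorohod: "Metric_space skorohod d_J1"
proof
  fix f g :: "real \<Rightarrow> real"
  show "0 \<le> d_J1 f g"
    unfolding d_J1_eq using id_in_time_changes time_cost_nonneg by (intro cINF_greatest) auto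
  show "d_J1 f g = d_J1 g f" by (rule d_J1_commute)
next
  fix f g assume fg: "f \<in> skorohod" "g \<in> skorohod"
  have "d_J1 f f \<le> 0" by (rule d_J1_le_sup) simp
  moreover have "0 \<le> d_J1 f f"
    unfolding d_J1_eq using id_in_time_changes time_cost_nonneg by (intro cINF_greatest) auto
  ultimately show "d_J1 f g = 0 \<longleftrightarrow> f = g" using d_J1_zero_imp_eq[OF fg] by auto
next
  fix f g h assume fgh: "f \<in> skorohod" "g \<in> skorohod" "h \<in> skorohod"
  show "d_J1 f h \<le> d_J1 f g + d_J1 g h"
  proof (rule field_le_epsilon)
    fix e :: real assume "e > 0"
    then have lt: "d_J1 f g < d_J1 f g + e/2" "d_J1 g h < d_J1 g h + e/2" by auto
    obtain l where l: "l \<in> time_changes"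
        "\<forall>t\<in>{0..1}. \<bar>f t - g (l t)\<bar> < d_J1 f g + e/2 \<and> \<bar>l t - t\<bar> < d_J1 f g + e/2"
      using d_J1_lessD[OF lt(1) fgh(1,2)] by blast
    obtain k where k: "k \<in> time_changes"
        "\<forall>t\<in>{0..1}. \<bar>g t - h (k t)\<bar> < d_J1 g h + e/2 \<and> \<bar>k t - t\<bar> < d_J1 g h + e/2"
      using d_J1_lessD[OF lt(2) fgh(2,3)] by blast
    have lr: "l t \<in> {0..1}" if "t \<in> {0..1}" for t using l(1) that by (auto simp: time_changes_def)
    show "d_J1 f h \<le> d_J1 f g + d_J1 g h + e"
    proof (rule d_J1_leI[OF time_changes_comp[OF l(1) k(1)]])
      fix t :: real assume t: "t \<in> {0..1}"
      show "\<bar>f t - h (k (l t))\<bar> \<le> d_J1 f g + d_J1 g h + e"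
        using bspec[OF l(2) t] bspec[OF k(2) lr[OF t]] by linarith
      show "\<bar>k (l t) - t\<bar> \<le> d_J1 f g + d_J1 g h + e"
        using bspec[OF l(2) t] bspec[OF k(2) lr[OF t]] by linarith
    qed
  qed
qed

interpretation J1: Metric_space skorohod d_J1
  by (rule Metric_space_skorohod)

lemma openin_J1_subset: "{U. openin J1.mtopology U} \<subseteq> Pow skorohod"
proof -
  have "U \<subseteq> skorohod" if "openin J1.mtopology U" for U
    using openin_subset[OF that] unfolding J1.topspace_mtopology .
  then show ?thesis by blast
qed

lemma space_skorohod_borel: "space skorohod_borel = skorohod"
  unfolding borel_of_def J1.topspace_mtopology by (rule space_measure_of[OF openin_J1_subset])

lemma sets_skorohod_borel: "sets skorohod_borel = sigma_sets skorohod {U. openin J1.mtopology U}"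
  unfolding borel_of_def J1.topspace_mtopology by (rule sets_measure_of[OF openin_J1_subset])

lemma open_in_skorohod_borel: "openin J1.mtopology U \<Longrightarrow> U \<in> sets skorohod_borel"
  unfolding sets_skorohod_borel by (rule sigma_sets.Basic) simp

lemma closed_in_skorohod_borel:
  assumes "closedin J1.mtopology F" shows "F \<in> sets skorohod_borel"
proof -
  have "skorohod - F \<in> sets skorohod_borel"
    using assms by (intro open_in_skorohod_borel) (auto simp: closedin_def)
  then have "skorohod - (skorohod - F) \<in> sets skorohod_borel"
    using sets.compl_sets[of "skorohod - F" skorohod_borel] by (simp add: space_skorohod_borel)
  moreover have "F \<subseteq> skorohod" using closedin_subset[OF assms] by simp
  ultimately show ?thesis by (simp add: double_diff)
qed

definition nbhd :: "(real \<Rightarrow> real) set \<Rightarrow> real \<Rightarrow> (real \<Rightarrow> real) set" where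
  "nbhd A e = (\<Union>f\<in>A. J1.mball f e)"

text \<open>The inner parallel set: the points whose ball of radius \<open>e\<close> stays in \<open>A\<close>.\<close>
definition core_nbhd :: "(real \<Rightarrow> real) set \<Rightarrow> real \<Rightarrow> (real \<Rightarrow> real) set" where
  "core_nbhd A e = skorohod - nbhd (skorohod - A) e"

lemma nbhd_borel: "nbhd A e \<in> sets skorohod_borel"
proof (rule open_in_skorohod_borel)
  show "openin J1.mtopology (nbhd A e)"
    unfolding nbhd_def by (rule openin_Union) blast
qed

lemma core_nbhd_borel: "core_nbhd A e \<in> sets skorohod_borel"
  unfolding core_nbhd_def using sets.compl_sets[OF nbhd_borel] by (simp add: space_skorohod_borel)

lemma in_nbhdI:
  assumes "f \<in> A" "f \<in> skorohod" "g \<in> skorohod" "d_J1 f g < e"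
  shows "g \<in> nbhd A e"
  unfolding nbhd_def using assms by (intro UN_I[of f]) simp_all

lemma nbhd_mono: "e \<le> e' \<Longrightarrow> nbhd A e \<subseteq> nbhd A e'"
  unfolding nbhd_def using J1.mball_subset_concentric by blast

lemma core_nbhd_anti: "e \<le> e' \<Longrightarrow> core_nbhd A e' \<subseteq> core_nbhd A e"
  unfolding core_nbhd_def using nbhd_mono by blast

lemma core_nbhd_subset:
  assumes "e > 0" shows "core_nbhd A e \<subseteq> A"
proof
  fix f assume "f \<in> core_nbhd A e"
  then have f: "f \<in> skorohod" "f \<notin> nbhd (skorohod - A) e" by (simp_all add: core_nbhd_def)
  show "f \<in> A"
  proof (rule ccontr)
    assume "f \<notin> A"
    then have "f \<in> nbhd (skorohod - A) e" using f(1) assms by (intro in_nbhdI[of f]) simp_all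
    then show False using f(2) by simp
  qed
qed

lemma nbhd_trans: "nbhd (nbhd A d) e \<subseteq> nbhd A (d + e)"
proof
  fix h assume "h \<in> nbhd (nbhd A d) e"
  then obtain g f where gf: "f \<in> A" "g \<in> J1.mball f d" "h \<in> J1.mball g e" unfolding nbhd_def by blast
  then have "h \<in> J1.mball f (d + e)" using J1.triangle[of f g h] by auto
  then show "h \<in> nbhd A (d + e)" using gf(1) unfolding nbhd_def by blast
qed

lemma core_nbhdD:
  assumes "f \<in> core_nbhd A e" "g \<in> skorohod" "d_J1 f g < e" shows "g \<in> A"
proof (rule ccontr)
  assume "g \<notin> A"
  then have "f \<in> nbhd (skorohod - A) e"
    using assms by (intro in_nbhdI[of g]) (simp_all add: core_nbhd_def J1.commute[of g])
  then show False using assms(1) by (simp add: core_nbhd_def)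
qed

text \<open>
  The factor \<open>c\<close> keeps all the neighbourhoods within a given distance of the closed set, so that they
  have finite mass under the limit measure.
\<close>
lemma closed_eq_Inter_nbhd:
  assumes "closedin J1.mtopology F" "c > 0"
  shows "F = (\<Inter>k. nbhd F (c / real (Suc k)))"
proof
  show "F \<subseteq> (\<Inter>k. nbhd F (c / real (Suc k)))"
  proof (intro subsetI INT_I)
    fix f k assume "f \<in> F"
    moreover have "f \<in> skorohod" using closedin_subset[OF assms(1)] \<open>f \<in> F\<close> by auto
    ultimately show "f \<in> nbhd F (c / real (Suc k))" using assms(2) by (intro in_nbhdI[of f]) simp_all
  qed
  show "(\<Inter>k. nbhd F (c / real (Suc k))) \<subseteq> F"
  proof
    fix f assume f: "f \<in> (\<Inter>k. nbhd F (c / real (Suc k)))"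
    then have fS: "f \<in> skorohod" by (auto simp: nbhd_def)
    show "f \<in> F"
    proof (rule ccontr)
      assume "f \<notin> F"
      then obtain r where r: "r > 0" "disjnt F (J1.mball f r)"
        using assms(1) fS by (auto simp: J1.closedin_metric)
      have "(\<lambda>k. c / real (Suc k)) \<longlonglongrightarrow> 0"
        by (rule LIMSEQ_Suc) (rule lim_const_over_n)
      then have "\<forall>\<^sub>F k in sequentially. c / real (Suc k) < r"
        using r(1) by (rule order_tendstoD)
      then obtain k where k: "c / real (Suc k) < r" by (auto simp: eventually_sequentially)
      have "f \<in> nbhd F (c / real (Suc k))" using f by blast
      then obtain g where "g \<in> F" "g \<in> skorohod" "d_J1 g f < c / real (Suc k)"
        by (auto simp: nbhd_def)
      then have "g \<in> F \<inter> J1.mball f r" using k fS by (simp add: J1.commute)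
      then show False using r(2) by (auto simp: disjnt_def)
    qed
  qed
qed

lemma open_eq_Union_core:
  assumes "openin J1.mtopology G" "c > 0"
  shows "G = (\<Union>k. core_nbhd G (c / real (Suc k)))"
proof -
  have G: "G \<subseteq> skorohod" using openin_subset[OF assms(1)] by simp
  have "skorohod - G = (\<Inter>k. nbhd (skorohod - G) (c / real (Suc k)))"
    using assms by (intro closed_eq_Inter_nbhd) auto
  then show ?thesis unfolding core_nbhd_def using G by blast
qed

section \<open>Step functions\<close>

text \<open>
  The sequences that lie in \<open>U_up j\<close> on restriction to \<open>{1..j}\<close>. Values at other indices are free, so
  that sequences need not be restricted all the time.
\<close>
definition jump_times :: "nat \<Rightarrow> (nat \<Rightarrow> real) set" where
  "jump_times j = {u. (\<forall>i\<in>{1..j}. 0 \<le> u i \<and> u i \<le> 1) \<and> strict_mono_on {1..j} u}"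

lemma h_map_apply:
  "h_map j (z, u) = (\<lambda>t\<in>{0..1}. \<Sum>i=1..j. z i * indicator {u i ..} t)"
  by (simp add: h_map_def)

lemma h_map_at:
  "t \<in> {0..1} \<Longrightarrow> h_map j (z, u) t = (\<Sum>i=1..j. z i * indicator {u i ..} t)"
  by (simp add: h_map_def)

lemma h_map_cong:
  assumes "\<And>i. i \<in> {1..j} \<Longrightarrow> z i = z' i" "\<And>i. i \<in> {1..j} \<Longrightarrow> u i = u' i"
  shows "h_map j (z, u) = h_map j (z', u')"
  using assms by (auto simp: h_map_apply intro!: restrict_ext sum.cong)

lemma indicator_atLeast_right: "((\<lambda>s. indicator {a..} s :: real) \<longlongrightarrow> indicator {a..} t) (at_right (t::real))"
proof (rule tendsto_eventually)
  show "\<forall>\<^sub>F s in at_right t. indicator {a..} s = (indicator {a..} t :: real)"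
  proof (cases "a \<le> t")
    case True
    then show ?thesis unfolding eventually_at_right_field
      by (intro exI[of _ "t+1"]) (auto simp: indicator_def)
  next
    case False
    then show ?thesis unfolding eventually_at_right_field
      by (intro exI[of _ a]) (auto simp: indicator_def)
  qed
qed

lemma indicator_atLeast_left: "((\<lambda>s. indicator {a..} s :: real) \<longlongrightarrow> indicator {a<..} t) (at_left (t::real))"
proof (rule tendsto_eventually)
  show "\<forall>\<^sub>F s in at_left t. indicator {a..} s = (indicator {a<..} t :: real)"
  proof (cases "a < t")
    case True
    then show ?thesis unfolding eventually_at_left_field
      by (intro exI[of _ a]) (auto simp: indicator_def)
  next
    case False
    then show ?thesis unfolding eventually_at_left_field
      by (intro exI[of _ "t-1"]) (auto simp: indicator_def)
  qed
qed

lemma h_map_skorohod: "h_map j (z, u) \<in> skorohod"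
proof -
  let ?s = "\<lambda>t. \<Sum>i=1..j. z i * indicator {u i ..} t"
  have R: "(h_map j (z,u) \<longlongrightarrow> h_map j (z,u) t) (at_right t)" if t: "t \<in> {0..<1}" for t
  proof -
    have "(?s \<longlongrightarrow> ?s t) (at_right t)"
      by (intro tendsto_intros indicator_atLeast_right)
    moreover have "\<forall>\<^sub>F s in at_right t. ?s s = h_map j (z,u) s"
      unfolding eventually_at_right_field using t by (intro exI[of _ 1]) (auto simp: h_map_apply)
    ultimately have "(h_map j (z,u) \<longlongrightarrow> ?s t) (at_right t)"
      by (rule Lim_transform_eventually)
    then show ?thesis using t by (simp add: h_map_apply)
  qed
  have L: "\<exists>l. (h_map j (z,u) \<longlongrightarrow> l) (at_left t)" if t: "t \<in> {0<..1}" for t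
  proof -
    have "(?s \<longlongrightarrow> (\<Sum>i=1..j. z i * indicator {u i <..} t)) (at_left t)"
      by (intro tendsto_intros indicator_atLeast_left)
    moreover have "\<forall>\<^sub>F s in at_left t. ?s s = h_map j (z,u) s"
      unfolding eventually_at_left_field using t by (intro exI[of _ 0]) (auto simp: h_map_apply)
    ultimately have "(h_map j (z,u) \<longlongrightarrow> (\<Sum>i=1..j. z i * indicator {u i <..} t)) (at_left t)"
      by (rule Lim_transform_eventually)
    then show ?thesis by blast
  qed
  show ?thesis unfolding skorohod_def using R L by (auto simp: h_map_apply)
qed

lemma h_map_reindex:
  assumes "inj_on k {1..m}" "k ` {1..m} \<subseteq> {1..n}" "\<And>i. i \<in> {1..n} - k ` {1..m} \<Longrightarrow> z i = 0"
  shows "h_map n (z, u) = h_map m (\<lambda>i. z (k i), \<lambda>i. u (k i))"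
proof -
  have "(\<Sum>i=1..n. z i * indicator {u i ..} t) = (\<Sum>i=1..m. z (k i) * indicator {u (k i) ..} t)" for t
  proof -
    have "(\<Sum>i=1..n. z i * indicator {u i ..} t) = (\<Sum>i\<in>k ` {1..m}. z i * indicator {u i ..} t)"
      using assms by (intro sum.mono_neutral_right) auto
    also have "\<dots> = (\<Sum>i=1..m. z (k i) * indicator {u (k i) ..} t)"
      by (simp only: sum.reindex[OF assms(1)] o_def)
    finally show ?thesis .
  qed
  then show ?thesis by (simp add: h_map_apply)
qed

lemma strict_mono_enumeration:
  assumes "finite (K :: nat set)"
  obtains k where "bij_betw k {1..card K} K" "strict_mono_on {1..card K} k"
proof -
  obtain h where h: "bij_betw h {..<card K} K" "strict_mono_on {..<card K} h"
    using ex_bij_betw_strict_mono_card[OF assms] by blast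
  have b: "bij_betw (\<lambda>i. i - 1) {1..card K} {..<card K}"
    by (rule bij_betw_byWitness[of _ Suc]) auto
  show ?thesis
  proof
    show "bij_betw (h \<circ> (\<lambda>i. i - 1)) {1..card K} K"
      using b h(1) by (rule bij_betw_trans)
    show "strict_mono_on {1..card K} (h \<circ> (\<lambda>i. i - 1))"
    proof (rule strict_mono_onI)
      fix r s assume "r \<in> {1..card K}" "s \<in> {1..card K}" "r < s"
      then have "r - 1 \<in> {..<card K}" "s - 1 \<in> {..<card K}" "r - 1 < s - 1" by auto
      then show "(h \<circ> (\<lambda>i. i - 1)) r < (h \<circ> (\<lambda>i. i - 1)) s" using strict_mono_onD[OF h(2)] by simp
    qed
  qed
qed

text \<open>Jumps of size zero may be dropped: \<open>D_eq\<close> counts only the effective ones.\<close>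
lemma h_map_in_D_eq:
  assumes u: "u \<in> jump_times n"
  shows "h_map n (z, u) \<in> D_eq (card {i\<in>{1..n}. z i \<noteq> 0})"
proof -
  define K where "K = {i\<in>{1..n}. z i \<noteq> 0}"
  define m where "m = card K"
  have "finite K" by (simp add: K_def)
  then obtain k where k: "bij_betw k {1..m} K" "strict_mono_on {1..m} k"
    unfolding m_def by (rule strict_mono_enumeration)
  have kK: "k i \<in> K" if "i \<in> {1..m}" for i using k(1) that by (auto simp: bij_betw_def)
  have eq: "h_map n (z, u) = h_map m (\<lambda>i. z (k i), \<lambda>i. u (k i))"
    using k(1) by (intro h_map_reindex) (auto simp: bij_betw_def K_def)
  show ?thesis
  proof (cases "m = 0")
    case True
    then show ?thesis using eq by (simp add: D_eq_def h_map_apply K_def m_def)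
  next
    case False
    have "h_map n (z, u) = h_map m (\<lambda>i\<in>{1..m}. z (k i), \<lambda>i\<in>{1..m}. u (k i))"
      unfolding eq by (rule h_map_cong) auto
    moreover have "(\<lambda>i\<in>{1..m}. z (k i)) \<in> {1..m} \<rightarrow>\<^sub>E - {0}"
      using kK by (auto simp: K_def)
    moreover have "(\<lambda>i\<in>{1..m}. u (k i)) \<in> U_up m"
      using kK u k(2) by (fastforce simp: U_up_def jump_times_def K_def strict_mono_on_def)
    ultimately show ?thesis
      using False unfolding D_eq_def m_def K_def by auto
  qed
qed

lemma h_map_in_D_le:
  assumes "u \<in> jump_times n" "card {i\<in>{1..n}. z i \<noteq> 0} \<le> m"
  shows "h_map n (z, u) \<in> D_le m"
  using h_map_in_D_eq[OF assms(1), of z] assms(2) by (auto simp: D_le_def)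

lemma D_leE:
  assumes "f \<in> D_le m"
  obtains k z u where "k \<le> m" "u \<in> jump_times k" "f = h_map k (z, u)"
proof -
  from assms obtain k where k: "k \<le> m" "f \<in> D_eq k" by (auto simp: D_le_def)
  show ?thesis
  proof (cases "k = 0")
    case True
    have "f = h_map 0 (\<lambda>_. 0, \<lambda>_. 0)" "(\<lambda>_. 0) \<in> jump_times 0"
      using k True by (auto simp: D_eq_def h_map_apply jump_times_def strict_mono_on_def)
    then show ?thesis using that[of 0] by blast
  next
    case False
    then obtain z u where "u \<in> U_up k" "f = h_map k (z,u)" using k by (auto simp: D_eq_def)
    moreover have "u \<in> jump_times k" using \<open>u \<in> U_up k\<close>
      by (auto simp: U_up_def jump_times_def PiE_iff Ball_def)
    ultimately show ?thesis using that k by blast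
  qed
qed

lemma D_le_subset: "D_le m \<subseteq> skorohod"
  using h_map_skorohod by (auto elim!: D_leE)

lemma d_J1_h_map_jumps: "d_J1 (h_map j (x, u)) (h_map j (y, u)) \<le> (\<Sum>i=1..j. \<bar>x i - y i\<bar>)"
proof (rule d_J1_le_sup)
  fix t :: real assume t: "t \<in> {0..1}"
  have "\<bar>h_map j (x,u) t - h_map j (y,u) t\<bar> = \<bar>\<Sum>i=1..j. (x i - y i) * indicator {u i ..} t\<bar>"
    using t by (simp add: h_map_apply sum_subtractf left_diff_distrib)
  also have "\<dots> \<le> (\<Sum>i=1..j. \<bar>x i - y i\<bar>)"
    by (rule order_trans[OF sum_abs]) (auto intro!: sum_mono simp: indicator_def)
  finally show "\<bar>h_map j (x,u) t - h_map j (y,u) t\<bar> \<le> (\<Sum>i=1..j. \<bar>x i - y i\<bar>)" .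
qed

text \<open>
  The graph of the time change is the diagonal with a tent of height \<open>v i - u i\<close> put on top of it
  at each \<open>u i\<close>. The tents have width \<open>\<eta>\<close>, so they do not reach the other nodes, and they are
  so low that the sum of their slopes stays below one.
\<close>
lemma tent_time_change:
  fixes u v :: "'i \<Rightarrow> real"
  assumes fin: "finite I" and eta: "\<eta> > 0"
    and gap: "\<And>i k. i \<in> I \<Longrightarrow> k \<in> I \<Longrightarrow> i \<noteq> k \<Longrightarrow> \<eta> \<le> \<bar>u i - u k\<bar>"
    and edge: "\<And>i. i \<in> I \<Longrightarrow> v i = u i \<or> \<eta> \<le> u i \<and> u i \<le> 1 - \<eta>"
    and small: "(\<Sum>i\<in>I. \<bar>v i - u i\<bar>) < \<eta>"
  obtains l where "l \<in> time_changes" "\<And>i. i \<in> I \<Longrightarrow> l (u i) = v i"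
    "\<And>t. \<bar>l t - t\<bar> \<le> (\<Sum>i\<in>I. \<bar>v i - u i\<bar>)"
proof
  define tent where "tent i t = max 0 (1 - \<bar>t - u i\<bar> / \<eta>)" for i t
  define l where "l t = t + (\<Sum>i\<in>I. (v i - u i) * tent i t)" for t
  have tent01: "0 \<le> tent i t" "tent i t \<le> 1" for i t using eta by (auto simp: tent_def)
  have lip: "\<bar>tent i t - tent i s\<bar> \<le> \<bar>t - s\<bar> / \<eta>" for i s t
  proof -
    have "\<bar>max 0 (1 - a) - max 0 (1 - b)\<bar> \<le> \<bar>a - b\<bar>" for a b :: real by (auto simp: max_def)
    then have "\<bar>tent i t - tent i s\<bar> \<le> \<bar>\<bar>t - u i\<bar> / \<eta> - \<bar>s - u i\<bar> / \<eta>\<bar>" unfolding tent_def .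
    also have "\<dots> = \<bar>\<bar>t - u i\<bar> - \<bar>s - u i\<bar>\<bar> / \<eta>" using eta by (simp add: diff_divide_distrib[symmetric])
    also have "\<dots> \<le> \<bar>t - s\<bar> / \<eta>" using eta by (intro divide_right_mono) auto
    finally show ?thesis .
  qed
  have far: "tent i t = 0" if "\<eta> \<le> \<bar>t - u i\<bar>" for i t
    using that eta by (simp add: tent_def field_simps)
  show le: "\<bar>l t - t\<bar> \<le> (\<Sum>i\<in>I. \<bar>v i - u i\<bar>)" for t
  proof -
    have "\<bar>l t - t\<bar> = \<bar>\<Sum>i\<in>I. (v i - u i) * tent i t\<bar>" by (simp add: l_def)
    also have "\<dots> \<le> (\<Sum>i\<in>I. \<bar>v i - u i\<bar>)"
      by (rule order_trans[OF sum_abs]) (auto intro!: sum_mono simp: abs_mult tent01 mult_left_le)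
    finally show ?thesis .
  qed
  have node: "l (u k) = v k" if k: "k \<in> I" for k
  proof -
    have "(\<Sum>i\<in>I. (v i - u i) * tent i (u k)) = (\<Sum>i\<in>{k}. (v i - u i) * tent i (u k))"
      using fin k gap[OF k] far by (intro sum.mono_neutral_right) auto
    then show ?thesis by (simp add: l_def tent_def)
  qed
  then show "\<And>i. i \<in> I \<Longrightarrow> l (u i) = v i" .
  have incr: "l s < l t" if "s < t" for s t
  proof -
    have "\<bar>(\<Sum>i\<in>I. (v i - u i) * tent i t) - (\<Sum>i\<in>I. (v i - u i) * tent i s)\<bar>
        = \<bar>\<Sum>i\<in>I. (v i - u i) * (tent i t - tent i s)\<bar>"
      by (simp add: sum_subtractf right_diff_distrib)
    also have "\<dots> \<le> (\<Sum>i\<in>I. \<bar>v i - u i\<bar> * (\<bar>t - s\<bar> / \<eta>))"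
      by (rule order_trans[OF sum_abs], rule sum_mono, unfold abs_mult, rule mult_left_mono[OF lip]) simp
    also have "\<dots> = (\<Sum>i\<in>I. \<bar>v i - u i\<bar>) / \<eta> * (t - s)"
      using that by (simp add: sum_distrib_right sum_divide_distrib)
    also have "\<dots> < 1 * (t - s)"
      using small eta that by (intro mult_strict_right_mono) auto
    finally show ?thesis by (simp add: l_def)
  qed
  have l0: "l 0 = 0"
  proof -
    have "(v i - u i) * tent i 0 = 0" if "i \<in> I" for i
    proof -
      have "v i = u i \<or> \<eta> \<le> \<bar>0 - u i\<bar>" using edge[OF that] eta by linarith
      then show ?thesis using far[of 0 i] by auto
    qed
    then have "(\<Sum>i\<in>I. (v i - u i) * tent i 0) = 0" by (intro sum.neutral ballI)
    then show ?thesis by (simp only: l_def add_0_right)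
  qed
  have l1: "l 1 = 1"
  proof -
    have "(v i - u i) * tent i 1 = 0" if "i \<in> I" for i
    proof -
      have "v i = u i \<or> \<eta> \<le> \<bar>1 - u i\<bar>" using edge[OF that] eta by linarith
      then show ?thesis using far[of 1 i] by auto
    qed
    then have "(\<Sum>i\<in>I. (v i - u i) * tent i 1) = 0" by (intro sum.neutral ballI)
    then show ?thesis by (simp only: l_def add_0_right)
  qed
  have "continuous_on {0..1} l"
    unfolding l_def tent_def using eta by (intro continuous_intros) auto
  moreover have "l t \<in> {0..1}" if "t \<in> {0..1}" for t
  proof -
    have "t = 0 \<or> 0 < t" "t = 1 \<or> t < 1" using that by auto
    then show ?thesis using incr[of 0 t] incr[of t 1] l0 l1 by auto
  qed
  ultimately show "l \<in> time_changes"
    using incr l0 l1 by (auto simp: time_changes_def strict_mono_on_def)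
qed

lemma time_changes_le_iff:
  assumes "l \<in> time_changes" "s \<in> {0..1}" "t \<in> {0..1}"
  shows "l s \<le> l t \<longleftrightarrow> s \<le> t"
  using assms strict_mono_on_less_eq[of "{0..1}" l s t] by (auto simp: time_changes_def)

text \<open>
  Nearby step functions are matched by a time change that carries the old jump times to the new
  ones. A jump at time \<open>0\<close> or \<open>1\<close> cannot be moved into the interior by a time change, hence the
  assumption \<open>edge\<close>.
\<close>
lemma h_map_continuous:
  assumes u: "u \<in> jump_times j"
    and X: "\<And>i. i \<in> {1..j} \<Longrightarrow> ((\<lambda>a. X a i) \<longlongrightarrow> x i) F"
    and V: "\<And>i. i \<in> {1..j} \<Longrightarrow> ((\<lambda>a. V a i) \<longlongrightarrow> u i) F"
    and edge: "\<forall>\<^sub>F a in F. \<forall>i\<in>{1..j}. u i = 0 \<or> u i = 1 \<longrightarrow> V a i = u i"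
    and e: "e > 0"
  shows "\<forall>\<^sub>F a in F. d_J1 (h_map j (x, u)) (h_map j (X a, V a)) < e"
proof -
  \<comment> \<open>The gaps between the jump times and between them and the boundary; \<open>1\<close> makes the set nonempty.\<close>
  define G where "G = {1} \<union> {\<bar>u i - u k\<bar> | i k. i \<in> {1..j} \<and> k \<in> {1..j} \<and> i \<noteq> k}
      \<union> {u i | i. i \<in> {1..j} \<and> u i \<noteq> 0} \<union> {1 - u i | i. i \<in> {1..j} \<and> u i \<noteq> 1}"
  have "{\<bar>u i - u k\<bar> | i k. i \<in> {1..j} \<and> k \<in> {1..j} \<and> i \<noteq> k} \<subseteq> (\<lambda>(i,k). \<bar>u i - u k\<bar>) ` ({1..j} \<times> {1..j})"
    by auto
  then have "finite {\<bar>u i - u k\<bar> | i k. i \<in> {1..j} \<and> k \<in> {1..j} \<and> i \<noteq> k}"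
    by (rule finite_subset) auto
  then have finG: "finite G" by (auto simp: G_def)
  have inj: "inj_on u {1..j}"
    using u by (auto simp: jump_times_def intro: strict_mono_on_imp_inj_on)
  have u01: "0 \<le> u i" "u i \<le> 1" if "i \<in> {1..j}" for i using u that by (auto simp: jump_times_def)
  have posG: "g > 0" if "g \<in> G" for g
  proof -
    from that consider "g = 1" | i k where "g = \<bar>u i - u k\<bar>" "i \<in> {1..j}" "k \<in> {1..j}" "i \<noteq> k"
      | i where "g = u i" "i \<in> {1..j}" "u i \<noteq> 0" | i where "g = 1 - u i" "i \<in> {1..j}" "u i \<noteq> 1"
      unfolding G_def by blast
    then show ?thesis
    proof cases
      case 2
      then have "u i \<noteq> u k" using inj by (auto dest: inj_onD)
      then show ?thesis using 2 by simp
    next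
      case 3 then show ?thesis using u01(1)[of i] by simp
    next
      case 4 then show ?thesis using u01(2)[of i] by simp
    qed simp
  qed
  define \<eta> where "\<eta> = Min G"
  have eta: "\<eta> > 0" using finG posG by (auto simp: \<eta>_def G_def)
  have etaG: "\<eta> \<le> g" if "g \<in> G" for g using finG that by (simp add: \<eta>_def)
  have "((\<lambda>a. \<Sum>i=1..j. \<bar>V a i - u i\<bar>) \<longlongrightarrow> (\<Sum>i=1..j. \<bar>u i - u i\<bar>)) F"
    by (intro tendsto_intros V)
  then have ev1: "\<forall>\<^sub>F a in F. (\<Sum>i=1..j. \<bar>V a i - u i\<bar>) < min \<eta> (e/2)"
    using eta e by (intro order_tendstoD(2)[of _ 0]) auto
  have "((\<lambda>a. \<Sum>i=1..j. \<bar>x i - X a i\<bar>) \<longlongrightarrow> (\<Sum>i=1..j. \<bar>x i - x i\<bar>)) F"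
    by (intro tendsto_intros X)
  then have ev2: "\<forall>\<^sub>F a in F. (\<Sum>i=1..j. \<bar>x i - X a i\<bar>) < e/2"
    using e by (intro order_tendstoD(2)[of _ 0]) auto
  from ev1 ev2 edge show ?thesis
  proof eventually_elim
    case (elim a)
    obtain l where l: "l \<in> time_changes" "\<And>i. i \<in> {1..j} \<Longrightarrow> l (u i) = V a i"
      "\<And>t. \<bar>l t - t\<bar> \<le> (\<Sum>i=1..j. \<bar>V a i - u i\<bar>)"
    proof (rule tent_time_change[of "{1..j}" \<eta> u "V a"])
      show "finite {1..j}" "\<eta> > 0" by (auto intro: eta)
      show "\<And>i k. i \<in> {1..j} \<Longrightarrow> k \<in> {1..j} \<Longrightarrow> i \<noteq> k \<Longrightarrow> \<eta> \<le> \<bar>u i - u k\<bar>"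
        by (rule etaG) (auto simp: G_def)
      fix i assume i: "i \<in> {1..j}"
      show "V a i = u i \<or> \<eta> \<le> u i \<and> u i \<le> 1 - \<eta>"
      proof (cases "u i = 0 \<or> u i = 1")
        case True then show ?thesis using elim(3) i by blast
      next
        case False
        then have "\<eta> \<le> u i" "\<eta> \<le> 1 - u i" using i by (auto intro!: etaG simp: G_def)
        then show ?thesis by simp
      qed
    next
      show "(\<Sum>i=1..j. \<bar>V a i - u i\<bar>) < \<eta>" using elim(1) by simp
    qed blast
    have "d_J1 (h_map j (x, u)) (h_map j (X a, V a))
        \<le> max (\<Sum>i=1..j. \<bar>x i - X a i\<bar>) (\<Sum>i=1..j. \<bar>V a i - u i\<bar>)"
    proof (rule d_J1_leI[OF l(1)])
      fix t :: real assume t: "t \<in> {0..1}"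
      then have lt: "l t \<in> {0..1}" using l(1) by (auto simp: time_changes_def)
      have ind: "(indicator {V a i ..} (l t) :: real) = indicator {u i ..} t" if "i \<in> {1..j}" for i
        using time_changes_le_iff[OF l(1), of "u i" t] l(2)[OF that] u01[OF that] t
        by (auto simp: indicator_def)
      have "\<bar>h_map j (x,u) t - h_map j (X a, V a) (l t)\<bar> = \<bar>\<Sum>i=1..j. (x i - X a i) * indicator {u i ..} t\<bar>"
      proof -
        have "(\<Sum>i=1..j. X a i * indicator {V a i ..} (l t)) = (\<Sum>i=1..j. X a i * indicator {u i ..} t)"
          by (intro sum.cong refl) (simp only: ind)
        then show ?thesis
          unfolding h_map_at[OF t] h_map_at[OF lt] by (simp only: sum_subtractf left_diff_distrib)
      qed
      also have "\<dots> \<le> (\<Sum>i=1..j. \<bar>x i - X a i\<bar>)"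
        by (rule order_trans[OF sum_abs]) (auto intro!: sum_mono simp: indicator_def)
      finally show "\<bar>h_map j (x,u) t - h_map j (X a, V a) (l t)\<bar>
          \<le> max (\<Sum>i=1..j. \<bar>x i - X a i\<bar>) (\<Sum>i=1..j. \<bar>V a i - u i\<bar>)" by simp
      show "\<bar>l t - t\<bar> \<le> max (\<Sum>i=1..j. \<bar>x i - X a i\<bar>) (\<Sum>i=1..j. \<bar>V a i - u i\<bar>)"
        using l(3)[of t] by simp
    qed
    then show ?case using elim(1,2) e by linarith
  qed
qed

section \<open>Measurability of the step function map\<close>

lemma measurable_coord [measurable]: "(\<lambda>u :: nat \<Rightarrow> real. u i) \<in> borel_measurable borel"
  by (intro borel_measurable_continuous_onI continuous_on_product_coordinates)

lemma jump_times_borel: "jump_times j \<in> sets borel"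
proof -
  have "jump_times j = {u\<in>space borel. (\<forall>i\<in>{1..j}. 0 \<le> u i \<and> u i \<le> 1) \<and>
      (\<forall>r\<in>{1..j}. \<forall>s\<in>{1..j}. r < s \<longrightarrow> u r < u s)}"
    by (auto simp: jump_times_def strict_mono_on_def)
  also have "\<dots> \<in> sets borel" by measurable
  finally show ?thesis .
qed

text \<open>
  The domain falls into finitely many Borel pieces, according to which of the times are \<open>0\<close> and
  which are \<open>1\<close>, and on each piece the map is continuous.
\<close>
lemma h_map_preimage_open:
  assumes "openin J1.mtopology U"
  shows "{p \<in> UNIV \<times> jump_times j. h_map j p \<in> U} \<in> sets borel"
proof -
  define W where "W P = {u \<in> jump_times j. {i\<in>{1..j}. u i = 0} = fst P \<and> {i\<in>{1..j}. u i = 1} = snd P}"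
    for P :: "nat set \<times> nat set"
  define Q where "Q P = {p \<in> UNIV \<times> W P. h_map j p \<in> U}" for P
  have "Q P \<in> sets borel" if P: "P \<in> Pow {1..j} \<times> Pow {1..j}" for P
  proof -
    have "W P = jump_times j \<inter> {u\<in>space borel. (\<forall>i\<in>{1..j}. u i = 0 \<longleftrightarrow> i \<in> fst P) \<and> (\<forall>i\<in>{1..j}. u i = 1 \<longleftrightarrow> i \<in> snd P)}"
      using P unfolding W_def by (auto simp: set_eq_iff)
    also have "\<dots> \<in> sets borel"
      by (intro sets.Int jump_times_borel) measurable
    finally have WB: "W P \<in> sets borel" .
    have "openin (top_of_set (UNIV \<times> W P)) (Q P)"
    proof (subst openin_subopen, intro ballI)
      fix p assume p: "p \<in> Q P"
      obtain x u where pe: "p = (x, u)" by force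
      have u: "u \<in> jump_times j" "u \<in> W P" using p by (auto simp: Q_def W_def pe)
      have hU: "h_map j (x,u) \<in> U" using p by (simp add: Q_def pe)
      then obtain e where e: "e > 0" "J1.mball (h_map j (x,u)) e \<subseteq> U"
        using assms by (auto simp: J1.openin_mtopology)
      have "\<forall>\<^sub>F q in at p within (UNIV \<times> W P). d_J1 (h_map j (x, u)) (h_map j (fst q, snd q)) < e"
      proof (rule h_map_continuous[OF u(1) _ _ _ e(1)])
        fix i
        have c: "continuous_on UNIV (\<lambda>q::(nat\<Rightarrow>real)\<times>(nat\<Rightarrow>real). fst q i)"
          by (rule continuous_on_compose2[OF continuous_on_product_coordinates[of i] continuous_on_fst]) (auto intro!: continuous_intros)
        have "isCont (\<lambda>q::(nat\<Rightarrow>real)\<times>(nat\<Rightarrow>real). fst q i) p"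
          using c open_UNIV unfolding continuous_on_eq_continuous_at[OF open_UNIV] by blast
        then have "((\<lambda>q. fst q i) \<longlongrightarrow> fst p i) (at p)" by (simp add: isCont_def)
        from tendsto_within_subset[OF this] show "((\<lambda>q. fst q i) \<longlongrightarrow> x i) (at p within UNIV \<times> W P)"
          by (auto simp: pe)
        have c: "continuous_on UNIV (\<lambda>q::(nat\<Rightarrow>real)\<times>(nat\<Rightarrow>real). snd q i)"
          by (rule continuous_on_compose2[OF continuous_on_product_coordinates[of i] continuous_on_snd]) (auto intro!: continuous_intros)
        have "isCont (\<lambda>q::(nat\<Rightarrow>real)\<times>(nat\<Rightarrow>real). snd q i) p"
          using c open_UNIV unfolding continuous_on_eq_continuous_at[OF open_UNIV] by blast
        then have "((\<lambda>q. snd q i) \<longlongrightarrow> snd p i) (at p)" by (simp add: isCont_def)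
        from tendsto_within_subset[OF this] show "((\<lambda>q. snd q i) \<longlongrightarrow> u i) (at p within UNIV \<times> W P)"
          by (auto simp: pe)
      next
        have "\<forall>i\<in>{1..j}. u i = 0 \<or> u i = 1 \<longrightarrow> snd q i = u i" if "q \<in> UNIV \<times> W P" for q
        proof -
          have "{i\<in>{1..j}. u i = 0} = {i\<in>{1..j}. snd q i = 0}" "{i\<in>{1..j}. u i = 1} = {i\<in>{1..j}. snd q i = 1}"
            using that u(2) by (auto simp only: W_def mem_Collect_eq mem_Times_iff)
          then show ?thesis by (metis (mono_tags, lifting) mem_Collect_eq)
        qed
        then show "\<forall>\<^sub>F q in at p within UNIV \<times> W P. \<forall>i\<in>{1..j}. u i = 0 \<or> u i = 1 \<longrightarrow> snd q i = u i"
          unfolding eventually_at_filter by (auto intro: always_eventually)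
      qed
      then have "\<forall>\<^sub>F q in at p within (UNIV \<times> W P). h_map j q \<in> U"
        by eventually_elim (use e(2) h_map_skorohod in auto)
      then obtain S where S: "open S" "p \<in> S" "\<And>q. q \<in> S \<Longrightarrow> q \<noteq> p \<Longrightarrow> q \<in> UNIV \<times> W P \<Longrightarrow> h_map j q \<in> U"
        unfolding eventually_at_topological by blast
      have "(UNIV \<times> W P) \<inter> S \<subseteq> Q P" using S(3) p by (auto simp: Q_def)
      moreover have "p \<in> (UNIV \<times> W P) \<inter> S" using p S by (auto simp: Q_def)
      moreover have "openin (top_of_set (UNIV \<times> W P)) ((UNIV \<times> W P) \<inter> S)"
        using S(1) by (rule openin_open_Int)
      ultimately show "\<exists>T. openin (top_of_set (UNIV \<times> W P)) T \<and> p \<in> T \<and> T \<subseteq> Q P" by blast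
    qed
    then obtain S where S: "open S" "Q P = (UNIV \<times> W P) \<inter> S" by (auto simp: openin_open)
    have "(UNIV :: (nat \<Rightarrow> real) set) \<times> W P \<in> sets (borel \<Otimes>\<^sub>M borel)" using WB by (intro pair_measureI) auto
    then have "(UNIV :: (nat \<Rightarrow> real) set) \<times> W P \<in> sets borel" by (simp only: borel_prod)
    then show ?thesis using S by auto
  qed
  then have "(\<Union>P\<in>Pow {1..j} \<times> Pow {1..j}. Q P) \<in> sets borel" by (intro sets.finite_UN) auto
  moreover have "{p \<in> UNIV \<times> jump_times j. h_map j p \<in> U} = (\<Union>P\<in>Pow {1..j} \<times> Pow {1..j}. Q P)"
  proof (intro set_eqI iffI)
    fix p assume p: "p \<in> {p \<in> UNIV \<times> jump_times j. h_map j p \<in> U}"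
    have "p \<in> Q ({i\<in>{1..j}. snd p i = 0}, {i\<in>{1..j}. snd p i = 1})"
      using p by (simp add: Q_def W_def mem_Times_iff)
    moreover have "({i\<in>{1..j}. snd p i = 0}, {i\<in>{1..j}. snd p i = 1}) \<in> Pow {1..j} \<times> Pow {1..j}" by blast
    ultimately show "p \<in> (\<Union>P\<in>Pow {1..j} \<times> Pow {1..j}. Q P)" by blast
  next
    fix p assume "p \<in> (\<Union>P\<in>Pow {1..j} \<times> Pow {1..j}. Q P)"
    then obtain P where "p \<in> Q P" by blast
    then show "p \<in> {p \<in> UNIV \<times> jump_times j. h_map j p \<in> U}" by (simp add: Q_def W_def mem_Times_iff)
  qed
  ultimately show ?thesis by simp
qed

text \<open>
  Only the first \<open>j\<close> coordinates matter to \<open>h_map j\<close>. Filling the others with zeros turns measurable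
  coordinates into a measurable map to the space of all sequences.
\<close>
lemma measurable_extend_zero:
  fixes f :: "'b \<Rightarrow> nat \<Rightarrow> real"
  assumes "\<And>i. i \<in> {1..j} \<Longrightarrow> (\<lambda>x. f x i) \<in> borel_measurable N"
  shows "(\<lambda>x i. if i \<in> {1..j} then f x i else 0) \<in> borel_measurable N"
proof (rule measurable_coordinatewise_then_product)
  fix i show "(\<lambda>x. if i \<in> {1..j} then f x i else 0) \<in> borel_measurable N"
    using assms by (cases "i \<in> {1..j}") (simp_all only: if_True if_False, simp)
qed

lemma h_map_measurable_compose:
  assumes X: "\<And>i. i \<in> {1..j} \<Longrightarrow> (\<lambda>\<omega>. X \<omega> i) \<in> borel_measurable N"
    and V: "\<And>i. i \<in> {1..j} \<Longrightarrow> (\<lambda>\<omega>. V \<omega> i) \<in> borel_measurable N"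
    and times: "\<And>\<omega>. \<omega> \<in> space N \<Longrightarrow> V \<omega> \<in> jump_times j"
  shows "(\<lambda>\<omega>. h_map j (X \<omega>, V \<omega>)) \<in> measurable N skorohod_borel"
proof -
  define q where "q \<omega> = ((\<lambda>i. if i \<in> {1..j} then X \<omega> i else 0), (\<lambda>i. if i \<in> {1..j} then V \<omega> i else 0))" for \<omega>
  have q: "q \<in> measurable N borel"
    unfolding q_def borel_prod[symmetric]
    by (intro measurable_Pair measurable_extend_zero X V)
  have hq: "h_map j (X \<omega>, V \<omega>) = h_map j (q \<omega>)" for \<omega>
    unfolding q_def by (rule h_map_cong) auto
  have qt: "q \<omega> \<in> UNIV \<times> jump_times j" if "\<omega> \<in> space N" for \<omega>
    using times[OF that] by (auto simp: q_def jump_times_def strict_mono_on_def)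
  show ?thesis
    unfolding borel_of_def
  proof (rule measurable_measure_of)
    show "{U. openin J1.mtopology U} \<subseteq> Pow (topspace J1.mtopology)"
      using openin_subset by blast
    show "(\<lambda>\<omega>. h_map j (X \<omega>, V \<omega>)) \<in> space N \<rightarrow> topspace J1.mtopology"
      by (auto simp: h_map_skorohod)
    fix U assume "U \<in> {U. openin J1.mtopology U}"
    then have "q -` {p \<in> UNIV \<times> jump_times j. h_map j p \<in> U} \<inter> space N \<in> sets N"
      using measurable_sets[OF q] h_map_preimage_open by blast
    also have "q -` {p \<in> UNIV \<times> jump_times j. h_map j p \<in> U} \<inter> space N
        = (\<lambda>\<omega>. h_map j (X \<omega>, V \<omega>)) -` U \<inter> space N"
      using qt hq by auto
    finally show "(\<lambda>\<omega>. h_map j (X \<omega>, V \<omega>)) -` U \<inter> space N \<in> sets N" .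
  qed
qed

section \<open>The random walk as a step function\<close>

definition grid :: "nat \<Rightarrow> nat \<Rightarrow> real" where
  "grid n i = real i / real n"

lemma grid_jump_times: "grid n \<in> jump_times n"
  by (auto simp: grid_def jump_times_def strict_mono_on_def field_simps)

lemma grid_apply_sum:
  assumes "t \<in> {0..1}"
  shows "(\<Sum>i=1..n. z i * indicator {grid n i ..} t) = (\<Sum>i=1..nat \<lfloor>real n * t\<rfloor>. (z i :: real))"
proof -
  have "real n * t \<le> real n * 1" using assms by (intro mult_left_mono) auto
  then have le: "nat \<lfloor>real n * t\<rfloor> \<le> n" by linarith
  have iff: "grid n i \<le> t \<longleftrightarrow> i \<le> nat \<lfloor>real n * t\<rfloor>" if "i \<in> {1..n}" for i
  proof -
    have "grid n i \<le> t \<longleftrightarrow> real i \<le> real n * t" using that by (simp add: grid_def field_simps)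
    also have "\<dots> \<longleftrightarrow> i \<le> nat \<lfloor>real n * t\<rfloor>"
      using assms by (simp add: le_nat_iff le_floor_iff)
    finally show ?thesis .
  qed
  have "(\<Sum>i=1..n. z i * indicator {grid n i ..} t) = (\<Sum>i=1..n. if i \<le> nat \<lfloor>real n * t\<rfloor> then z i else 0)"
    using iff by (intro sum.cong) (auto simp: indicator_def)
  also have "\<dots> = (\<Sum>i\<in>{i\<in>{1..n}. i \<le> nat \<lfloor>real n * t\<rfloor>}. z i)"
    by (simp only: sum.inter_filter[OF finite_atLeastAtMost])
  also have "{i\<in>{1..n}. i \<le> nat \<lfloor>real n * t\<rfloor>} = {1..nat \<lfloor>real n * t\<rfloor>}" using le by auto
  finally show ?thesis .
qed

lemma scaled_walk_eq_h_map:
  "(\<lambda>t\<in>{0..1}. walk Z n \<omega> t / lam n) = h_map n (\<lambda>i. Z i \<omega> / lam n, grid n)"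
proof -
  have "walk Z n \<omega> t / lam n = (\<Sum>i=1..n. (Z i \<omega> / lam n) * indicator {grid n i ..} t)" if "t \<in> {0..1}" for t
    unfolding grid_apply_sum[OF that] using that by (simp add: walk_def sum_divide_distrib)
  then show ?thesis unfolding h_map_apply by (intro restrict_ext) auto
qed

section \<open>Paths with few jumps form a closed set\<close>

text \<open>
  \<open>changes f k s v\<close>: from time \<open>s\<close> on the path \<open>f\<close>, thought to start from the value \<open>v\<close>, changes its
  value at least \<open>k\<close> times. Unlike the number of jumps, this is an open condition on \<open>f\<close>.
\<close>
primrec changes :: "(real \<Rightarrow> real) \<Rightarrow> nat \<Rightarrow> real \<Rightarrow> real \<Rightarrow> bool" where
  "changes f 0 s v = True"
| "changes f (Suc k) s v = (\<exists>t\<in>{0..1}. s \<le> t \<and> f t \<noteq> v \<and> changes f k t (f t))"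

text \<open>
  The witnessing times are carried along by a time change, and finitely many strict inequalities
  between values survive a small uniform perturbation.
\<close>
lemma changes_stable:
  assumes "changes f k s v" "s \<in> {0..1}"
  shows "\<exists>e>0. \<forall>g l w. l \<in> time_changes \<longrightarrow> (\<forall>t\<in>{0..1}. \<bar>f t - g (l t)\<bar> < e) \<longrightarrow> \<bar>v - w\<bar> < e
      \<longrightarrow> changes g k (l s) w"
  using assms
proof (induction k arbitrary: s v)
  case 0
  show ?case by (rule exI[of _ 1]) simp
next
  case (Suc k)
  then obtain t where t: "t \<in> {0..1}" "s \<le> t" "f t \<noteq> v" "changes f k t (f t)" by auto
  from Suc.IH[OF t(4,1)] obtain e where e: "e > 0"
    "\<And>g l w. l \<in> time_changes \<Longrightarrow> (\<forall>t\<in>{0..1}. \<bar>f t - g (l t)\<bar> < e) \<Longrightarrow> \<bar>f t - w\<bar> < e \<Longrightarrow> changes g k (l t) w"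
    by blast
  show ?case
  proof (intro exI[of _ "min e (\<bar>f t - v\<bar> / 2)"] conjI allI impI)
    show "min e (\<bar>f t - v\<bar> / 2) > 0" using e t by simp
    fix g l w assume l: "l \<in> time_changes"
      and g: "\<forall>t'\<in>{0..1}. \<bar>f t' - g (l t')\<bar> < min e (\<bar>f t - v\<bar> / 2)" and w: "\<bar>v - w\<bar> < min e (\<bar>f t - v\<bar> / 2)"
    have gt: "\<bar>f t - g (l t)\<bar> < min e (\<bar>f t - v\<bar> / 2)" using g t(1) by blast
    have "changes g k (l t) (g (l t))" using e(2)[OF l, of g "g (l t)"] g gt by auto
    moreover have "g (l t) \<noteq> w" using gt w by (auto simp: abs_if split: if_splits)
    moreover have "l s \<le> l t" using time_changes_le_iff[OF l Suc.prems(2) t(1)] t(2) by simp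
    moreover have "l t \<in> {0..1}" using l t(1) by (auto simp: time_changes_def)
    ultimately show "changes g (Suc k) (l s) w" by auto
  qed
qed

lemma changes_open: "openin J1.mtopology {f\<in>skorohod. changes f k 0 0}"
  unfolding J1.openin_mtopology
proof (intro conjI allI impI)
  fix f assume f: "f \<in> {f\<in>skorohod. changes f k 0 0}"
  then obtain e where e: "e > 0" "\<And>g l w. l \<in> time_changes \<Longrightarrow> (\<forall>t\<in>{0..1}. \<bar>f t - g (l t)\<bar> < e) \<Longrightarrow> \<bar>0 - w\<bar> < e
      \<Longrightarrow> changes g k (l 0) w"
    using changes_stable[of f k 0 0] by auto
  have "J1.mball f e \<subseteq> {f\<in>skorohod. changes f k 0 0}"
  proof
    fix g assume "g \<in> J1.mball f e"
    then have g: "g \<in> skorohod" "d_J1 f g < e" by auto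
    obtain l where "l \<in> time_changes" "\<forall>t\<in>{0..1}. \<bar>f t - g (l t)\<bar> < e"
      using d_J1_lessD[OF g(2) _ g(1)] f by blast
    then have "changes g k (l 0) 0" using e(2)[of l g 0] e(1) by auto
    then show "g \<in> {f\<in>skorohod. changes f k 0 0}" using \<open>l \<in> time_changes\<close> g by (simp add: time_changes_def)
  qed
  then show "\<exists>r>0. J1.mball f r \<subseteq> {f\<in>skorohod. changes f k 0 0}" using e by blast
qed auto

text \<open>Between two times with different values there must be a jump.\<close>
lemma changes_h_map_le:
  assumes "changes (h_map n (z, u)) k s (h_map n (z, u) s)" "s \<in> {0..1}"
  shows "k \<le> card {i\<in>{1..n}. s < u i}"
  using assms
proof (induction k arbitrary: s)
  case (Suc k)
  let ?f = "h_map n (z, u)"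
  from Suc.prems obtain t where t: "t \<in> {0..1}" "s \<le> t" "?f t \<noteq> ?f s" "changes ?f k t (?f t)" by auto
  have "\<exists>i\<in>{1..n}. s < u i \<and> u i \<le> t"
  proof (rule ccontr)
    assume "\<not> ?thesis"
    then have "(indicator {u i ..} t :: real) = indicator {u i ..} s" if "i \<in> {1..n}" for i
      using that t(2) by (force simp: indicator_def)
    then have "(\<Sum>i=1..n. z i * indicator {u i ..} t) = (\<Sum>i=1..n. z i * indicator {u i ..} s)"
      by (intro sum.cong refl) (simp only:)
    then show False using t(3) by (simp only: h_map_at[OF t(1)] h_map_at[OF Suc.prems(2)])
  qed
  then obtain i where i: "i \<in> {1..n}" "s < u i" "u i \<le> t" by blast
  have "i \<in> {i\<in>{1..n}. s < u i}" "i \<notin> {i\<in>{1..n}. t < u i}" using i by auto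
  moreover have "{i\<in>{1..n}. t < u i} \<subseteq> {i\<in>{1..n}. s < u i}" using t(2) by auto
  ultimately have "{i\<in>{1..n}. t < u i} \<subset> {i\<in>{1..n}. s < u i}" by blast
  then have "card {i\<in>{1..n}. t < u i} < card {i\<in>{1..n}. s < u i}" by (intro psubset_card_mono) auto
  then show ?case using Suc.IH[OF t(4,1)] by linarith
qed simp

lemma not_changes_h_map: "\<not> changes (h_map n (z, u)) (Suc n) 0 0"
proof
  let ?f = "h_map n (z, u)"
  assume "changes ?f (Suc n) 0 0"
  then obtain t where t: "t \<in> {0..1}" "?f t \<noteq> 0" "changes ?f n t (?f t)" by auto
  have "\<exists>i\<in>{1..n}. u i \<le> t"
  proof (rule ccontr)
    assume "\<not> ?thesis"
    then have "(indicator {u i ..} t :: real) = 0" if "i \<in> {1..n}" for i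
      using that by (force simp: indicator_def)
    then have "(\<Sum>i=1..n. z i * indicator {u i ..} t) = 0"
      by (intro sum.neutral ballI) (simp only: mult_zero_right)
    then show False using t(2) by (simp only: h_map_at[OF t(1)])
  qed
  then obtain i where i: "i \<in> {1..n}" "u i \<le> t" by blast
  have "i \<notin> {i\<in>{1..n}. t < u i}" using i by auto
  then have "{i\<in>{1..n}. t < u i} \<subset> {1..n}" using i(1) by blast
  then have "card {i\<in>{1..n}. t < u i} < card {1..n}" by (intro psubset_card_mono) auto
  then show False using changes_h_map_le[OF t(3,1)] by simp
qed

text \<open>
  A path that leaves its right limit \<open>v\<close> without a jump takes values other than \<open>v\<close> arbitrarily close
  to \<open>a\<close>. Going backwards in time towards \<open>a\<close>, each of them may be chosen closer to \<open>v\<close> than the one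
  before, so they are distinct.
\<close>
lemma changes_accumulate:
  assumes lim: "(f \<longlongrightarrow> v) (at_right a)" and a: "0 \<le> a"
    and acc: "\<And>e. e > 0 \<Longrightarrow> \<exists>t. a < t \<and> t < a + e \<and> t \<le> 1 \<and> f t \<noteq> v"
  shows "e > 0 \<Longrightarrow> \<exists>t. a < t \<and> t < a + e \<and> t \<le> 1 \<and> f t \<noteq> v \<and> changes f k t (f t)"
proof (induction k arbitrary: e)
  case 0
  then show ?case using acc by simp
next
  case (Suc k)
  from Suc.IH[OF Suc.prems] obtain t1 where t1: "a < t1" "t1 < a + e" "t1 \<le> 1" "f t1 \<noteq> v" "changes f k t1 (f t1)"
    by blast
  have "\<forall>\<^sub>F s in at_right a. dist (f s) v < dist (f t1) v" using lim t1(4) by (intro tendstoD) auto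
  then obtain b where b: "b > a" "\<And>s. a < s \<Longrightarrow> s < b \<Longrightarrow> dist (f s) v < dist (f t1) v"
    unfolding eventually_at_right_field by auto
  have "min b t1 - a > 0" using b t1 by simp
  from acc[OF this] obtain t where t: "a < t" "t < b" "t < t1" "t \<le> 1" "f t \<noteq> v" by auto
  have "f t1 \<noteq> f t" using b(2)[of t] t by auto
  then have "changes f (Suc k) t (f t)" unfolding changes.simps(2)
    using t t1 a by (intro bexI[of _ t1]) simp_all
  then show ?case using t t1 by (intro exI[of _ t]) auto
qed

text \<open>
  Induction on the number of changes, splitting the path at the first time \<open>a\<close> at which it leaves the
  value \<open>v\<close>. There must be a jump at \<open>a\<close>, by \<open>changes_accumulate\<close>, and after it one change is used up.
  The strict bound on the jump times makes the jump at \<open>a\<close> precede those of the rest of the path.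
\<close>
lemma few_changes_imp_step:
  assumes f: "f \<in> skorohod" and s: "s \<in> {0..1}" and few: "\<not> changes f (Suc m) s v"
  shows "\<exists>k\<le>m. \<exists>z u. u \<in> jump_times k \<and> (\<forall>i\<in>{1..k}. s \<le> u i \<and> (f s = v \<longrightarrow> s < u i)) \<and>
    (\<forall>t\<in>{s..1}. f t = v + (\<Sum>i=1..k. z i * indicator {u i ..} t))"
  using s few
proof (induction m arbitrary: s v)
  case 0
  then have "\<forall>t\<in>{s..1}. f t = v" by auto
  then show ?case by (intro exI[of _ 0]) (auto simp: jump_times_def strict_mono_on_def)
next
  case (Suc m)
  show ?case
  proof (cases "\<forall>t\<in>{s..1}. f t = v")
    case True
    then show ?thesis by (intro exI[of _ 0]) (auto simp: jump_times_def strict_mono_on_def)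
  next
    case False
    define S where "S = {t\<in>{s..1}. f t \<noteq> v}"
    have S: "S \<noteq> {}" "bdd_below S" using False by (auto simp: S_def)
    \<comment> \<open>The first time at which the path leaves the value \<open>v\<close>.\<close>
    define a where "a = Inf S"
    have as: "s \<le> a" using S unfolding a_def by (intro cInf_greatest) (auto simp: S_def)
    have aS: "a \<le> t" if "t \<in> S" for t using that S by (auto simp: a_def intro: cInf_lower)
    obtain t0 where t0: "t0 \<in> S" using S by blast
    have a1: "a \<le> 1" using aS[OF t0] t0 by (auto simp: S_def)
    have a01: "a \<in> {0..1}" using as a1 Suc.prems by auto
    have fa: "f a \<noteq> v"
    proof
      assume fa: "f a = v"
      then have "a \<notin> S" by (simp add: S_def)
      have "a < t0" using aS[OF t0] t0 \<open>a \<notin> S\<close> by (auto simp: less_le)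
      then have "a < 1" using t0 by (auto simp: S_def)
      then have lim: "(f \<longlongrightarrow> v) (at_right a)" using f a01 fa by (auto simp: skorohod_def)
      have acc: "\<exists>t. a < t \<and> t < a + e \<and> t \<le> 1 \<and> f t \<noteq> v" if e: "e > 0" for e
      proof -
        obtain t where t: "t \<in> S" "t < a + e" using cInf_less_iff[OF S, of "a + e"] e a_def by auto
        then have "a < t" using aS[of t] \<open>a \<notin> S\<close> by (auto simp: less_le)
        then show ?thesis using t by (auto simp: S_def)
      qed
      obtain t where "a < t" "t \<le> 1" "f t \<noteq> v" "changes f (Suc m) t (f t)"
        using changes_accumulate[OF lim _ acc, of 1 "Suc m"] a01 by auto
      then have "changes f (Suc (Suc m)) s v"
        unfolding changes.simps(2)[of f "Suc m"]
        using as a01 by (intro bexI[of _ t]) (simp_all del: changes.simps)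
      then show False using Suc.prems by blast
    qed
    have "\<not> changes f (Suc m) a (f a)"
    proof
      assume "changes f (Suc m) a (f a)"
      then have "changes f (Suc (Suc m)) s v"
        unfolding changes.simps(2)[of f "Suc m"]
        using as a01 fa by (intro bexI[of _ a]) (simp_all del: changes.simps)
      then show False using Suc.prems by blast
    qed
    from Suc.IH[OF a01 this] obtain k z u where k: "k \<le> m" "u \<in> jump_times k"
      "\<forall>i\<in>{1..k}. a < u i" "\<forall>t\<in>{a..1}. f t = f a + (\<Sum>i=1..k. z i * indicator {u i ..} t)"
      by auto
    define z' where "z' i = (if i = 1 then f a - v else z (i - 1))" for i
    define u' where "u' i = (if i = 1 then a else u (i - 1))" for i
    have "u' \<in> jump_times (Suc k)"
    proof -
      have "0 \<le> u' i \<and> u' i \<le> 1" if i: "i \<in> {1..Suc k}" for i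
      proof (cases "i = 1")
        case False
        then have "i - 1 \<in> {1..k}" using i by auto
        then show ?thesis using False k(2) by (auto simp: jump_times_def u'_def)
      qed (use a01 in \<open>simp add: u'_def\<close>)
      moreover have "u' r < u' s'" if rs: "r \<in> {1..Suc k}" "s' \<in> {1..Suc k}" "r < s'" for r s'
      proof -
        have s': "s' - 1 \<in> {1..k}" "s' \<noteq> 1" using rs by auto
        show ?thesis
        proof (cases "r = 1")
          case True
          then show ?thesis using s' k(3) by (auto simp: u'_def)
        next
          case False
          then have "r - 1 \<in> {1..k}" "r - 1 < s' - 1" using rs by auto
          then have "u (r - 1) < u (s' - 1)" using k(2) s'(1)
            by (auto simp only: jump_times_def mem_Collect_eq intro: strict_mono_onD[of "{1..k}" u])
          then show ?thesis using False s' by (simp add: u'_def)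
        qed
      qed
      ultimately show ?thesis by (auto simp: jump_times_def intro!: strict_mono_onI)
    qed
    moreover have "\<forall>i\<in>{1..Suc k}. s \<le> u' i \<and> (f s = v \<longrightarrow> s < u' i)"
    proof
      fix i assume "i \<in> {1..Suc k}"
      then have "i = 1 \<or> i - 1 \<in> {1..k}" by auto
      then have "a \<le> u' i" using k(3) unfolding u'_def by (auto intro: less_imp_le)
      moreover have "f s = v \<longrightarrow> s < a" using as fa by (auto simp: less_le)
      ultimately show "s \<le> u' i \<and> (f s = v \<longrightarrow> s < u' i)" using as by auto
    qed
    moreover have "\<forall>t\<in>{s..1}. f t = v + (\<Sum>i=1..Suc k. z' i * indicator {u' i ..} t)"
    proof
      fix t assume t: "t \<in> {s..1}"
      have sum: "(\<Sum>i=1..Suc k. z' i * indicator {u' i ..} t)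
          = (f a - v) * indicator {a..} t + (\<Sum>i=1..k. z i * indicator {u i ..} t)"
      proof -
        have "(\<Sum>i=1..Suc k. z' i * indicator {u' i ..} t)
            = z' 1 * indicator {u' 1 ..} t + (\<Sum>i=Suc 1..Suc k. z' i * indicator {u' i ..} t)"
          by (rule sum.atLeast_Suc_atMost) simp
        also have "(\<Sum>i=Suc 1..Suc k. z' i * indicator {u' i ..} t) = (\<Sum>i=1..k. z' (Suc i) * indicator {u' (Suc i) ..} t)"
          by (rule sum.shift_bounds_cl_Suc_ivl)
        also have "\<dots> = (\<Sum>i=1..k. z i * indicator {u i ..} t)"
          by (intro sum.cong) (auto simp: z'_def u'_def)
        finally show ?thesis by (simp add: z'_def u'_def)
      qed
      show "f t = v + (\<Sum>i=1..Suc k. z' i * indicator {u' i ..} t)"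
      proof (cases "a \<le> t")
        case True
        then have "f t = f a + (\<Sum>i=1..k. z i * indicator {u i ..} t)" 
          by (intro k(4)[rule_format]) (use t True in simp)
        moreover have "indicator {a..} t = (1 :: real)" using True by simp
        ultimately show ?thesis unfolding sum by (simp only: mult_1_right)
      next
        case False
        have "t \<notin> S" using False aS by force
        then have "f t = v" using t by (auto simp: S_def)
        moreover have "(\<Sum>i=1..k. z i * indicator {u i ..} t) = 0"
        proof (intro sum.neutral ballI)
          fix i assume "i \<in> {1..k}"
          then have "indicator {u i ..} t = (0 :: real)" using k(3) False by (force simp: indicator_def)
          then show "z i * indicator {u i ..} t = 0" by (simp only: mult_zero_right)
        qed
        moreover have "indicator {a..} t = (0 :: real)" using False by simp
        ultimately show ?thesis unfolding sum by (simp only: mult_zero_right add_0_right)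
      qed
    qed
    ultimately show ?thesis using k(1)
      by (intro exI[of _ "Suc k"] conjI exI[of _ z'] exI[of _ u']) auto
  qed
qed

lemma skorohod_minus_D_le: "skorohod - D_le m = {f\<in>skorohod. changes f (Suc m) 0 0}"
proof (intro set_eqI iffI)
  fix f assume "f \<in> skorohod - D_le m"
  then have f: "f \<in> skorohod" "f \<notin> D_le m" by auto
  have "changes f (Suc m) 0 0"
  proof (rule ccontr)
    assume "\<not> ?thesis"
    then obtain k z u where k: "k \<le> m" "u \<in> jump_times k"
      "\<forall>t\<in>{0..1}. f t = (\<Sum>i=1..k. z i * indicator {u i ..} t)"
      using few_changes_imp_step[OF f(1), of 0 m 0] by auto
    have "f = h_map k (z, u)"
      using f(1) k(3) by (intro extensionalityI[of _ "{0..1}"]) (auto simp: skorohod_def h_map_apply)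
    moreover have "card {i\<in>{1..k}. z i \<noteq> 0} \<le> card {1..k}" by (intro card_mono) auto
    then have "card {i\<in>{1..k}. z i \<noteq> 0} \<le> m" using k(1) by simp
    ultimately show False using f(2) h_map_in_D_le[OF k(2)] by blast
  qed
  then show "f \<in> {f\<in>skorohod. changes f (Suc m) 0 0}" using f by simp
next
  fix f assume f: "f \<in> {f\<in>skorohod. changes f (Suc m) 0 0}"
  have mono: "changes f k s v" if "changes f (Suc k) s v" for f k s v
    using that by (induction k arbitrary: s v) auto
  have mono': "changes f k s v" if "k \<le> k'" "changes f k' s v" for f k k' s v
    using that by (induction rule: dec_induct) (use mono in blast)+
  have "f \<notin> D_le m"
  proof
    assume "f \<in> D_le m"
    then obtain k z u where k: "k \<le> m" "f = h_map k (z, u)" by (auto elim!: D_leE)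
    have "changes f (Suc k) 0 0" using f k(1) by (intro mono'[of "Suc k" "Suc m"]) auto
    then show False using not_changes_h_map[of k z u] k(2) by simp
  qed
  then show "f \<in> skorohod - D_le m" using f by simp
qed

text \<open>By the previous lemma and \<open>changes_open\<close>, the complement is open.\<close>
lemma closedin_D_le: "closedin J1.mtopology (D_le m)"
  unfolding closedin_def using D_le_subset changes_open[of "Suc m"] by (simp add: skorohod_minus_D_le)

section \<open>A maximal inequality for bounded summands\<close>

text \<open>
  The probability that a random walk with step distribution \<open>\<mu>\<close>, started in \<open>x\<close>, leaves the
  interval \<open>[-t, t]\<close> within \<open>n\<close> steps, given by conditioning on the first step. This recursion
  replaces stopping times: each inequality below is an induction on \<open>n\<close>.
\<close>
primrec exceed :: "real measure \<Rightarrow> real \<Rightarrow> nat \<Rightarrow> real \<Rightarrow> ennreal" where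
  "exceed \<mu> t 0 x = (if t < \<bar>x\<bar> then 1 else 0)"
| "exceed \<mu> t (Suc n) x = (if t < \<bar>x\<bar> then 1 else \<integral>\<^sup>+ y. exceed \<mu> t n (x + y) \<partial>\<mu>)"

context real_distribution
begin

lemma exceed_measurable [measurable]: "exceed M t n \<in> borel_measurable borel"
proof (induction n)
  case 0
  show ?case unfolding exceed.simps by measurable
next
  case (Suc n)
  note [measurable] = Suc
  show ?case unfolding exceed.simps by measurable
qed

lemma emeasure_UNIV: "emeasure M UNIV = 1"
  using emeasure_space_1 by simp

lemma prob_UNIV: "prob UNIV = 1"
  using prob_space by simp

lemma exceed_outside: "t < \<bar>x\<bar> \<Longrightarrow> exceed M t n x = 1"
  by (cases n) auto

lemma exceed_le_1: "exceed M t n x \<le> 1"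
proof (induction n arbitrary: x)
  case (Suc n)
  have "(\<integral>\<^sup>+ y. exceed M t n (x + y) \<partial>M) \<le> (\<integral>\<^sup>+ y. 1 \<partial>M)"
    by (intro nn_integral_mono Suc)
  then show ?case by (simp add: emeasure_UNIV)
qed simp

lemma exceed_Suc_mono: "exceed M t n x \<le> exceed M t (Suc n) x"
proof (induction n arbitrary: x)
  case (Suc n)
  have "(\<integral>\<^sup>+ y. exceed M t n (x + y) \<partial>M) \<le> (\<integral>\<^sup>+ y. exceed M t (Suc n) (x + y) \<partial>M)"
    by (intro nn_integral_mono Suc)
  then show ?case by (simp del: exceed.simps(2) add: exceed.simps(2)[of M t "Suc n"] exceed.simps(2)[of M t n x])
qed simp

lemma exceed_shift:
  assumes "\<bar>x - x'\<bar> \<le> r"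
  shows "exceed M (t + r) n x \<le> exceed M t n x'"
  using assms
proof (induction n arbitrary: x x')
  case 0
  then show ?case by auto
next
  case (Suc n)
  show ?case
  proof (cases "t < \<bar>x'\<bar>")
    case True
    then show ?thesis using exceed_le_1[of "t + r" "Suc n" x] by (simp add: exceed_outside del: exceed.simps(2))
  next
    case False
    then have "\<not> t + r < \<bar>x\<bar>" using Suc.prems by linarith
    moreover have "(\<integral>\<^sup>+ y. exceed M (t + r) n (x + y) \<partial>M) \<le> (\<integral>\<^sup>+ y. exceed M t n (x' + y) \<partial>M)"
      using Suc.prems by (intro nn_integral_mono Suc.IH) simp
    ultimately show ?thesis using False by simp
  qed
qed

text \<open>
  To get beyond level \<open>s + t + b\<close> the walk must first pass level \<open>s\<close>. At that time it has not passed
  \<open>s + b\<close>, since the steps are bounded by \<open>b\<close>, so it has to move by more than \<open>t\<close> in the remaining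
  time. Iterated in \<open>exceed_power\<close>, this turns any decay of the exit probability into a decay of
  arbitrary power, at the price of a level that is larger by a constant factor.
\<close>
lemma exceed_submultiplicative:
  assumes bnd: "AE y in M. \<bar>y\<bar> \<le> b" and "0 \<le> b" "0 \<le> t" and "\<bar>x\<bar> \<le> s + b"
  shows "exceed M (s + t + b) n x \<le> exceed M s n x * exceed M t n 0"
  using assms(4)
proof (induction n arbitrary: x)
  case 0
  have "exceed M (t + (s + b)) 0 x \<le> exceed M t 0 0"
    using 0 by (intro exceed_shift) simp
  then show ?case using 0 assms(2,3) by (cases "s < \<bar>x\<bar>") (simp_all add: algebra_simps)
next
  case (Suc n)
  show ?case
  proof (cases "s < \<bar>x\<bar>")
    case True
    have "exceed M (t + (s + b)) (Suc n) x \<le> exceed M t (Suc n) 0"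
      using Suc.prems by (intro exceed_shift) simp
    then show ?thesis using exceed_outside[OF True, of "Suc n"] by (simp add: algebra_simps del: exceed.simps(2))
  next
    case False
    then have F2: "\<not> s + t + b < \<bar>x\<bar>" using assms(2,3) by linarith
    have "(\<integral>\<^sup>+ y. exceed M (s + t + b) n (x + y) \<partial>M)
        \<le> (\<integral>\<^sup>+ y. exceed M s n (x + y) * exceed M t n 0 \<partial>M)"
    proof (rule nn_integral_mono_AE, use bnd in eventually_elim)
      fix y assume "\<bar>y\<bar> \<le> b"
      then show "exceed M (s + t + b) n (x + y) \<le> exceed M s n (x + y) * exceed M t n 0"
        using False by (intro Suc.IH) linarith
    qed
    also have "\<dots> = (\<integral>\<^sup>+ y. exceed M s n (x + y) \<partial>M) * exceed M t n 0"
      by (intro nn_integral_multc measurable_compose[OF _ exceed_measurable]) simp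
    also have "\<dots> \<le> (\<integral>\<^sup>+ y. exceed M s n (x + y) \<partial>M) * exceed M t (Suc n) 0"
      by (intro mult_left_mono exceed_Suc_mono) simp
    finally show ?thesis using False F2 by (simp only: exceed.simps(2) if_False)
  qed
qed

lemma exceed_power:
  assumes "AE y in M. \<bar>y\<bar> \<le> b" "0 \<le> b" "0 \<le> t"
  shows "exceed M (real r * (t + b)) n 0 \<le> exceed M t n 0 ^ r"
proof (induction r)
  case 0
  show ?case using exceed_le_1 by simp
next
  case (Suc r)
  have "exceed M (real r * (t + b) + t + b) n 0 \<le> exceed M (real r * (t + b)) n 0 * exceed M t n 0"
    using assms by (intro exceed_submultiplicative) auto
  also have "\<dots> \<le> exceed M t n 0 ^ r * exceed M t n 0"
    by (intro mult_right_mono Suc) simp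
  finally show ?case by (simp add: algebra_simps)
qed

text \<open>
  Kolmogorov's inequality for a walk with drift: as long as the walk stays in \<open>[-t, t]\<close>, its
  square grows in one step by at most \<open>2 t \<bar>E Y\<bar> + E Y\<^sup>2\<close> on average.
\<close>
lemma exceed_le_second_moment:
  assumes int: "integrable M (\<lambda>y. y)" "integrable M (\<lambda>y. y\<^sup>2)" and t: "0 < t"
  shows "exceed M t n x \<le> ennreal ((x\<^sup>2 + real n * (2 * t * \<bar>\<integral>y. y \<partial>M\<bar> + (\<integral>y. y\<^sup>2 \<partial>M))) / t\<^sup>2)"
proof -
  define k where "k = 2 * t * \<bar>\<integral>y. y \<partial>M\<bar> + (\<integral>y. y\<^sup>2 \<partial>M)"
  have k: "k \<ge> 0" using t by (simp add: k_def)
  have out: "exceed M t n x \<le> ennreal ((x\<^sup>2 + real n * k) / t\<^sup>2)" if "t < \<bar>x\<bar>" for n x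
  proof -
    have "t\<^sup>2 \<le> \<bar>x\<bar>\<^sup>2" using that t by (intro power_mono) auto
    moreover have "0 \<le> real n * k" using k by simp
    ultimately have "t\<^sup>2 \<le> x\<^sup>2 + real n * k" by simp
    then have "1 \<le> (x\<^sup>2 + real n * k) / t\<^sup>2" using t by (simp add: field_simps)
    then show ?thesis using exceed_le_1[of t n x] by (meson ennreal_leI ennreal_1 order_trans one_le_numeral ennreal_ge_1)
  qed
  have "exceed M t n x \<le> ennreal ((x\<^sup>2 + real n * k) / t\<^sup>2)"
  proof (induction n arbitrary: x)
    case 0
    then show ?case using out[of x 0] by (cases "t < \<bar>x\<bar>") auto
  next
    case (Suc n)
    show ?case
    proof (cases "t < \<bar>x\<bar>")
      case True
      then show ?thesis by (rule out)
    next
      case False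
      have i: "integrable M (\<lambda>y. ((x + y)\<^sup>2 + real n * k) / t\<^sup>2)"
        using int by (simp add: power2_sum)
      have "exceed M t (Suc n) x = (\<integral>\<^sup>+ y. exceed M t n (x + y) \<partial>M)" using False by simp
      also have "\<dots> \<le> (\<integral>\<^sup>+ y. ennreal (((x + y)\<^sup>2 + real n * k) / t\<^sup>2) \<partial>M)"
        by (intro nn_integral_mono Suc)
      also have "\<dots> = ennreal (\<integral>y. ((x + y)\<^sup>2 + real n * k) / t\<^sup>2 \<partial>M)"
        using k by (intro nn_integral_eq_integral[OF i]) auto
      also have "(\<integral>y. ((x + y)\<^sup>2 + real n * k) / t\<^sup>2 \<partial>M)
          = (x\<^sup>2 + 2 * x * (\<integral>y. y \<partial>M) + (\<integral>y. y\<^sup>2 \<partial>M) + real n * k) / t\<^sup>2"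
        using int by (simp add: power2_sum prob_UNIV)
      also have "\<dots> \<le> (x\<^sup>2 + real (Suc n) * k) / t\<^sup>2"
      proof (rule divide_right_mono)
        have "x * (\<integral>y. y \<partial>M) \<le> \<bar>x\<bar> * \<bar>\<integral>y. y \<partial>M\<bar>" by (metis abs_ge_self abs_mult)
        also have "\<dots> \<le> t * \<bar>\<integral>y. y \<partial>M\<bar>" using False by (intro mult_right_mono) auto
        finally show "x\<^sup>2 + 2 * x * (\<integral>y. y \<partial>M) + (\<integral>y. y\<^sup>2 \<partial>M) + real n * k \<le> x\<^sup>2 + real (Suc n) * k"
          by (simp add: k_def algebra_simps)
      qed simp
      finally show ?thesis by (simp add: ennreal_leI)
    qed
  qed
  then show ?thesis by (simp only: k_def)
qed

text \<open>
  The index of the first step is a parameter because the induction splits off the first coordinate of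
  the product.
\<close>
lemma exceed_eq_PiM:
  "(\<integral>\<^sup>+ y. indicator {y. \<exists>k\<in>{m..m+d}. t < \<bar>x + (\<Sum>i\<in>{m..<k}. y i)\<bar>} y \<partial>(\<Pi>\<^sub>M i\<in>{m..<m+d}. M)) = exceed M t d x"
proof (induction d arbitrary: m x)
  case 0
  interpret product_sigma_finite "\<lambda>_. M" by standard
  show ?case by (simp add: nn_integral_empty indicator_def)
next
  case (Suc d)
  have prob: "prob_space M" by (rule prob_space_axioms)
  interpret product_prob_space "\<lambda>_. M" ..
  let ?f = "\<lambda>y. indicator {y. \<exists>k\<in>{m..m+Suc d}. t < \<bar>x + (\<Sum>i\<in>{m..<k}. y i)\<bar>} y :: ennreal"
  have ins: "{m..<m+Suc d} = insert m {Suc m..<Suc m + d}" by auto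
  have meas: "?f \<in> borel_measurable (PiM {m..<m+Suc d} (\<lambda>_. M))"
  proof -
    have "{y\<in>space (PiM {m..<m+Suc d} (\<lambda>_. M)). \<exists>k\<in>{m..m+Suc d}. t < \<bar>x + (\<Sum>i\<in>{m..<k}. y i)\<bar>} \<in> sets (PiM {m..<m+Suc d} (\<lambda>_. M))"
    proof (intro sets.sets_Collect_finite_Ex)
      fix k assume "k \<in> {m..m+Suc d}"
      then have [measurable]: "(\<lambda>y. \<Sum>i\<in>{m..<k}. y i) \<in> borel_measurable (PiM {m..<m+Suc d} (\<lambda>_. M))"
        by (intro borel_measurable_sum measurable_component_singleton[THEN measurable_compose] measurable_ident_sets) auto
      show "{y\<in>space (PiM {m..<m+Suc d} (\<lambda>_. M)). t < \<bar>x + (\<Sum>i\<in>{m..<k}. y i)\<bar>} \<in> sets (PiM {m..<m+Suc d} (\<lambda>_. M))"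
        by measurable
    qed auto
    then show ?thesis by (intro borel_measurable_indicator') (simp_all add: Int_def conj_commute)
  qed
  have upd: "(\<Sum>i\<in>{m..<k}. (z(m := y)) i) = y + (\<Sum>i\<in>{Suc m..<k}. z i)" if "Suc m \<le> k" for z :: "nat \<Rightarrow> real" and y and k :: nat
  proof -
    have "{m..<k} = insert m {Suc m..<k}" using that by auto
    then show ?thesis by (simp add: sum.insert)
  qed
  have split: "?f (z(m := y)) = (if t < \<bar>x\<bar> then 1
      else indicator {z. \<exists>k\<in>{Suc m..Suc m + d}. t < \<bar>(x + y) + (\<Sum>i\<in>{Suc m..<k}. z i)\<bar>} z)" for z y
  proof -
    have "{m..m+Suc d} = insert m {Suc m..Suc m + d}" by auto
    then have "(\<exists>k\<in>{m..m+Suc d}. t < \<bar>x + (\<Sum>i\<in>{m..<k}. (z(m := y)) i)\<bar>) \<longleftrightarrow>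
       t < \<bar>x\<bar> \<or> (\<exists>k\<in>{Suc m..Suc m + d}. t < \<bar>x + (\<Sum>i\<in>{m..<k}. (z(m := y)) i)\<bar>)" by simp
    also have "(\<exists>k\<in>{Suc m..Suc m + d}. t < \<bar>x + (\<Sum>i\<in>{m..<k}. (z(m := y)) i)\<bar>) \<longleftrightarrow>
        (\<exists>k\<in>{Suc m..Suc m + d}. t < \<bar>(x + y) + (\<Sum>i\<in>{Suc m..<k}. z i)\<bar>)"
    proof (intro bex_cong refl)
      fix k assume "k \<in> {Suc m..Suc m + d}"
      then have "Suc m \<le> k" by simp
      from upd[OF this] show "(t < \<bar>x + (\<Sum>i\<in>{m..<k}. (z(m := y)) i)\<bar>)
          = (t < \<bar>(x + y) + (\<Sum>i\<in>{Suc m..<k}. z i)\<bar>)" by (simp only: add.assoc)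
    qed
    finally show ?thesis by (simp add: indicator_def)
  qed
  have "(\<integral>\<^sup>+ y. ?f y \<partial>(PiM {m..<m+Suc d} (\<lambda>_. M)))
      = (\<integral>\<^sup>+ y. (\<integral>\<^sup>+ z. ?f (z(m := y)) \<partial>(PiM {Suc m..<Suc m + d} (\<lambda>_. M))) \<partial>M)"
    using meas unfolding ins by (intro product_nn_integral_insert_rev) auto
  also have "\<dots> = exceed M t (Suc d) x"
  proof (cases "t < \<bar>x\<bar>")
    case True
    interpret rest: prob_space "PiM {Suc m..<Suc m + d} (\<lambda>_. M)" by (intro prob_space_PiM prob)
    show ?thesis unfolding split using True rest.emeasure_space_1 by (simp add: emeasure_UNIV)
  next
    case False
    then show ?thesis unfolding split by (simp only: if_False exceed.simps(2) Suc.IH)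
  qed
  finally show ?case .
qed

end

text \<open>
  Kolmogorov's inequality alone only yields the first power. The \<open>r\<close>-th power is what makes the
  probability small compared with any power of \<open>n\<close>, hence compared with the probability of \<open>j\<close> big
  jumps.
\<close>
lemma (in prob_space) max_partial_sum_le:
  fixes Y :: "nat \<Rightarrow> 'a \<Rightarrow> real"
  assumes indep: "indep_vars (\<lambda>_. borel) Y {1..n}"
    and law: "\<And>i. i \<in> {1..n} \<Longrightarrow> distr M borel (Y i) = distr M borel X" and X: "X \<in> borel_measurable M"
    and b: "\<And>\<omega>. \<omega> \<in> space M \<Longrightarrow> \<bar>X \<omega>\<bar> \<le> b" and "0 \<le> b" and t: "0 < t"
  shows "prob {\<omega>\<in>space M. \<exists>k\<in>{1..n}. real r * (t + b) < \<bar>\<Sum>i=1..k. Y i \<omega>\<bar>}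
      \<le> (real n * (2 * t * \<bar>expectation X\<bar> + expectation (\<lambda>\<omega>. (X \<omega>)\<^sup>2)) / t\<^sup>2) ^ r"
proof (cases "n = 0")
  case True
  then show ?thesis by simp
next
  case False
  define \<mu> where "\<mu> = distr M borel X"
  interpret \<mu>: real_distribution \<mu> unfolding \<mu>_def using X by (intro real_distribution_distr)
  define c where "c = real n * (2 * t * \<bar>expectation X\<bar> + expectation (\<lambda>\<omega>. (X \<omega>)\<^sup>2)) / t\<^sup>2"
  have c: "0 \<le> c" using t by (simp add: c_def)
  have Y: "Y i \<in> borel_measurable M" if "i \<in> {1..n}" for i
    using indep that by (auto simp: indep_vars_def)
  let ?v = "\<lambda>\<omega>. \<lambda>i\<in>{1..n}. Y i \<omega>"
  let ?P = "PiM {1..n} (\<lambda>_. borel) :: (nat \<Rightarrow> real) measure"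
  have v: "?v \<in> measurable M ?P" using Y by (intro measurable_restrict) auto
  have PiM: "distr M ?P ?v = PiM {1..n} (\<lambda>_. \<mu>)"
  proof -
    have "distr M ?P ?v = PiM {1..n} (\<lambda>i. distr M borel (Y i))"
      using indep Y False by (subst indep_vars_iff_distr_eq_PiM'[symmetric]) auto
    also have "\<dots> = PiM {1..n} (\<lambda>_. \<mu>)" unfolding \<mu>_def by (intro PiM_cong refl law) auto
    finally show ?thesis .
  qed
  define R where "R = real r * (t + b)"
  let ?A = "{y. \<exists>k\<in>{1..1+n}. R < \<bar>0 + (\<Sum>i\<in>{1..<k}. y i)\<bar>}"
  have A: "{y\<in>space ?P. y \<in> ?A} \<in> sets ?P"
  proof -
    have "{y\<in>space ?P. \<exists>k\<in>{1..1+n}. R < \<bar>0 + (\<Sum>i\<in>{1..<k}. y i)\<bar>} \<in> sets ?P"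
    proof (intro sets.sets_Collect_finite_Ex)
      fix k assume "k \<in> {1..1+n}"
      then have [measurable]: "(\<lambda>y. \<Sum>i\<in>{1..<k}. y i) \<in> borel_measurable ?P"
        by (intro borel_measurable_sum measurable_component_singleton) auto
      show "{y\<in>space ?P. R < \<bar>0 + (\<Sum>i\<in>{1..<k}. y i)\<bar>} \<in> sets ?P" by measurable
    qed auto
    then show ?thesis by simp
  qed
  let ?E = "{\<omega>\<in>space M. \<exists>k\<in>{1..n}. R < \<bar>\<Sum>i=1..k. Y i \<omega>\<bar>}"
  have sub: "?E \<subseteq> ?v -` {y\<in>space ?P. y \<in> ?A} \<inter> space M"
  proof
    fix \<omega> assume "\<omega> \<in> ?E"
    then obtain k where k: "\<omega> \<in> space M" "k \<in> {1..n}" "R < \<bar>\<Sum>i=1..k. Y i \<omega>\<bar>" by blast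
    have "(\<Sum>i\<in>{1..<Suc k}. ?v \<omega> i) = (\<Sum>i=1..k. Y i \<omega>)"
      using k(2) by (intro sum.cong) auto
    then have "?v \<omega> \<in> ?A" using k by (auto intro!: bexI[of _ "Suc k"])
    moreover have "?v \<omega> \<in> space ?P" using measurable_space[OF v k(1)] .
    ultimately show "\<omega> \<in> ?v -` {y\<in>space ?P. y \<in> ?A} \<inter> space M" using k(1) by blast
  qed
  have "emeasure M ?E \<le> emeasure M (?v -` {y\<in>space ?P. y \<in> ?A} \<inter> space M)"
    by (intro emeasure_mono sub measurable_sets[OF v A])
  also have "\<dots> = emeasure (distr M ?P ?v) {y\<in>space ?P. y \<in> ?A}"
    using v A by (simp add: emeasure_distr)
  also have "\<dots> = (\<integral>\<^sup>+ y. indicator {y\<in>space ?P. y \<in> ?A} y \<partial>(PiM {1..n} (\<lambda>_. \<mu>)))"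
  proof -
    have "sets (PiM {1..n} (\<lambda>_. \<mu>)) = sets ?P" unfolding PiM[symmetric] by simp
    then show ?thesis unfolding PiM using A by (intro nn_integral_indicator[symmetric]) (simp only:)
  qed
  also have "\<dots> = (\<integral>\<^sup>+ y. indicator ?A y \<partial>(PiM {1..n} (\<lambda>_. \<mu>)))"
    by (intro nn_integral_cong) (auto simp: indicator_def space_PiM)
  also have "\<dots> = exceed \<mu> R n 0"
    using \<mu>.exceed_eq_PiM[of 1 n R 0] by (simp add: atLeastLessThanSuc_atLeastAtMost)
  also have "\<dots> \<le> exceed \<mu> t n 0 ^ r"
    unfolding R_def
  proof (rule \<mu>.exceed_power)
    show "AE y in \<mu>. \<bar>y\<bar> \<le> b" unfolding \<mu>_def using X b by (subst AE_distr_iff) auto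
  qed (use assms in auto)
  also have "\<dots> \<le> ennreal c ^ r"
  proof (intro power_mono)
    have bnd: "\<bar>X \<omega> ^ k\<bar> \<le> b ^ k" if "\<omega> \<in> space M" for \<omega> k
      unfolding power_abs using b[OF that] by (intro power_mono) auto
    have "integrable M (\<lambda>\<omega>. X \<omega> ^ k)" for k
      by (rule integrable_const_bound[of _ "b ^ k"]) (use X bnd in auto)
    then have "integrable \<mu> (\<lambda>y. y ^ k)" for k
      unfolding \<mu>_def using X by (subst integrable_distr_eq) auto
    from this[of 1] this[of 2] have "exceed \<mu> t n 0
        \<le> ennreal ((0\<^sup>2 + real n * (2 * t * \<bar>\<integral>y. y \<partial>\<mu>\<bar> + (\<integral>y. y\<^sup>2 \<partial>\<mu>))) / t\<^sup>2)"
      using t by (intro \<mu>.exceed_le_second_moment) auto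
    also have "(0\<^sup>2 + real n * (2 * t * \<bar>\<integral>y. y \<partial>\<mu>\<bar> + (\<integral>y. y\<^sup>2 \<partial>\<mu>))) / t\<^sup>2 = c"
      unfolding c_def \<mu>_def using X by (subst (1 2) integral_distr) auto
    finally show "exceed \<mu> t n 0 \<le> ennreal c" .
  qed simp
  also have "\<dots> = ennreal (c ^ r)" using c by (simp add: ennreal_power)
  finally have "ennreal (prob ?E) \<le> ennreal (c ^ r)" by (simp add: emeasure_eq_measure)
  then show ?thesis using c unfolding R_def c_def[symmetric] by (simp add: ennreal_le_iff)
qed

section \<open>Polynomial bounds from regular variation\<close>

text \<open>Halving \<open>t\<close> until it lies in \<open>[t0, 2 * t0]\<close> can only increase the value.\<close>
lemma doubling_bound:
  fixes \<phi> :: "real \<Rightarrow> real"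
  assumes "0 < t0" and double: "\<And>t. t0 \<le> t \<Longrightarrow> \<phi> (2 * t) \<le> \<phi> t"
    and start: "\<And>t. t0 \<le> t \<Longrightarrow> t \<le> 2 * t0 \<Longrightarrow> \<phi> t \<le> B" and "t0 \<le> t"
  shows "\<phi> t \<le> B"
proof -
  have bnd: "\<phi> t \<le> B" if "t0 \<le> t" "t \<le> 2 ^ Suc k * t0" for k t
    using that
  proof (induction k arbitrary: t)
    case 0
    then show ?case by (intro start) auto
  next
    case (Suc k)
    show ?case
    proof (cases "t \<le> 2 * t0")
      case True
      then show ?thesis using Suc.prems by (intro start)
    next
      case False
      have "\<phi> (2 * (t/2)) \<le> \<phi> (t/2)" using False by (intro double) simp
      also have "\<phi> (t/2) \<le> B" using False Suc.prems by (intro Suc.IH) auto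
      finally show ?thesis by simp
    qed
  qed
  obtain k where "t / t0 < 2 ^ k" using real_arch_pow[of 2 "t / t0"] by auto
  then have "t \<le> 2 ^ k * t0" using \<open>0 < t0\<close> by (simp add: field_simps)
  also have "\<dots> \<le> 2 ^ Suc k * t0" using \<open>0 < t0\<close> by simp
  finally show ?thesis using bnd[OF \<open>t0 \<le> t\<close>] by blast
qed

text \<open>
  Along \<open>n, n div 2, n div 4, \<dots>\<close> the sequence increases until the index is small, so all its values
  are bounded by those with small index.
\<close>
lemma halving_bound:
  fixes a :: "nat \<Rightarrow> real"
  assumes pos: "\<And>n. n \<ge> 1 \<Longrightarrow> a n > 0" and lim: "(\<lambda>n. a (n div 2) / a n) \<longlonglongrightarrow> L" and "1 < L"
  shows "\<exists>B>0. \<forall>n\<ge>1. a n \<le> B"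
proof -
  from lim \<open>1 < L\<close> have "\<forall>\<^sub>F n in sequentially. 1 < a (n div 2) / a n" by (rule order_tendstoD)
  then obtain N where N: "\<And>n. n \<ge> N \<Longrightarrow> 1 < a (n div 2) / a n" by (auto simp: eventually_sequentially)
  define B where "B = (\<Sum>n\<in>{1..N+1}. a n)"
  have nn: "a n \<ge> 0" if "n \<in> {1..N+1}" for n using pos[of n] that by simp
  have bnd: "a n \<le> B" if "n \<ge> 1" for n
    using that
  proof (induction n rule: less_induct)
    case (less n)
    show ?case
    proof (cases "n \<le> N + 1")
      case True
      then show ?thesis unfolding B_def using less.prems nn by (intro member_le_sum) auto
    next
      case False
      then have "a n < a (n div 2)" using N[of n] pos[of n] by (simp add: field_simps)
      also have "a (n div 2) \<le> B" using False by (intro less.IH) auto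
      finally show ?thesis by simp
    qed
  qed
  have "0 < a 1" by (rule pos) simp
  also have "a 1 \<le> B" by (rule bnd) simp
  finally show ?thesis using bnd by blast
qed

lemma half_ratio: "(\<lambda>n. real (n div 2) / real n) \<longlonglongrightarrow> 1/2"
proof (rule tendsto_sandwich[of "\<lambda>n. 1/2 - 1 / real n" _ _ "\<lambda>_. 1/2"])
  have "real n \<le> 2 * real (n div 2) + 1" for n :: nat by linarith
  then have le: "real n / 2 - 1 \<le> real (n div 2)" for n :: nat by (smt (verit) field_sum_of_halves)
  have lower: "1/2 - 1 / real n \<le> real (n div 2) / real n" if "n > 0" for n
  proof -
    have "1/2 - 1 / real n = (real n / 2 - 1) / real n" using that by (simp add: diff_divide_distrib)
    also have "\<dots> \<le> real (n div 2) / real n" by (intro divide_right_mono le) simp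
    finally show ?thesis .
  qed
  show "\<forall>\<^sub>F n in sequentially. 1/2 - 1 / real n \<le> real (n div 2) / real n"
    by (intro eventually_sequentiallyI[of 1] lower) simp
  have "2 * real (n div 2) \<le> real n" for n :: nat by linarith
  then have upper: "real (n div 2) / real n \<le> 1/2" if "n > 0" for n
    using that by (simp add: field_simps)
  show "\<forall>\<^sub>F n in sequentially. real (n div 2) / real n \<le> 1/2"
    by (intro eventually_sequentiallyI[of 1] upper) simp
  show "(\<lambda>n. 1/2 - 1 / real n) \<longlonglongrightarrow> 1/2"
    using tendsto_diff[OF tendsto_const lim_1_over_n, of "1/2"] by simp
qed simp

lemma regularly_varying_seq_half:
  assumes "regularly_varying_seq lam \<rho>"
  shows "(\<lambda>n. lam (n div 2) / lam n) \<longlonglongrightarrow> (1/2) powr \<rho>"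
proof -
  have "(\<lambda>n. lam (nat \<lfloor>1/2 * real n\<rfloor>) / lam n) \<longlonglongrightarrow> (1/2) powr \<rho>"
    using assms unfolding regularly_varying_seq_def by (metis zero_less_divide_1_iff zero_less_numeral)
  moreover have "nat \<lfloor>1/2 * real n\<rfloor> = n div 2" for n
    using floor_divide_of_nat_eq[where 'a = real, of n 2] by simp
  ultimately show ?thesis by simp
qed

text \<open>
  This is a weak form of Potter's bounds. The ratio of \<open>n powr \<sigma> / lam n\<close> along \<open>n div 2\<close> and \<open>n\<close> tends
  to \<open>2 powr (\<rho> - \<sigma>)\<close>, which exceeds one, so that \<open>halving_bound\<close> applies.
\<close>
lemma regularly_varying_seq_lower:
  assumes rv: "regularly_varying_seq lam \<rho>" and "\<sigma> < \<rho>"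
  shows "\<exists>c>0. \<forall>n\<ge>1. c * real n powr \<sigma> \<le> lam n"
proof -
  have pos: "lam n > 0" if "n \<ge> 1" for n using rv that by (auto simp: regularly_varying_seq_def)
  have "(\<lambda>n. (real (n div 2) / real n) powr \<sigma> * inverse (lam (n div 2) / lam n)) \<longlonglongrightarrow> (1/2) powr \<sigma> * inverse ((1/2) powr \<rho>)"
    by (intro tendsto_intros half_ratio regularly_varying_seq_half[OF rv]) auto
  moreover have "\<forall>\<^sub>F n in sequentially. (real (n div 2) / real n) powr \<sigma> * inverse (lam (n div 2) / lam n)
      = (real (n div 2) powr \<sigma> / lam (n div 2)) / (real n powr \<sigma> / lam n)"
    by (simp add: powr_divide divide_simps)
  ultimately have "(\<lambda>n. (real (n div 2) powr \<sigma> / lam (n div 2)) / (real n powr \<sigma> / lam n)) \<longlonglongrightarrow> (1/2) powr \<sigma> * inverse ((1/2) powr \<rho>)"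
    by (rule Lim_transform_eventually)
  moreover have "1 < (1/2) powr \<sigma> * inverse ((1/2::real) powr \<rho>)"
    using \<open>\<sigma> < \<rho>\<close> by (simp add: powr_divide field_simps)
  ultimately have "\<exists>B>0. \<forall>n\<ge>1. real n powr \<sigma> / lam n \<le> B"
    using pos by (intro halving_bound) auto
  then obtain B where B: "B > 0" "\<forall>n\<ge>1. real n powr \<sigma> / lam n \<le> B" by blast
  show ?thesis
  proof (intro exI[of _ "1/B"] conjI allI impI)
    fix n :: nat assume n: "n \<ge> 1"
    then show "1 / B * real n powr \<sigma> \<le> lam n" using B(2)[rule_format, OF n] B(1) pos[of n] by (simp add: field_simps)
  qed (use B in simp)
qed

lemma regularly_varying_seq_upper:
  assumes rv: "regularly_varying_seq lam \<rho>" and "\<rho> < \<tau>"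
  shows "\<exists>C>0. \<forall>n\<ge>1. lam n \<le> C * real n powr \<tau>"
proof -
  have pos: "lam n > 0" if "n \<ge> 1" for n using rv that by (auto simp: regularly_varying_seq_def)
  have "(\<lambda>n. (lam (n div 2) / lam n) * inverse ((real (n div 2) / real n) powr \<tau>)) \<longlonglongrightarrow> (1/2) powr \<rho> * inverse ((1/2) powr \<tau>)"
    by (intro tendsto_intros half_ratio regularly_varying_seq_half[OF rv]) auto
  moreover have "\<forall>\<^sub>F n in sequentially. (lam (n div 2) / lam n) * inverse ((real (n div 2) / real n) powr \<tau>)
      = (lam (n div 2) / real (n div 2) powr \<tau>) / (lam n / real n powr \<tau>)"
    by (simp add: powr_divide divide_simps)
  ultimately have "(\<lambda>n. (lam (n div 2) / real (n div 2) powr \<tau>) / (lam n / real n powr \<tau>)) \<longlonglongrightarrow> (1/2) powr \<rho> * inverse ((1/2) powr \<tau>)"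
    by (rule Lim_transform_eventually)
  moreover have "1 < (1/2) powr \<rho> * inverse ((1/2::real) powr \<tau>)"
    using \<open>\<rho> < \<tau>\<close> by (simp add: powr_divide field_simps)
  ultimately have "\<exists>B>0. \<forall>n\<ge>1. lam n / real n powr \<tau> \<le> B"
    using pos by (intro halving_bound) auto
  then obtain B where B: "B > 0" "\<forall>n\<ge>1. lam n / real n powr \<tau> \<le> B" by blast
  show ?thesis
  proof (intro exI[of _ B] conjI allI impI)
    fix n :: nat assume n: "n \<ge> 1"
    then show "lam n \<le> B * real n powr \<tau>" using B(2)[rule_format, OF n] by (simp add: field_simps)
  qed (use B in simp)
qed

text \<open>By regular variation, \<open>T t * t powr \<beta>\<close> decreases on doubling a large \<open>t\<close>.\<close>
lemma tail_upper:
  fixes T :: "real \<Rightarrow> real"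
  assumes anti: "\<And>s t. s \<le> t \<Longrightarrow> T t \<le> T s" and pos: "\<And>t. 0 < T t" and le1: "\<And>t. T t \<le> 1"
    and rv: "((\<lambda>t. T (t * 2) / T t) \<longlongrightarrow> 2 powr (- \<alpha>)) at_top" and "0 < \<beta>" "\<beta> < \<alpha>"
  shows "\<exists>C>0. \<forall>t\<ge>1. T t \<le> C * t powr (- \<beta>)"
proof -
  have "2 powr (- \<alpha>) < 2 powr (- \<beta>)" using \<open>\<beta> < \<alpha>\<close> by simp
  with rv have "\<forall>\<^sub>F t in at_top. T (t * 2) / T t < 2 powr (- \<beta>)" by (rule order_tendstoD)
  then obtain t1 where t1: "\<And>t. t \<ge> t1 \<Longrightarrow> T (t * 2) / T t < 2 powr (- \<beta>)" by (auto simp: eventually_at_top_linorder)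
  define t0 where "t0 = max t1 1"
  have t0: "t0 \<ge> 1" by (simp add: t0_def)
  define C where "C = (2 * t0) powr \<beta>"
  have 1: "T t * t powr \<beta> \<le> C" if "t0 \<le> t" for t
  proof (rule doubling_bound[of t0 "\<lambda>t. T t * t powr \<beta>"])
    show "0 < t0" "t0 \<le> t" using t0 that by auto
    fix t assume t: "t0 \<le> t"
    have "T (2 * t) \<le> 2 powr (- \<beta>) * T t" using t1[of t] t pos[of t] by (simp add: t0_def field_simps)
    then have "T (2 * t) * (2 * t) powr \<beta> \<le> 2 powr (- \<beta>) * T t * (2 * t) powr \<beta>" by (intro mult_right_mono) auto
    also have "\<dots> = T t * t powr \<beta>" using t t0 by (simp add: powr_mult powr_minus field_simps)
    finally show "T (2 * t) * (2 * t) powr \<beta> \<le> T t * t powr \<beta>" .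
    assume "t \<le> 2 * t0"
    then have "T t * t powr \<beta> \<le> 1 * (2 * t0) powr \<beta>"
      using t t0 \<open>0 < \<beta>\<close> le1 by (intro mult_mono powr_mono2) auto
    then show "T t * t powr \<beta> \<le> C" by (simp add: C_def)
  qed
  have 2: "T t * t powr \<beta> \<le> C" if "1 \<le> t" for t
  proof (cases "t0 \<le> t")
    case False
    then have "T t * t powr \<beta> \<le> 1 * (2 * t0) powr \<beta>"
      using that t0 \<open>0 < \<beta>\<close> le1 by (intro mult_mono powr_mono2) auto
    then show ?thesis by (simp add: C_def)
  qed (rule 1)
  show ?thesis
  proof (intro exI[of _ C] conjI allI impI)
    show "C > 0" using t0 by (simp add: C_def)
    fix t :: real assume "1 \<le> t"
    then show "T t \<le> C * t powr (- \<beta>)" using 2[of t] by (simp add: powr_minus field_simps)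
  qed
qed

text \<open>By regular variation, \<open>t powr (- \<gamma>) / T t\<close> decreases on doubling a large \<open>t\<close>.\<close>
lemma tail_lower:
  fixes T :: "real \<Rightarrow> real"
  assumes anti: "\<And>s t. s \<le> t \<Longrightarrow> T t \<le> T s" and pos: "\<And>t. 0 < T t"
    and rv: "((\<lambda>t. T (t * 2) / T t) \<longlongrightarrow> 2 powr (- \<alpha>)) at_top" and "0 < \<gamma>" "\<alpha> < \<gamma>"
  shows "\<exists>c>0. \<exists>t0. \<forall>t\<ge>t0. c * t powr (- \<gamma>) \<le> T t"
proof -
  have "2 powr (- \<gamma>) < 2 powr (- \<alpha>)" using \<open>\<alpha> < \<gamma>\<close> by simp
  with rv have "\<forall>\<^sub>F t in at_top. 2 powr (- \<gamma>) < T (t * 2) / T t" by (rule order_tendstoD)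
  then obtain t1 where t1: "\<And>t. t \<ge> t1 \<Longrightarrow> 2 powr (- \<gamma>) < T (t * 2) / T t" by (auto simp: eventually_at_top_linorder)
  define t0 where "t0 = max t1 1"
  have t0: "t0 \<ge> 1" by (simp add: t0_def)
  define B where "B = 1 / T (2 * t0)"
  have B: "B > 0" using pos by (simp add: B_def)
  have 1: "t powr (- \<gamma>) / T t \<le> B" if "t0 \<le> t" for t
  proof (rule doubling_bound[of t0 "\<lambda>t. t powr (- \<gamma>) / T t"])
    show "0 < t0" "t0 \<le> t" using t0 that by auto
    fix t assume t: "t0 \<le> t"
    have "2 powr (- \<gamma>) * T t \<le> T (2 * t)" using t1[of t] t pos[of t] by (simp add: t0_def field_simps)
    then have "(2 * t) powr (- \<gamma>) / T (2 * t) \<le> (2 * t) powr (- \<gamma>) / (2 powr (- \<gamma>) * T t)"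
      using pos by (intro divide_left_mono) auto
    also have "\<dots> = t powr (- \<gamma>) / T t" using t t0 by (simp add: powr_mult)
    finally show "(2 * t) powr (- \<gamma>) / T (2 * t) \<le> t powr (- \<gamma>) / T t" .
    assume t2: "t \<le> 2 * t0"
    have "t powr (- \<gamma>) \<le> 1" using t t0 \<open>0 < \<gamma>\<close> powr_mono2'[of "-\<gamma>" 1 t] by simp
    then show "t powr (- \<gamma>) / T t \<le> B"
      unfolding B_def using anti[OF t2] pos by (intro frac_le) auto
  qed
  show ?thesis
  proof (rule exI[of _ "1/B"], intro conjI exI[of _ t0] allI impI)
    fix t assume "t0 \<le> t"
    then show "1 / B * t powr (- \<gamma>) \<le> T t" using 1[of t] B pos[of t] by (simp add: field_simps)
  qed (use B in simp)
qed

section \<open>Moments below the tail index\<close>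

text \<open>Dyadic layers: \<open>\<bar>x\<bar> powr \<beta>\<close> is at most \<open>2 powr ((k + 1) * \<beta>)\<close> where \<open>2 ^ k < \<bar>x\<bar> \<le> 2 ^ (k + 1)\<close>.\<close>
lemma (in prob_space) integrable_abs_powr:
  fixes X :: "'a \<Rightarrow> real"
  assumes X [measurable]: "X \<in> borel_measurable M" and "0 < \<beta>" "\<beta> < \<beta>'"
    and tail: "\<And>t. t \<ge> 1 \<Longrightarrow> prob {\<omega>\<in>space M. t < \<bar>X \<omega>\<bar>} \<le> C * t powr (- \<beta>')"
  shows "integrable M (\<lambda>\<omega>. \<bar>X \<omega>\<bar> powr \<beta>)"
proof (rule integrableI_nonneg)
  show "(\<lambda>\<omega>. \<bar>X \<omega>\<bar> powr \<beta>) \<in> borel_measurable M" by measurable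
  let ?w = "\<lambda>k. (2::real) powr (real (Suc k) * \<beta>)"
  let ?A = "\<lambda>k. {\<omega>\<in>space M. 2 ^ k < \<bar>X \<omega>\<bar>}"
  have pt: "ennreal (\<bar>X \<omega>\<bar> powr \<beta>) \<le> 1 + (\<Sum>k. ennreal (?w k) * indicator (?A k) \<omega>)" if w: "\<omega> \<in> space M" for \<omega>
  proof (cases "\<bar>X \<omega>\<bar> \<le> 1")
    case True
    then have "\<bar>X \<omega>\<bar> powr \<beta> \<le> 1 powr \<beta>" using \<open>0 < \<beta>\<close> by (intro powr_mono2) auto
    then have "ennreal (\<bar>X \<omega>\<bar> powr \<beta>) \<le> 1" using ennreal_leI by fastforce
    then show ?thesis by (intro add_increasing2 zero_le)
  next
    case False
    define k where "k = (LEAST k. \<bar>X \<omega>\<bar> \<le> 2 ^ Suc k)"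
    have ex: "\<exists>k. \<bar>X \<omega>\<bar> \<le> 2 ^ Suc k"
    proof -
      obtain k where "\<bar>X \<omega>\<bar> < 2 ^ k" using real_arch_pow[of 2] by auto
      also have "(2::real) ^ k \<le> 2 ^ Suc k" by simp
      finally show ?thesis by (meson less_imp_le)
    qed
    have k: "\<bar>X \<omega>\<bar> \<le> 2 ^ Suc k" unfolding k_def using ex by (rule LeastI_ex)
    have k': "2 ^ k < \<bar>X \<omega>\<bar>"
    proof (cases k)
      case 0 then show ?thesis using False by simp
    next
      case (Suc l)
      then have "\<not> \<bar>X \<omega>\<bar> \<le> 2 ^ Suc l" using not_less_Least[of l "\<lambda>k. \<bar>X \<omega>\<bar> \<le> 2 ^ Suc k"] by (simp add: k_def)
      then show ?thesis using Suc by simp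
    qed
    have "\<bar>X \<omega>\<bar> powr \<beta> \<le> (2 ^ Suc k) powr \<beta>" using k \<open>0 < \<beta>\<close> by (intro powr_mono2) auto
    also have "(2::real) ^ Suc k = 2 powr real (Suc k)" by (rule powr_realpow[symmetric]) simp
    also have "\<dots> powr \<beta> = ?w k" by (rule powr_powr)
    finally have "ennreal (\<bar>X \<omega>\<bar> powr \<beta>) \<le> ennreal (?w k) * indicator (?A k) \<omega>"
      using w k' by (simp add: ennreal_leI)
    also have "\<dots> \<le> (\<Sum>k. ennreal (?w k) * indicator (?A k) \<omega>)"
    proof -
      define F where "F k = ennreal (?w k) * indicator (?A k) \<omega>" for k
      have "sum F {k} \<le> suminf F" by (rule sum_le_suminf) auto
      then have "F k \<le> suminf F" by simp
      then show ?thesis unfolding F_def .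
    qed
    finally show ?thesis by (intro add_increasing zero_le)
  qed
  have C: "C \<ge> 0" using order_trans[OF measure_nonneg tail[of 1]] by simp
  define q where "q = (2::real) powr (\<beta> - \<beta>')"
  have q: "0 < q" "q < 1" using \<open>\<beta> < \<beta>'\<close> by (auto simp: q_def powr_less_one)
  have layer: "ennreal (?w k) * emeasure M (?A k) \<le> ennreal (C * 2 powr \<beta> * q ^ k)" for k
  proof -
    have "prob (?A k) \<le> C * (2 ^ k) powr (- \<beta>')" by (intro tail) simp
    then have "?w k * prob (?A k) \<le> ?w k * (C * (2 ^ k) powr (- \<beta>'))" by (intro mult_left_mono) auto
    also have "\<dots> = C * (2 powr (real (Suc k) * \<beta>) * 2 powr (real k * (- \<beta>')))"
      by (simp only: powr_realpow[symmetric, OF zero_less_numeral] powr_powr mult.left_commute)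
    also have "\<dots> = C * 2 powr (\<beta> + real k * (\<beta> - \<beta>'))"
      by (simp add: powr_add[symmetric] algebra_simps)
    also have "\<dots> = C * 2 powr \<beta> * q ^ k"
      by (simp add: q_def powr_add powr_realpow[symmetric] powr_powr mult.commute)
    finally show ?thesis
      by (simp add: emeasure_eq_measure ennreal_mult[symmetric] ennreal_leI)
  qed
  have "(\<integral>\<^sup>+ \<omega>. ennreal (\<bar>X \<omega>\<bar> powr \<beta>) \<partial>M) \<le> (\<integral>\<^sup>+ \<omega>. 1 + (\<Sum>k. ennreal (?w k) * indicator (?A k) \<omega>) \<partial>M)"
    by (intro nn_integral_mono pt)
  also have "\<dots> = 1 + (\<Sum>k. ennreal (?w k) * emeasure M (?A k))"
    by (simp add: nn_integral_add nn_integral_suminf nn_integral_cmult_indicator emeasure_space_1)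
  also have "\<dots> \<le> 1 + (\<Sum>k. ennreal (C * 2 powr \<beta> * q ^ k))"
    by (intro add_left_mono suminf_le layer) auto
  also have "(\<Sum>k. ennreal (C * 2 powr \<beta> * q ^ k)) = ennreal (\<Sum>k. C * 2 powr \<beta> * q ^ k)"
    using q C by (intro suminf_ennreal2 summable_mult summable_geometric) auto
  also have "1 + ennreal (\<Sum>k. C * 2 powr \<beta> * q ^ k) < \<infinity>" by simp
  finally show "(\<integral>\<^sup>+ \<omega>. ennreal (\<bar>X \<omega>\<bar> powr \<beta>) \<partial>M) < \<infinity>" .
qed simp

section \<open>Truncation of the random walk\<close>

locale heavy_tailed_walk = prob_space M for M :: "'a measure" +
  fixes Z :: "nat \<Rightarrow> 'a \<Rightarrow> real" and lam :: "nat \<Rightarrow> real" and \<alpha> \<rho> p :: real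
  assumes indep: "indep_vars (\<lambda>_. borel) Z {1..}"
    and ident: "\<forall>i\<ge>1. distr M borel (Z i) = distr M borel (Z 1)"
    and alpha_pos: "\<alpha> > 0"
    and tail_rv: "regularly_varying_rv M (Z 1) \<alpha> p"
    and centered: "integrable M (Z 1) \<longrightarrow> expectation (Z 1) = 0"
    and lam_rv: "regularly_varying_seq lam \<rho>"
    and lam_top: "filterlim lam at_top sequentially"
    and fin_var: "finite_variance M (Z 1) \<longrightarrow> \<rho> > 1 / 2"
    and inf_var: "\<not> finite_variance M (Z 1) \<longrightarrow> \<alpha> * \<rho> > 1"
begin

lemma Z_measurable: "1 \<le> i \<Longrightarrow> Z i \<in> borel_measurable M"
  using indep by (auto simp: indep_vars_def)

lemma Z1_measurable [measurable]: "Z 1 \<in> borel_measurable M"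
  by (rule Z_measurable) simp

(* The simplifier turns Z 1 into Z (Suc 0). *)
lemma Z_Suc0_measurable [measurable]: "Z (Suc 0) \<in> borel_measurable M"
  by (rule Z_measurable) simp

lemma lam_pos: "n \<ge> 1 \<Longrightarrow> lam n > 0"
  using lam_rv by (auto simp: regularly_varying_seq_def)

definition tail :: "real \<Rightarrow> real" where
  "tail t = prob {\<omega>\<in>space M. t < \<bar>Z 1 \<omega>\<bar>}"

text \<open>The expected number of steps larger than \<open>lam n\<close>.\<close>
definition big_rate :: "nat \<Rightarrow> real" where
  "big_rate n = real n * tail (lam n)"

lemma gamma_seq_eq: "gamma_seq M Z lam j n = inverse (big_rate n ^ j)"
  by (simp add: gamma_seq_def big_rate_def tail_def)

lemma prob_Z: 
  assumes "1 \<le> i" "B \<in> sets borel"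
  shows "prob {\<omega>\<in>space M. Z i \<omega> \<in> B} = prob {\<omega>\<in>space M. Z 1 \<omega> \<in> B}"
proof -
  have "prob {\<omega>\<in>space M. Z i \<omega> \<in> B} = measure (distr M borel (Z i)) B"
    using assms Z_measurable[of i] by (simp add: measure_distr vimage_def Int_def conj_commute)
  also have "distr M borel (Z i) = distr M borel (Z 1)" using ident assms by blast
  also have "measure (distr M borel (Z 1)) B = prob {\<omega>\<in>space M. Z 1 \<omega> \<in> B}"
    using assms Z1_measurable by (simp add: measure_distr vimage_def Int_def conj_commute)
  finally show ?thesis .
qed

lemma tail_antimono: "s \<le> t \<Longrightarrow> tail t \<le> tail s"
  unfolding tail_def by (intro finite_measure_mono) auto

lemma tail_ratio: "x > 0 \<Longrightarrow> ((\<lambda>t. tail (t * x) / tail t) \<longlongrightarrow> x powr (- \<alpha>)) at_top"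
  using tail_rv unfolding regularly_varying_rv_def tail_def by blast

lemma tail_le_1: "tail t \<le> 1"
  by (simp add: tail_def)

text \<open>Division by zero yields zero, so the limit of the tail ratio could not be positive otherwise.\<close>
lemma tail_pos: "0 < tail t"
proof -
  have "\<forall>\<^sub>F s in at_top. 0 < tail (s * 1) / tail s"
    using tail_ratio[of 1] by (rule order_tendstoD) simp_all
  then have "\<forall>\<^sub>F s in at_top. 0 < tail s"
  proof eventually_elim
    case (elim s)
    then have "tail s \<noteq> 0" by auto
    moreover have "0 \<le> tail s" by (simp add: tail_def)
    ultimately show ?case by simp
  qed
  then obtain s0 where "\<And>s. s \<ge> s0 \<Longrightarrow> 0 < tail s" by (auto simp: eventually_at_top_linorder)
  then have "0 < tail (max s0 t)" by simp
  also have "\<dots> \<le> tail t" by (rule tail_antimono) simp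
  finally show ?thesis .
qed

lemma big_rate_pos: "n \<ge> 1 \<Longrightarrow> 0 < big_rate n"
  using tail_pos by (simp add: big_rate_def)

lemma abs_moment_below_index:
  assumes "0 < \<beta>" "\<beta> < \<alpha>"
  shows "integrable M (\<lambda>\<omega>. \<bar>Z 1 \<omega>\<bar> powr \<beta>)"
proof -
  obtain \<beta>' where b: "\<beta> < \<beta>'" "\<beta>' < \<alpha>" using dense assms(2) by blast
  have "\<exists>C>0. \<forall>t\<ge>1. tail t \<le> C * t powr (- \<beta>')"
    using b assms by (intro tail_upper[of tail \<alpha>] tail_antimono tail_pos tail_le_1 tail_ratio) auto
  then obtain C where "\<And>t. t \<ge> 1 \<Longrightarrow> tail t \<le> C * t powr (- \<beta>')" by blast
  then show ?thesis using b assms by (intro integrable_abs_powr[of "Z 1" \<beta> \<beta>' C]) (auto simp: tail_def)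
qed

lemma square_integrable_imp_finite_variance:
  assumes "integrable M (\<lambda>\<omega>. (Z 1 \<omega>)\<^sup>2)"
  shows "finite_variance M (Z 1)"
proof -
  have i: "integrable M (Z 1)" using square_integrable_imp_integrable[OF Z1_measurable assms] .
  moreover have "(\<lambda>\<omega>. (Z 1 \<omega> - expectation (Z 1))\<^sup>2) = (\<lambda>\<omega>. (Z 1 \<omega>)\<^sup>2)" using centered i by simp
  ultimately show ?thesis using assms by (simp add: finite_variance_def)
qed

text \<open>
  The exponent \<open>\<beta>\<close> unifies the two regimes of the theorem: it is \<open>2\<close> if the variance is finite, and
  lies between \<open>1 / \<rho>\<close> and \<open>\<alpha>\<close> otherwise. The small jumps and the number of big jumps are both
  controlled by \<open>n * lam n powr (- \<beta>)\<close>, which decays polynomially.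
\<close>
lemma moment_exponent:
  obtains \<beta> where "0 < \<beta>" "\<beta> \<le> 2" "1 < \<beta> * \<rho>" "integrable M (\<lambda>\<omega>. \<bar>Z 1 \<omega>\<bar> powr \<beta>)"
proof (cases "finite_variance M (Z 1)")
  case True
  then have i: "integrable M (Z 1)" by (simp add: finite_variance_def)
  then have "integrable M (\<lambda>\<omega>. (Z 1 \<omega>)\<^sup>2)" using True centered by (simp add: finite_variance_def)
  then have "integrable M (\<lambda>\<omega>. \<bar>Z 1 \<omega>\<bar> powr 2)" by simp
  then show ?thesis using that[of 2] fin_var True by simp
next
  case False
  then have ar: "\<alpha> * \<rho> > 1" using inf_var by simp
  then have rho: "\<rho> > 0" using alpha_pos by (metis less_trans zero_less_mult_pos zero_less_one)
  have "\<alpha> \<le> 2"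
  proof (rule ccontr)
    assume "\<not> \<alpha> \<le> 2"
    then have "integrable M (\<lambda>\<omega>. \<bar>Z 1 \<omega>\<bar> powr 2)" by (intro abs_moment_below_index) auto
    then have "integrable M (\<lambda>\<omega>. (Z 1 \<omega>)\<^sup>2)" by simp
    then show False using square_integrable_imp_finite_variance False by blast
  qed
  have "1 / \<rho> < \<alpha>" using ar rho by (simp add: field_simps)
  then obtain \<beta> where b: "1 / \<rho> < \<beta>" "\<beta> < \<alpha>" using dense by blast
  have "0 < 1 / \<rho>" using rho by simp
  then have "0 < \<beta>" using b by linarith
  moreover have "1 < \<beta> * \<rho>" using b rho by (simp add: field_simps)
  ultimately show ?thesis using that[of \<beta>] b \<open>\<alpha> \<le> 2\<close> abs_moment_below_index[of \<beta>] by simp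
qed

text \<open>
  The probability of \<open>j\<close> big jumps is at least polynomial, so super-polynomially small errors do not
  matter.
\<close>
lemma big_rate_lower: "\<exists>c>0. \<exists>\<kappa>>0. \<exists>N. \<forall>n\<ge>N. c * real n powr (- \<kappa>) \<le> big_rate n"
proof -
  \<comment> \<open>Any exponents above \<open>\<alpha>\<close> and \<open>\<rho>\<close> will do, as long as they are positive.\<close>
  define \<gamma> where "\<gamma> = \<alpha> + 1"
  define \<tau> where "\<tau> = \<bar>\<rho>\<bar> + 1"
  have "\<exists>c>0. \<exists>t0. \<forall>t\<ge>t0. c * t powr (- \<gamma>) \<le> tail t"
    using alpha_pos by (intro tail_lower[of tail \<alpha>] tail_antimono tail_pos tail_ratio) (auto simp: \<gamma>_def)
  then obtain c t0 where c: "c > 0" "\<forall>t\<ge>t0. c * t powr (- \<gamma>) \<le> tail t" by blast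
  have "\<exists>C>0. \<forall>n\<ge>1. lam n \<le> C * real n powr \<tau>"
    by (rule regularly_varying_seq_upper[OF lam_rv]) (simp add: \<tau>_def)
  then obtain C where C: "C > 0" "\<forall>n\<ge>1. lam n \<le> C * real n powr \<tau>" by blast
  from lam_top have "\<forall>\<^sub>F n in sequentially. t0 \<le> lam n" by (simp add: filterlim_at_top)
  then obtain N where N: "\<forall>n\<ge>N. t0 \<le> lam n" by (auto simp: eventually_sequentially)
  have g: "\<gamma> > 0" "\<tau> > 0" using alpha_pos by (auto simp: \<gamma>_def \<tau>_def)
  show ?thesis
  proof (rule exI[of _ "c * C powr (- \<gamma>)"], intro conjI, goal_cases)
    case 2
    show ?case
    proof (rule exI[of _ "\<gamma> * \<tau>"], intro conjI exI[of _ "max N 1"] allI impI)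
      fix n assume n: "max N 1 \<le> n"
      have "C powr (- \<gamma>) * real n powr (- (\<gamma> * \<tau>)) = (C * real n powr \<tau>) powr (- \<gamma>)"
        using C by (simp add: powr_mult powr_powr mult.commute)
      also have "\<dots> \<le> lam n powr (- \<gamma>)"
        using C n g lam_pos[of n] by (intro powr_mono2') auto
      finally have "c * C powr (- \<gamma>) * real n powr (- (\<gamma> * \<tau>)) \<le> c * lam n powr (- \<gamma>)"
        using c by simp
      also have "\<dots> \<le> tail (lam n)" using c N n by simp
      also have "\<dots> \<le> big_rate n" using n tail_pos[of "lam n"] by (simp add: big_rate_def)
      finally show "c * C powr (- \<gamma>) * real n powr (- (\<gamma> * \<tau>)) \<le> big_rate n" .
    qed (use g in simp)
  qed (use c C in simp)
qed

text \<open>Choose \<open>\<sigma>\<close> between \<open>1 / \<beta>\<close> and \<open>\<rho>\<close>; then \<open>lam n\<close> is at least of order \<open>n powr \<sigma>\<close> with \<open>\<beta> * \<sigma> > 1\<close>.\<close>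
lemma moment_rate:
  assumes "0 < \<beta>" "1 < \<beta> * \<rho>"
  shows "\<exists>C>0. \<exists>\<eta>>0. \<forall>n\<ge>1. real n * lam n powr (- \<beta>) \<le> C * real n powr (- \<eta>)"
proof -
  have "1 / \<beta> < \<rho>" using assms by (simp add: field_simps)
  then obtain \<sigma> where s: "1 / \<beta> < \<sigma>" "\<sigma> < \<rho>" using dense by blast
  obtain c where c: "c > 0" "\<forall>n\<ge>1. c * real n powr \<sigma> \<le> lam n"
    using regularly_varying_seq_lower[OF lam_rv s(2)] by blast
  define \<eta> where "\<eta> = \<beta> * \<sigma> - 1"
  have eta: "\<eta> > 0" using s(1) assms by (simp add: \<eta>_def field_simps)
  have "real n * lam n powr (- \<beta>) \<le> c powr (- \<beta>) * real n powr (- \<eta>)" if n: "n \<ge> 1" for n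
  proof -
    have "lam n powr (- \<beta>) \<le> (c * real n powr \<sigma>) powr (- \<beta>)"
      using c n assms by (intro powr_mono2') auto
    also have "\<dots> = c powr (- \<beta>) * real n powr (- (\<beta> * \<sigma>))"
      using c by (simp add: powr_mult powr_powr mult.commute)
    finally have "real n * lam n powr (- \<beta>) \<le> real n * (c powr (- \<beta>) * real n powr (- (\<beta> * \<sigma>)))"
      by (intro mult_left_mono) auto
    also have "\<dots> = c powr (- \<beta>) * (real n powr 1 * real n powr (- (\<beta> * \<sigma>)))" using n by simp
    also have "\<dots> = c powr (- \<beta>) * real n powr (- \<eta>)"
      by (simp only: powr_add[symmetric]) (simp add: \<eta>_def)
    finally show ?thesis .
  qed
  then show ?thesis using c eta by (intro exI[of _ "c powr (- \<beta>)"] conjI exI[of _ \<eta>]) auto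
qed

lemma powr_neg_tendsto_0: "\<eta> > 0 \<Longrightarrow> (\<lambda>n. real n powr (- \<eta>)) \<longlonglongrightarrow> 0"
  by (rule tendsto_neg_powr) (auto intro: filterlim_real_sequentially)

text \<open>This is Markov's inequality for the moment of order \<open>\<beta>\<close>, combined with \<open>moment_rate\<close>.\<close>
lemma big_rate_tendsto_0: "big_rate \<longlonglongrightarrow> 0"
proof -
  obtain \<beta> where b: "0 < \<beta>" "1 < \<beta> * \<rho>" "integrable M (\<lambda>\<omega>. \<bar>Z 1 \<omega>\<bar> powr \<beta>)"
    using moment_exponent by metis
  obtain C \<eta> where C: "C > 0" "\<eta> > 0" "\<forall>n\<ge>1. real n * lam n powr (- \<beta>) \<le> C * real n powr (- \<eta>)"
    using moment_rate[OF b(1,2)] by blast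
  define m where "m = expectation (\<lambda>\<omega>. \<bar>Z 1 \<omega>\<bar> powr \<beta>)"
  have m: "m \<ge> 0" by (simp add: m_def)
  have tl: "tail t \<le> t powr (- \<beta>) * m" if t: "t > 0" for t
  proof -
    have "tail t \<le> prob {\<omega>\<in>space M. t powr \<beta> \<le> \<bar>Z 1 \<omega>\<bar> powr \<beta>}"
      unfolding tail_def using t b(1) by (intro finite_measure_mono) (auto intro!: powr_mono2)
    also have "\<dots> \<le> m / t powr \<beta>"
      unfolding m_def using t b by (intro integral_Markov_inequality_measure[where A = "{}"]) auto
    finally show ?thesis by (simp add: powr_minus field_simps)
  qed
  have "big_rate n \<le> m * (C * real n powr (- \<eta>))" if "n \<ge> 1" for n
  proof -
    have "big_rate n \<le> real n * (lam n powr (- \<beta>) * m)"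
      unfolding big_rate_def by (intro mult_left_mono tl lam_pos that) simp
    also have "\<dots> = m * (real n * lam n powr (- \<beta>))" by simp
    also have "\<dots> \<le> m * (C * real n powr (- \<eta>))" using C that m by (intro mult_left_mono) auto
    finally show ?thesis .
  qed
  then have "\<forall>\<^sub>F n in sequentially. big_rate n \<le> m * (C * real n powr (- \<eta>))"
    by (rule eventually_sequentiallyI)
  moreover have "\<forall>\<^sub>F n in sequentially. 0 \<le> big_rate n" by (simp add: big_rate_def tail_def)
  moreover have "(\<lambda>n. m * (C * real n powr (- \<eta>))) \<longlonglongrightarrow> m * (C * 0)"
    by (intro tendsto_intros powr_neg_tendsto_0 C(2))
  ultimately show ?thesis by (intro tendsto_sandwich[of "\<lambda>_. 0" big_rate]) auto
qed

definition trunc :: "real \<Rightarrow> nat \<Rightarrow> nat \<Rightarrow> 'a \<Rightarrow> real" where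
  "trunc \<delta> n i \<omega> = (if \<bar>Z i \<omega>\<bar> \<le> \<delta> * lam n then Z i \<omega> else 0)"

lemma trunc_measurable: "1 \<le> i \<Longrightarrow> trunc \<delta> n i \<in> borel_measurable M"
  unfolding trunc_def using Z_measurable[of i] by measurable

lemma trunc_abs_le: "1 \<le> n \<Longrightarrow> 0 < \<delta> \<Longrightarrow> \<bar>trunc \<delta> n i \<omega>\<bar> \<le> \<delta> * lam n"
  using lam_pos[of n] by (simp add: trunc_def)

text \<open>
  For \<open>\<bar>x\<bar> \<le> c\<close> and \<open>k \<ge> \<beta>\<close> one has \<open>\<bar>x\<bar> powr k \<le> c powr (k - \<beta>) * \<bar>x\<bar> powr \<beta>\<close>, and for \<open>\<bar>x\<bar> > c\<close> and
  \<open>\<beta> \<ge> 1\<close> the same holds with \<open>k = 1\<close>.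
\<close>
lemma truncated_moments:
  assumes b: "0 < \<beta>" "\<beta> \<le> 2" "integrable M (\<lambda>\<omega>. \<bar>Z 1 \<omega>\<bar> powr \<beta>)" and n: "1 \<le> n" and d: "0 < \<delta>"
  shows "\<bar>expectation (trunc \<delta> n 1)\<bar> \<le> (\<delta> * lam n) powr (1 - \<beta>) * expectation (\<lambda>\<omega>. \<bar>Z 1 \<omega>\<bar> powr \<beta>)"
    and "expectation (\<lambda>\<omega>. (trunc \<delta> n 1 \<omega>)\<^sup>2) \<le> (\<delta> * lam n) powr (2 - \<beta>) * expectation (\<lambda>\<omega>. \<bar>Z 1 \<omega>\<bar> powr \<beta>)"
proof -
  define c where "c = \<delta> * lam n"
  have c: "c > 0" using d lam_pos[OF n] by (simp add: c_def)
  have tm [measurable]: "trunc \<delta> n 1 \<in> borel_measurable M" "trunc \<delta> n (Suc 0) \<in> borel_measurable M"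
    by (rule trunc_measurable, simp)+
  have bnd: "\<bar>trunc \<delta> n 1 \<omega>\<bar> \<le> c" for \<omega> using trunc_abs_le[OF n d] by (simp add: c_def)
  have int1: "integrable M (trunc \<delta> n 1)"
    by (rule integrable_const_bound[of _ c]) (use bnd in auto)
  have below: "\<bar>trunc \<delta> n 1 \<omega>\<bar> powr k \<le> c powr (k - \<beta>) * \<bar>Z 1 \<omega>\<bar> powr \<beta>" if "\<beta> \<le> k" for k \<omega>
  proof (cases "\<bar>Z 1 \<omega>\<bar> \<le> c \<and> Z 1 \<omega> \<noteq> 0")
    case True
    then have "\<bar>Z 1 \<omega>\<bar> powr k = \<bar>Z 1 \<omega>\<bar> powr (k - \<beta>) * \<bar>Z 1 \<omega>\<bar> powr \<beta>" by (simp add: powr_add[symmetric])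
    also have "\<dots> \<le> c powr (k - \<beta>) * \<bar>Z 1 \<omega>\<bar> powr \<beta>"
      using True that by (intro mult_right_mono powr_mono2) auto
    finally show ?thesis using True by (simp add: trunc_def c_def)
  next
    case False
    then show ?thesis by (auto simp: trunc_def c_def)
  qed
  have "expectation (\<lambda>\<omega>. (trunc \<delta> n 1 \<omega>)\<^sup>2) \<le> expectation (\<lambda>\<omega>. c powr (2 - \<beta>) * \<bar>Z 1 \<omega>\<bar> powr \<beta>)"
  proof (rule integral_mono')
    show "(trunc \<delta> n 1 \<omega>)\<^sup>2 \<le> c powr (2 - \<beta>) * \<bar>Z 1 \<omega>\<bar> powr \<beta>" for \<omega>
      using below[of 2 \<omega>] b(2) by simp
  qed (use b in auto)
  then show "expectation (\<lambda>\<omega>. (trunc \<delta> n 1 \<omega>)\<^sup>2) \<le> (\<delta> * lam n) powr (2 - \<beta>) * expectation (\<lambda>\<omega>. \<bar>Z 1 \<omega>\<bar> powr \<beta>)"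
    by (simp add: c_def)
  show "\<bar>expectation (trunc \<delta> n 1)\<bar> \<le> (\<delta> * lam n) powr (1 - \<beta>) * expectation (\<lambda>\<omega>. \<bar>Z 1 \<omega>\<bar> powr \<beta>)"
  proof (cases "\<beta> \<le> 1")
    case True
    have "\<bar>expectation (trunc \<delta> n 1)\<bar> \<le> expectation (\<lambda>\<omega>. \<bar>trunc \<delta> n 1 \<omega>\<bar>)" by (rule integral_abs_bound)
    also have "\<dots> \<le> expectation (\<lambda>\<omega>. c powr (1 - \<beta>) * \<bar>Z 1 \<omega>\<bar> powr \<beta>)"
    proof (rule integral_mono')
      show "\<bar>trunc \<delta> n 1 \<omega>\<bar> \<le> c powr (1 - \<beta>) * \<bar>Z 1 \<omega>\<bar> powr \<beta>" for \<omega>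
        using below[OF True, of \<omega>] by simp
    qed (use b in auto)
    finally show ?thesis by (simp add: c_def)
  next
    case False
    \<comment> \<open>Now the mean exists and vanishes, so the truncated mean is minus that of the large values.\<close>
    have above: "\<bar>trunc \<delta> n 1 \<omega> - Z 1 \<omega>\<bar> \<le> c powr (1 - \<beta>) * \<bar>Z 1 \<omega>\<bar> powr \<beta>" for \<omega>
    proof (cases "\<bar>Z 1 \<omega>\<bar> \<le> c")
      case True
      then show ?thesis by (simp add: trunc_def c_def)
    next
      case F: False
      have "\<bar>Z 1 \<omega>\<bar> = \<bar>Z 1 \<omega>\<bar> powr (1 - \<beta>) * \<bar>Z 1 \<omega>\<bar> powr \<beta>" using F c by (simp add: powr_add[symmetric])
      also have "\<dots> \<le> c powr (1 - \<beta>) * \<bar>Z 1 \<omega>\<bar> powr \<beta>"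
        using F c False by (intro mult_right_mono powr_mono2') auto
      finally show ?thesis using F by (simp add: trunc_def c_def)
    qed
    have intd: "integrable M (\<lambda>\<omega>. trunc \<delta> n 1 \<omega> - Z 1 \<omega>)"
    proof (rule Bochner_Integration.integrable_bound)
      show "integrable M (\<lambda>\<omega>. c powr (1 - \<beta>) * \<bar>Z 1 \<omega>\<bar> powr \<beta>)" using b by simp
      show "AE \<omega> in M. norm (trunc \<delta> n 1 \<omega> - Z 1 \<omega>) \<le> norm (c powr (1 - \<beta>) * \<bar>Z 1 \<omega>\<bar> powr \<beta>)"
        using above by (auto simp: abs_mult)
    qed measurable
    have "integrable M (\<lambda>\<omega>. trunc \<delta> n 1 \<omega> - (trunc \<delta> n 1 \<omega> - Z 1 \<omega>))" using int1 intd by (rule Bochner_Integration.integrable_diff)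
    then have iZ: "integrable M (Z 1)" by simp
    then have "expectation (trunc \<delta> n 1) = expectation (\<lambda>\<omega>. trunc \<delta> n 1 \<omega> - Z 1 \<omega>)"
      using int1 centered by simp
    also have "\<bar>\<dots>\<bar> \<le> expectation (\<lambda>\<omega>. \<bar>trunc \<delta> n 1 \<omega> - Z 1 \<omega>\<bar>)" by (rule integral_abs_bound)
    also have "\<dots> \<le> expectation (\<lambda>\<omega>. c powr (1 - \<beta>) * \<bar>Z 1 \<omega>\<bar> powr \<beta>)"
      by (rule integral_mono') (use b above in auto)
    finally show ?thesis by (simp add: c_def)
  qed
qed

text \<open>
  The small jumps are negligible at every polynomial scale: the maximal inequality with
  \<open>t = \<epsilon> * lam n / (2 * r)\<close> bounds the probability by the \<open>r\<close>-th power of a negative power of \<open>n\<close>,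
  and \<open>r\<close> may be taken as large as desired if the truncation level is small accordingly.
\<close>
lemma small_jumps_negligible:
  assumes eps: "\<epsilon> > 0"
  shows "\<exists>\<delta>0>0. \<forall>\<delta>. 0 < \<delta> \<longrightarrow> \<delta> \<le> \<delta>0 \<longrightarrow>
    (\<lambda>n. prob {\<omega>\<in>space M. \<exists>k\<in>{1..n}. \<epsilon> * lam n < \<bar>\<Sum>i=1..k. trunc \<delta> n i \<omega>\<bar>} / big_rate n ^ j) \<longlonglongrightarrow> 0"
proof -
  obtain \<beta> where b: "0 < \<beta>" "\<beta> \<le> 2" "1 < \<beta> * \<rho>" "integrable M (\<lambda>\<omega>. \<bar>Z 1 \<omega>\<bar> powr \<beta>)"
    using moment_exponent by metis
  obtain C \<eta> where C: "C > 0" "\<eta> > 0" "\<forall>n\<ge>1. real n * lam n powr (- \<beta>) \<le> C * real n powr (- \<eta>)"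
    using moment_rate[OF b(1,3)] by blast
  obtain c \<kappa> N where c: "c > 0" "\<kappa> > 0" "\<forall>n\<ge>N. c * real n powr (- \<kappa>) \<le> big_rate n"
    using big_rate_lower by blast
  define m where "m = expectation (\<lambda>\<omega>. \<bar>Z 1 \<omega>\<bar> powr \<beta>)"
  have m: "m \<ge> 0" by (simp add: m_def)
  \<comment> \<open>So large that \<open>n powr (- r * \<eta>)\<close> is negligible against the lower bound \<open>n powr (- j * \<kappa>)\<close>.\<close>
  obtain r :: nat where r: "real j * \<kappa> / \<eta> < real r" using reals_Archimedean2 by blast
  have "0 \<le> real j * \<kappa> / \<eta>" using c C by simp
  then have r0: "r > 0" using r by (cases r) auto
  have rk: "real r * \<eta> - real j * \<kappa> > 0" using r C by (simp add: field_simps)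
  \<comment> \<open>With \<open>t\<close> and the bound of the steps at most \<open>\<theta> * lam n\<close>, \<open>r\<close> passages reach up to \<open>\<epsilon> * lam n\<close>.\<close>
  define \<theta> where "\<theta> = \<epsilon> / (2 * real r)"
  have th: "\<theta> > 0" using eps r0 by (simp add: \<theta>_def)
  show ?thesis
  proof (intro exI[of _ \<theta>] conjI allI impI th)
    fix \<delta> assume d: "0 < \<delta>" "\<delta> \<le> \<theta>"
    define K where "K = (2 * \<theta> * \<delta> powr (1 - \<beta>) + \<delta> powr (2 - \<beta>)) * m / \<theta>\<^sup>2"
    have K: "K \<ge> 0" using th m by (simp add: K_def)
    let ?E = "\<lambda>n. {\<omega>\<in>space M. \<exists>k\<in>{1..n}. \<epsilon> * lam n < \<bar>\<Sum>i=1..k. trunc \<delta> n i \<omega>\<bar>}"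
    have main: "prob (?E n) \<le> (K * (C * real n powr (- \<eta>))) ^ r" if n: "n \<ge> 1" for n
    proof -
      have lam: "lam n > 0" using n by (rule lam_pos)
      have level: "real r * (\<theta> * lam n + \<delta> * lam n) \<le> \<epsilon> * lam n"
      proof -
        have "real r * (\<theta> + \<delta>) \<le> real r * (2 * \<theta>)" using d by (intro mult_left_mono) auto
        also have "\<dots> = \<epsilon>" using r0 by (simp add: \<theta>_def)
        finally have "real r * (\<theta> + \<delta>) * lam n \<le> \<epsilon> * lam n" using lam by (intro mult_right_mono) auto
        then show ?thesis by (simp add: algebra_simps)
      qed
      have ms: "{\<omega>\<in>space M. \<exists>k\<in>{1..n}. x < \<bar>\<Sum>i=1..k. trunc \<delta> n i \<omega>\<bar>} \<in> sets M" for x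
      proof (intro sets.sets_Collect_finite_Ex)
        fix k assume "k \<in> {1..n}"
        have [measurable]: "(\<lambda>\<omega>. \<Sum>i=1..k. trunc \<delta> n i \<omega>) \<in> borel_measurable M"
          by (intro borel_measurable_sum trunc_measurable) auto
        show "{\<omega>\<in>space M. x < \<bar>\<Sum>i=1..k. trunc \<delta> n i \<omega>\<bar>} \<in> sets M" by measurable
      qed auto
      have "prob (?E n) \<le> prob {\<omega>\<in>space M. \<exists>k\<in>{1..n}. real r * (\<theta> * lam n + \<delta> * lam n) < \<bar>\<Sum>i=1..k. trunc \<delta> n i \<omega>\<bar>}"
        using level by (intro finite_measure_mono ms) (auto intro: le_less_trans)
      also have "\<dots> \<le> (real n * (2 * (\<theta> * lam n) * \<bar>expectation (trunc \<delta> n 1)\<bar> + expectation (\<lambda>\<omega>. (trunc \<delta> n 1 \<omega>)\<^sup>2)) / (\<theta> * lam n)\<^sup>2) ^ r"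
      proof (rule max_partial_sum_le)
        define f where "f z = (if \<bar>z\<bar> \<le> \<delta> * lam n then z else 0)" for z
        have f: "f \<in> borel_measurable borel" unfolding f_def by measurable
        have tf: "trunc \<delta> n i = (\<lambda>\<omega>. f (Z i \<omega>))" for i by (auto simp: trunc_def f_def)
        have "indep_vars (\<lambda>_. borel) Z {1..n}" using indep by (rule indep_vars_subset) auto
        then show "indep_vars (\<lambda>_. borel) (trunc \<delta> n) {1..n}"
          unfolding tf by (rule indep_vars_compose2) (use f in auto)
        fix i assume "i \<in> {1..n}"
        then have i: "1 \<le> i" by simp
        have comp: "distr M borel (\<lambda>\<omega>. f (Z k \<omega>)) = distr (distr M borel (Z k)) borel f" if "1 \<le> k" for k
          using distr_distr[OF f Z_measurable[OF that]] by (simp add: o_def)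
        have "distr M borel (Z i) = distr M borel (Z 1)" using ident i by blast
        then show "distr M borel (trunc \<delta> n i) = distr M borel (trunc \<delta> n 1)"
          unfolding tf using comp[OF i] comp[of 1] by simp
      next
        show "trunc \<delta> n 1 \<in> borel_measurable M" by (rule trunc_measurable) simp
        show "\<bar>trunc \<delta> n 1 \<omega>\<bar> \<le> \<delta> * lam n" for \<omega> using n d by (intro trunc_abs_le) auto
      qed (use d lam th in auto)
      also have "\<dots> \<le> (K * (C * real n powr (- \<eta>))) ^ r"
      proof (rule power_mono)
        have "2 * (\<theta> * lam n) * \<bar>expectation (trunc \<delta> n 1)\<bar> + expectation (\<lambda>\<omega>. (trunc \<delta> n 1 \<omega>)\<^sup>2)
            \<le> 2 * (\<theta> * lam n) * ((\<delta> * lam n) powr (1 - \<beta>) * m) + (\<delta> * lam n) powr (2 - \<beta>) * m"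
          unfolding m_def using b n d th lam by (intro add_mono mult_left_mono truncated_moments) auto
        also have "(\<delta> * lam n) powr (1 - \<beta>) = \<delta> powr (1 - \<beta>) * (lam n * lam n powr (- \<beta>))"
          using lam d by (simp add: powr_mult powr_add[symmetric] powr_mult_base)
        also have "(\<delta> * lam n) powr (2 - \<beta>) = \<delta> powr (2 - \<beta>) * ((lam n)\<^sup>2 * lam n powr (- \<beta>))"
          using lam d powr_add[of "lam n" 2 "- \<beta>"] by (simp add: powr_mult)
        finally have "2 * (\<theta> * lam n) * \<bar>expectation (trunc \<delta> n 1)\<bar> + expectation (\<lambda>\<omega>. (trunc \<delta> n 1 \<omega>)\<^sup>2)
            \<le> (2 * \<theta> * \<delta> powr (1 - \<beta>) + \<delta> powr (2 - \<beta>)) * m * ((lam n)\<^sup>2 * lam n powr (- \<beta>))"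
          by (simp add: algebra_simps power2_eq_square)
        also have "(2 * \<theta> * \<delta> powr (1 - \<beta>) + \<delta> powr (2 - \<beta>)) * m = K * \<theta>\<^sup>2" using th by (simp add: K_def)
        finally have "2 * (\<theta> * lam n) * \<bar>expectation (trunc \<delta> n 1)\<bar> + expectation (\<lambda>\<omega>. (trunc \<delta> n 1 \<omega>)\<^sup>2)
            \<le> (K * \<theta>\<^sup>2) * ((lam n)\<^sup>2 * lam n powr (- \<beta>))" .
        then have "real n * (2 * (\<theta> * lam n) * \<bar>expectation (trunc \<delta> n 1)\<bar> + expectation (\<lambda>\<omega>. (trunc \<delta> n 1 \<omega>)\<^sup>2)) / (\<theta> * lam n)\<^sup>2
            \<le> real n * ((K * \<theta>\<^sup>2) * ((lam n)\<^sup>2 * lam n powr (- \<beta>))) / (\<theta> * lam n)\<^sup>2"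
          by (intro divide_right_mono mult_left_mono) auto
        also have "\<dots> = K * (real n * lam n powr (- \<beta>))"
          using th lam by (simp add: power_mult_distrib field_simps)
        also have "\<dots> \<le> K * (C * real n powr (- \<eta>))" using C n K by (intro mult_left_mono) auto
        finally show "real n * (2 * (\<theta> * lam n) * \<bar>expectation (trunc \<delta> n 1)\<bar> + expectation (\<lambda>\<omega>. (trunc \<delta> n 1 \<omega>)\<^sup>2)) / (\<theta> * lam n)\<^sup>2
            \<le> K * (C * real n powr (- \<eta>))" .
        show "0 \<le> real n * (2 * (\<theta> * lam n) * \<bar>expectation (trunc \<delta> n 1)\<bar> + expectation (\<lambda>\<omega>. (trunc \<delta> n 1 \<omega>)\<^sup>2)) / (\<theta> * lam n)\<^sup>2"
          using th lam by (intro divide_nonneg_nonneg mult_nonneg_nonneg add_nonneg_nonneg) auto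
      qed
      finally show ?thesis .
    qed
    define L where "L = (K * C) ^ r / c ^ j"
    have bound: "prob (?E n) / big_rate n ^ j \<le> L * real n powr (- (real r * \<eta> - real j * \<kappa>))" if n: "n \<ge> max N 1" for n
    proof -
      have cn: "0 < c * real n powr (- \<kappa>)" using c n by simp
      have "prob (?E n) / big_rate n ^ j \<le> (K * (C * real n powr (- \<eta>))) ^ r / (c * real n powr (- \<kappa>)) ^ j"
        using n c cn K C by (intro frac_le main power_mono zero_less_power) auto
      also have "\<dots> = L * ((real n powr (- \<eta>)) ^ r / (real n powr (- \<kappa>)) ^ j)"
        by (simp add: L_def power_mult_distrib)
      also have "(real n powr (- \<eta>)) ^ r / (real n powr (- \<kappa>)) ^ j = real n powr (- (real r * \<eta> - real j * \<kappa>))"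
        using n by (simp add: powr_realpow[symmetric] powr_powr powr_diff[symmetric] mult.commute)
      finally show ?thesis .
    qed
    have "(\<lambda>n. L * real n powr (- (real r * \<eta> - real j * \<kappa>))) \<longlonglongrightarrow> L * 0"
      by (intro tendsto_intros powr_neg_tendsto_0 rk)
    then have lim: "(\<lambda>n. L * real n powr (- (real r * \<eta> - real j * \<kappa>))) \<longlonglongrightarrow> 0"
      by (simp only: mult_zero_right)
    have upper: "\<forall>\<^sub>F n in sequentially. prob (?E n) / big_rate n ^ j \<le> L * real n powr (- (real r * \<eta> - real j * \<kappa>))"
      by (rule eventually_sequentiallyI[of "max N 1"]) (rule bound)
    have lower: "\<forall>\<^sub>F n in sequentially. 0 \<le> prob (?E n) / big_rate n ^ j"
      by (intro eventually_sequentiallyI[of 1] divide_nonneg_nonneg zero_le_power measure_nonneg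
          less_imp_le[OF big_rate_pos])
    show "(\<lambda>n. prob (?E n) / big_rate n ^ j) \<longlonglongrightarrow> 0"
      by (rule tendsto_sandwich[OF lower upper tendsto_const lim])
  qed
qed

end

section \<open>The conditional law of a big jump\<close>

(* From here on Z 1 stays in the form in which the assumptions mention it. *)
declare One_nat_def [simp del]

context heavy_tailed_walk
begin

lemma p_bounds: "0 \<le> p" "p \<le> 1"
  using tail_rv by (auto simp: regularly_varying_rv_def)

text \<open>Monotonicity makes the convergence of the tail ratios insensitive to small perturbations.\<close>
lemma tail_ratio_asymp:
  fixes a b :: "'c \<Rightarrow> real"
  assumes a: "filterlim a at_top F" and ba: "((\<lambda>n. b n / a n) \<longlongrightarrow> x) F" and x: "x > 0"
  shows "((\<lambda>n. tail (b n) / tail (a n)) \<longlongrightarrow> x powr (- \<alpha>)) F"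
proof -
  have cont: "((\<lambda>y. y powr (- \<alpha>)) \<longlongrightarrow> x powr (- \<alpha>)) (nhds x)"
    by (intro tendsto_powr filterlim_ident tendsto_const) (use x in simp)
  have apos: "\<forall>\<^sub>F n in F. 0 < a n" using a by (simp add: filterlim_at_top_dense)
  have near: "\<exists>y z. 0 < y \<and> y < x \<and> x < z \<and> P (y powr (- \<alpha>)) \<and> P (z powr (- \<alpha>))"
    if ev: "\<forall>\<^sub>F y in nhds x. P (y powr (- \<alpha>))" for P
  proof -
    obtain d where d: "d > 0" "\<And>y. dist y x < d \<Longrightarrow> P (y powr (- \<alpha>))"
      using ev unfolding eventually_nhds_metric by auto
    define h where "h = min d x / 2"
    have "0 < h" "h < d" "h < x" using d(1) x by (auto simp: h_def)
    then show ?thesis using d(2)[of "x - h"] d(2)[of "x + h"]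
      by (intro exI[of _ "x - h"] exI[of _ "x + h"]) (auto simp: dist_real_def)
  qed
  show ?thesis
  proof (rule order_tendstoI)
    fix l assume "l < x powr (- \<alpha>)"
    with cont have "\<forall>\<^sub>F y in nhds x. l < y powr (- \<alpha>)" by (rule order_tendstoD)
    then obtain z where z: "x < z" "l < z powr (- \<alpha>)" using near[of "\<lambda>v. l < v"] by blast
    have "((\<lambda>n. tail (a n * z) / tail (a n)) \<longlongrightarrow> z powr (- \<alpha>)) F"
      using z x by (intro filterlim_compose[OF tail_ratio a]) auto
    then have "\<forall>\<^sub>F n in F. l < tail (a n * z) / tail (a n)" using z(2) by (rule order_tendstoD)
    moreover have "\<forall>\<^sub>F n in F. b n / a n < z" using ba z(1) by (rule order_tendstoD)
    ultimately show "\<forall>\<^sub>F n in F. l < tail (b n) / tail (a n)"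
      using apos
    proof eventually_elim
      case (elim n)
      then have "b n \<le> a n * z" by (simp add: field_simps)
      then have "tail (a n * z) / tail (a n) \<le> tail (b n) / tail (a n)"
        using tail_pos[of "a n"] by (intro divide_right_mono tail_antimono) auto
      then show ?case using elim by linarith
    qed
  next
    fix l assume "x powr (- \<alpha>) < l"
    with cont have "\<forall>\<^sub>F y in nhds x. y powr (- \<alpha>) < l" by (rule order_tendstoD)
    then obtain z where z: "0 < z" "z < x" "z powr (- \<alpha>) < l" using near[of "\<lambda>v. v < l"] by blast
    have "((\<lambda>n. tail (a n * z) / tail (a n)) \<longlongrightarrow> z powr (- \<alpha>)) F"
      using z x by (intro filterlim_compose[OF tail_ratio a]) auto
    then have "\<forall>\<^sub>F n in F. tail (a n * z) / tail (a n) < l" using z(3) by (rule order_tendstoD)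
    moreover have "\<forall>\<^sub>F n in F. z < b n / a n" using ba z(2) by (rule order_tendstoD)
    ultimately show "\<forall>\<^sub>F n in F. tail (b n) / tail (a n) < l"
      using apos
    proof eventually_elim
      case (elim n)
      then have "a n * z \<le> b n" by (simp add: field_simps)
      then have "tail (b n) / tail (a n) \<le> tail (a n * z) / tail (a n)"
        using tail_pos[of "a n"] by (intro divide_right_mono tail_antimono) auto
      then show ?case using elim by linarith
    qed
  qed
qed

lemma tail_lam_ratio: "y > 0 \<Longrightarrow> (\<lambda>n. tail (y * lam n) / tail (lam n)) \<longlonglongrightarrow> y powr (- \<alpha>)"
proof (rule tail_ratio_asymp[OF lam_top])
  assume "y > 0"
  have "\<forall>\<^sub>F n in sequentially. y = y * lam n / lam n"
    by (rule eventually_sequentiallyI[of 1]) (use lam_pos in force)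
  then show "(\<lambda>n. y * lam n / lam n) \<longlonglongrightarrow> y"
    by (rule Lim_transform_eventually[OF tendsto_const])
qed

text \<open>
  The tail balance condition is stated along the integers. Every level has integers on both sides
  within distance two, which is negligible against \<open>lam n\<close>, so the limit carries over. The function
  \<open>g\<close> stands for the tail \<open>U\<close> or its variant with the weak inequality.
\<close>
lemma one_sided_tail_limit:
  assumes anti: "\<And>s t. s \<le> t \<Longrightarrow> U t \<le> U s"
    and bal: "(\<lambda>n::nat. U (real n) / tail (real n)) \<longlonglongrightarrow> q" and y: "y > 0"
    and between: "\<And>t. 2 \<le> t \<Longrightarrow> U (t + 1) \<le> g t \<and> g t \<le> U (t - 1 / 2)"
  shows "(\<lambda>n. g (y * lam n) / tail (lam n)) \<longlonglongrightarrow> q * y powr (- \<alpha>)"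
proof -
  define u where "u n = nat \<lfloor>y * lam n\<rfloor> + 2" for n
  define l where "l n = nat \<lfloor>y * lam n\<rfloor> - 1" for n
  have ylam: "filterlim (\<lambda>n. y * lam n) at_top sequentially"
    using filterlim_tendsto_pos_mult_at_top[OF tendsto_const y lam_top] .
  have big: "\<forall>\<^sub>F n in sequentially. 2 \<le> y * lam n" using ylam by (simp add: filterlim_at_top)
  have lamp: "\<forall>\<^sub>F n in sequentially. 0 < lam n" by (rule eventually_sequentiallyI[of 1]) (rule lam_pos)
  have inv0: "(\<lambda>n. 2 / lam n) \<longlonglongrightarrow> 0"
    using tendsto_divide_0[OF tendsto_const filterlim_at_top_imp_at_infinity[OF lam_top]] .
  have near: "(\<lambda>n. real (k n) / lam n) \<longlonglongrightarrow> y" if k: "\<forall>\<^sub>F n in sequentially. \<bar>real (k n) - y * lam n\<bar> \<le> 2" for k :: "nat \<Rightarrow> nat"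
  proof (rule LIM_zero_cancel, rule tendsto_0_le[OF inv0, of _ 1])
    show "\<forall>\<^sub>F n in sequentially. norm (real (k n) / lam n - y) \<le> norm (2 / lam n) * 1"
      using k lamp
    proof eventually_elim
      case (elim n)
      have "real (k n) / lam n - y = (real (k n) - y * lam n) / lam n" using elim by (simp add: field_simps)
      then show ?case using elim by (simp add: divide_right_mono)
    qed
  qed
  have lim: "(\<lambda>n. U (real (k n)) / tail (lam n)) \<longlonglongrightarrow> q * y powr (- \<alpha>)"
    if k: "\<forall>\<^sub>F n in sequentially. \<bar>real (k n) - y * lam n\<bar> \<le> 2" for k :: "nat \<Rightarrow> nat"
  proof -
    have "filterlim (\<lambda>n. y * lam n - 2) at_top sequentially"
      using filterlim_tendsto_add_at_top[OF tendsto_const ylam, of "-2"] by simp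
    then have "filterlim (\<lambda>n. real (k n)) at_top sequentially"
      by (rule filterlim_at_top_mono) (use k in \<open>eventually_elim, simp\<close>)
    then have "filterlim k at_top sequentially" by (simp add: filterlim_sequentially_iff_filterlim_real)
    then have "(\<lambda>n. U (real (k n)) / tail (real (k n))) \<longlonglongrightarrow> q" by (rule filterlim_compose[OF bal])
    from tendsto_mult[OF this tail_ratio_asymp[OF lam_top near[OF k] y]]
    show ?thesis using tail_pos by (simp add: less_imp_neq[symmetric])
  qed
  have "\<forall>\<^sub>F n in sequentially. \<bar>real (u n) - y * lam n\<bar> \<le> 2"
    using big by eventually_elim (simp add: u_def, linarith)
  then have limu: "(\<lambda>n. U (real (u n)) / tail (lam n)) \<longlonglongrightarrow> q * y powr (- \<alpha>)" by (rule lim)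
  have "\<forall>\<^sub>F n in sequentially. \<bar>real (l n) - y * lam n\<bar> \<le> 2"
    using big by eventually_elim (simp add: l_def, linarith)
  then have liml: "(\<lambda>n. U (real (l n)) / tail (lam n)) \<longlonglongrightarrow> q * y powr (- \<alpha>)" by (rule lim)
  show ?thesis
  proof (rule tendsto_sandwich[OF _ _ limu liml])
    show "\<forall>\<^sub>F n in sequentially. U (real (u n)) / tail (lam n) \<le> g (y * lam n) / tail (lam n)"
      using big
    proof eventually_elim
      case (elim n)
      have "U (real (u n)) \<le> U (y * lam n + 1)" by (rule anti) (use elim in \<open>simp add: u_def, linarith\<close>)
      also have "\<dots> \<le> g (y * lam n)" using between[OF elim] by simp
      finally show ?case using tail_pos[of "lam n"] by (simp add: divide_right_mono)
    qed
    show "\<forall>\<^sub>F n in sequentially. g (y * lam n) / tail (lam n) \<le> U (real (l n)) / tail (lam n)"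
      using big
    proof eventually_elim
      case (elim n)
      have "g (y * lam n) \<le> U (y * lam n - 1 / 2)" using between[OF elim] by simp
      also have "\<dots> \<le> U (real (l n))" by (rule anti) (use elim in \<open>simp add: l_def, linarith\<close>)
      finally show ?case using tail_pos[of "lam n"] by (simp add: divide_right_mono)
    qed
  qed
qed

lemma upper_tail_limit:
  assumes "y > 0"
  shows "(\<lambda>n. prob {\<omega>\<in>space M. y * lam n < Z 1 \<omega>} / tail (lam n)) \<longlonglongrightarrow> p * y powr (- \<alpha>)"
proof -
  have anti: "prob {\<omega>\<in>space M. t < Z 1 \<omega>} \<le> prob {\<omega>\<in>space M. s < Z 1 \<omega>}" if "s \<le> t" for s t
    using that by (intro finite_measure_mono) auto
  have bal: "(\<lambda>n. prob {\<omega>\<in>space M. real n < Z 1 \<omega>} / tail (real n)) \<longlonglongrightarrow> p"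
    using tail_rv by (simp add: regularly_varying_rv_def tail_def)
  show ?thesis
    by (rule one_sided_tail_limit[where U = "\<lambda>t. prob {\<omega>\<in>space M. t < Z 1 \<omega>}", OF anti bal assms])
       (auto intro!: finite_measure_mono)
qed

lemma lower_tail_limit:
  assumes "y > 0"
  shows "(\<lambda>n. prob {\<omega>\<in>space M. Z 1 \<omega> < - (y * lam n)} / tail (lam n)) \<longlonglongrightarrow> (1 - p) * y powr (- \<alpha>)"
    and "(\<lambda>n. prob {\<omega>\<in>space M. Z 1 \<omega> \<le> - (y * lam n)} / tail (lam n)) \<longlonglongrightarrow> (1 - p) * y powr (- \<alpha>)"
proof -
  have anti: "prob {\<omega>\<in>space M. Z 1 \<omega> < - t} \<le> prob {\<omega>\<in>space M. Z 1 \<omega> < - s}" if "s \<le> t" for s t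
    using that by (intro finite_measure_mono) auto
  have bal: "(\<lambda>n. prob {\<omega>\<in>space M. Z 1 \<omega> < - real n} / tail (real n)) \<longlonglongrightarrow> 1 - p"
    using tail_rv by (simp add: regularly_varying_rv_def tail_def)
  show "(\<lambda>n. prob {\<omega>\<in>space M. Z 1 \<omega> < - (y * lam n)} / tail (lam n)) \<longlonglongrightarrow> (1 - p) * y powr (- \<alpha>)"
    by (rule one_sided_tail_limit[where U = "\<lambda>t. prob {\<omega>\<in>space M. Z 1 \<omega> < - t}", OF anti bal assms])
       (auto intro: finite_measure_mono)
  show "(\<lambda>n. prob {\<omega>\<in>space M. Z 1 \<omega> \<le> - (y * lam n)} / tail (lam n)) \<longlonglongrightarrow> (1 - p) * y powr (- \<alpha>)"
    by (rule one_sided_tail_limit[where U = "\<lambda>t. prob {\<omega>\<in>space M. Z 1 \<omega> < - t}"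
        and g = "\<lambda>t. prob {\<omega>\<in>space M. Z 1 \<omega> \<le> - t}", OF anti bal assms])
       (auto intro!: finite_measure_mono)
qed

definition jump_law :: "real \<Rightarrow> nat \<Rightarrow> real measure" where
  "jump_law \<delta> n = distr (uniform_measure M {\<omega>\<in>space M. \<delta> * lam n < \<bar>Z 1 \<omega>\<bar>}) borel (\<lambda>\<omega>. Z 1 \<omega> / lam n)"

lemma emeasure_big: "emeasure M {\<omega>\<in>space M. t < \<bar>Z 1 \<omega>\<bar>} = ennreal (tail t)"
  by (simp add: tail_def emeasure_eq_measure)

lemma real_distribution_jump_law: "real_distribution (jump_law \<delta> n)"
proof -
  have "prob_space (uniform_measure M {\<omega>\<in>space M. \<delta> * lam n < \<bar>Z 1 \<omega>\<bar>})"
    using tail_pos[of "\<delta> * lam n"] by (intro prob_space_uniform_measure) (auto simp: emeasure_big)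
  moreover have "(\<lambda>\<omega>. Z 1 \<omega> / lam n) \<in> borel_measurable (uniform_measure M {\<omega>\<in>space M. \<delta> * lam n < \<bar>Z 1 \<omega>\<bar>})"
    by measurable
  ultimately show ?thesis unfolding jump_law_def by (rule prob_space.real_distribution_distr)
qed

lemma measure_jump_law:
  assumes B: "B \<in> sets borel"
  shows "measure (jump_law \<delta> n) B
    = prob {\<omega>\<in>space M. \<delta> * lam n < \<bar>Z 1 \<omega>\<bar> \<and> Z 1 \<omega> / lam n \<in> B} / tail (\<delta> * lam n)"
proof -
  have [measurable]: "(\<lambda>\<omega>. Z 1 \<omega> / lam n) \<in> borel_measurable M" by measurable
  have S: "{\<omega>\<in>space M. Z 1 \<omega> / lam n \<in> B} \<in> sets M" using B by measurable
  have "measure (jump_law \<delta> n) B = measure (uniform_measure M {\<omega>\<in>space M. \<delta> * lam n < \<bar>Z 1 \<omega>\<bar>}) {\<omega>\<in>space M. Z 1 \<omega> / lam n \<in> B}"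
    unfolding jump_law_def using B
    by (subst measure_distr) (auto simp: vimage_def Int_def conj_commute)
  also have "\<dots> = prob ({\<omega>\<in>space M. \<delta> * lam n < \<bar>Z 1 \<omega>\<bar>} \<inter> {\<omega>\<in>space M. Z 1 \<omega> / lam n \<in> B}) / tail (\<delta> * lam n)"
    using tail_pos[of "\<delta> * lam n"] S
    by (subst measure_uniform_measure) (auto simp: emeasure_big, simp add: tail_def)
  also have "{\<omega>\<in>space M. \<delta> * lam n < \<bar>Z 1 \<omega>\<bar>} \<inter> {\<omega>\<in>space M. Z 1 \<omega> / lam n \<in> B}
      = {\<omega>\<in>space M. \<delta> * lam n < \<bar>Z 1 \<omega>\<bar> \<and> Z 1 \<omega> / lam n \<in> B}" by blast
  finally show ?thesis .
qed

end

section \<open>The limiting jump law\<close>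

lemma sets_nu: "is_nu \<alpha> p \<nu> \<Longrightarrow> B \<in> sets \<nu> \<longleftrightarrow> B \<in> sets borel \<and> 0 \<notin> B"
  unfolding is_nu_def by (auto simp: sets_restrict_space image_iff intro!: bexI[of _ B])

lemma space_nu: "is_nu \<alpha> p \<nu> \<Longrightarrow> space \<nu> = - {0}"
  unfolding is_nu_def by (metis sets_eq_imp_space_eq space_restrict_space space_borel Int_UNIV_right)

text \<open>
  The mass of a union of two opposite rays is given; letting the end point of one of them tend to
  infinity leaves the mass of the other.
\<close>
lemma nu_rays:
  assumes nu: "is_nu \<alpha> p \<nu>" and "\<alpha> > 0" "0 \<le> p" "p \<le> 1" and x: "x > 0"
  shows "emeasure \<nu> {x<..} = ennreal (p * x powr (- \<alpha>))"
    and "emeasure \<nu> {..<-x} = ennreal ((1 - p) * x powr (- \<alpha>))"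
proof -
  have val: "emeasure \<nu> ({..< - s} \<union> {t <..}) = ennreal ((1 - p) * s powr (- \<alpha>) + p * t powr (- \<alpha>))"
    if "s > 0" "t > 0" for s t using nu that by (simp add: is_nu_def)
  have sets: "{..<-t} \<in> sets \<nu>" "{t<..} \<in> sets \<nu>" if "t > 0" for t
    using that by (auto simp: sets_nu[OF nu])
  have add: "emeasure \<nu> {..< - s} + emeasure \<nu> {t <..} = ennreal ((1 - p) * s powr (- \<alpha>) + p * t powr (- \<alpha>))"
    if "s > 0" "t > 0" for s t
  proof -
    have "emeasure \<nu> {..< - s} + emeasure \<nu> {t <..} = emeasure \<nu> ({..< - s} \<union> {t <..})"
      using that sets by (intro plus_emeasure) auto
    then show ?thesis using val that by simp
  qed
  have fin: "emeasure \<nu> {..< - t} \<noteq> \<infinity>" "emeasure \<nu> {t <..} \<noteq> \<infinity>" if "t > 0" for t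
  proof -
    have "emeasure \<nu> {..< - t} + emeasure \<nu> {t <..} \<noteq> \<infinity>" unfolding add[OF that that] by simp
    then show "emeasure \<nu> {..< - t} \<noteq> \<infinity>" "emeasure \<nu> {t <..} \<noteq> \<infinity>" by (auto simp: ennreal_add_eq_top)
  qed
  have pw: "(\<lambda>k. c * real (Suc k) powr (- \<alpha>)) \<longlonglongrightarrow> 0" for c
  proof -
    have "(\<lambda>k. real (Suc k) powr (- \<alpha>)) \<longlonglongrightarrow> 0"
      using \<open>\<alpha> > 0\<close> by (intro tendsto_neg_powr filterlim_compose[OF filterlim_real_sequentially filterlim_Suc]) auto
    from tendsto_mult[OF tendsto_const this, of c] show ?thesis by simp
  qed
  have s1: "range (\<lambda>k. {..< - real (Suc k)}) \<subseteq> sets \<nu>" "range (\<lambda>k. {real (Suc k)<..}) \<subseteq> sets \<nu>"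
    "emeasure \<nu> {..< - real (Suc k)} \<noteq> \<infinity>" "emeasure \<nu> {real (Suc k)<..} \<noteq> \<infinity>" for k
    by (intro image_subsetI sets fin, simp)+
  have "(\<lambda>k. emeasure \<nu> {..< - real (Suc k)}) \<longlonglongrightarrow> emeasure \<nu> (\<Inter>k. {..< - real (Suc k)})"
    by (rule Lim_emeasure_decseq) (use s1 in \<open>auto simp: decseq_def\<close>)
  also have "(\<Inter>k. {..< - real (Suc k)}) = {}"
  proof -
    have "\<exists>k. z \<notin> {..< - real (Suc k)}" for z :: real 
    proof -
      obtain k where "- z < real k" using reals_Archimedean2 by blast
      then show ?thesis by (intro exI[of _ k]) simp
    qed
    then show ?thesis by blast
  qed
  finally have l1: "(\<lambda>k. emeasure \<nu> {..< - real (Suc k)} + emeasure \<nu> {x<..}) \<longlonglongrightarrow> 0 + emeasure \<nu> {x<..}"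
    by (intro tendsto_add) auto
  have "(\<lambda>k. ennreal ((1 - p) * real (Suc k) powr (- \<alpha>) + p * x powr (- \<alpha>))) \<longlonglongrightarrow> ennreal (0 + p * x powr (- \<alpha>))"
    by (intro tendsto_ennrealI tendsto_add pw tendsto_const)
  moreover have "(\<lambda>k. emeasure \<nu> {..< - real (Suc k)} + emeasure \<nu> {x<..})
      = (\<lambda>k. ennreal ((1 - p) * real (Suc k) powr (- \<alpha>) + p * x powr (- \<alpha>)))"
    by (intro ext add) (use x in simp_all)
  ultimately show "emeasure \<nu> {x<..} = ennreal (p * x powr (- \<alpha>))"
    using l1 LIMSEQ_unique by fastforce
  have "(\<lambda>k. emeasure \<nu> {real (Suc k)<..}) \<longlonglongrightarrow> emeasure \<nu> (\<Inter>k. {real (Suc k)<..})"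
    by (rule Lim_emeasure_decseq) (use s1 in \<open>auto simp: decseq_def\<close>)
  also have "(\<Inter>k. {real (Suc k)<..}) = {}"
  proof -
    have "\<exists>k. z \<notin> {real (Suc k)<..}" for z :: real 
    proof -
      obtain k where "z < real k" using reals_Archimedean2 by blast
      then show ?thesis by (intro exI[of _ k]) simp
    qed
    then show ?thesis by blast
  qed
  finally have l2: "(\<lambda>k. emeasure \<nu> {..< - x} + emeasure \<nu> {real (Suc k)<..}) \<longlonglongrightarrow> emeasure \<nu> {..< - x} + 0"
    by (intro tendsto_add) auto
  have "(\<lambda>k. ennreal ((1 - p) * x powr (- \<alpha>) + p * real (Suc k) powr (- \<alpha>))) \<longlonglongrightarrow> ennreal ((1 - p) * x powr (- \<alpha>) + 0)"
    by (intro tendsto_ennrealI tendsto_add pw tendsto_const)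
  moreover have "(\<lambda>k. emeasure \<nu> {..< - x} + emeasure \<nu> {real (Suc k)<..})
      = (\<lambda>k. ennreal ((1 - p) * x powr (- \<alpha>) + p * real (Suc k) powr (- \<alpha>)))"
    by (intro ext add) (use x in simp_all)
  ultimately show "emeasure \<nu> {..<-x} = ennreal ((1 - p) * x powr (- \<alpha>))"
    using l2 LIMSEQ_unique by fastforce
qed

lemma nu_outside:
  assumes nu: "is_nu \<alpha> p \<nu>" and "\<delta> > 0"
  shows "emeasure \<nu> {x. \<delta> < \<bar>x\<bar>} = ennreal (\<delta> powr (- \<alpha>))"
proof -
  have "{x. \<delta> < \<bar>x\<bar>} = {..<-\<delta>} \<union> {\<delta><..}" by auto
  moreover have "(1 - p) * \<delta> powr (- \<alpha>) + p * \<delta> powr (- \<alpha>) = \<delta> powr (- \<alpha>)" by (simp add: algebra_simps)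
  ultimately show ?thesis using assms by (simp add: is_nu_def)
qed

text \<open>The mass of an open ray depends continuously on its end point, so there is no atom at \<open>- x\<close>.\<close>
lemma nu_closed_ray:
  assumes nu: "is_nu \<alpha> p \<nu>" and "\<alpha> > 0" "0 \<le> p" "p \<le> 1" and x: "x > 0"
  shows "emeasure \<nu> {..-x} = ennreal ((1 - p) * x powr (- \<alpha>))"
proof (rule antisym)
  have "(\<lambda>k. ennreal ((1 - p) * (x - x / 2 / real (Suc k)) powr (- \<alpha>))) \<longlonglongrightarrow> ennreal ((1 - p) * (x - 0) powr (- \<alpha>))"
    using x by (intro tendsto_ennrealI tendsto_intros LIMSEQ_Suc lim_const_over_n) auto
  moreover have "emeasure \<nu> {..-x} \<le> ennreal ((1 - p) * (x - x / 2 / real (Suc k)) powr (- \<alpha>))" for k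
  proof -
    define s where "s = x / 2 / real (Suc k)"
    have "0 < s" using x by (simp add: s_def)
    have "s \<le> x / 2" unfolding s_def using x by (simp add: field_simps)
    then have s: "0 < s" "s < x" using \<open>0 < s\<close> x by auto
    have "emeasure \<nu> {..-x} \<le> emeasure \<nu> {..<-(x - s)}"
      using s by (intro emeasure_mono) (auto simp: sets_nu[OF nu])
    also have "\<dots> = ennreal ((1 - p) * (x - s) powr (- \<alpha>))"
      using s by (intro nu_rays assms) auto
    finally show ?thesis by (simp add: s_def)
  qed
  ultimately show "emeasure \<nu> {..-x} \<le> ennreal ((1 - p) * x powr (- \<alpha>))"
    using LIMSEQ_le_const by fastforce
  have "emeasure \<nu> {..<-x} \<le> emeasure \<nu> {..-x}"
    using x by (intro emeasure_mono) (auto simp: sets_nu[OF nu])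
  then show "ennreal ((1 - p) * x powr (- \<alpha>)) \<le> emeasure \<nu> {..-x}"
    using nu_rays(2)[OF assms] by simp
qed

definition limit_jump_law :: "real measure \<Rightarrow> real \<Rightarrow> real measure" where
  "limit_jump_law \<nu> \<delta> = distr (uniform_measure \<nu> {x. \<delta> < \<bar>x\<bar>}) borel (\<lambda>x. x)"

lemma ident_nu_measurable: "is_nu \<alpha> p \<nu> \<Longrightarrow> (\<lambda>x. x) \<in> borel_measurable \<nu>"
  using measurable_ident_sets[of \<nu> "restrict_space borel (- {0})"]
  by (auto simp: is_nu_def intro: measurable_restrict_space1 simp: measurable_cong_sets[of \<nu> "restrict_space borel (- {0})"])

lemma prob_space_uniform_nu:
  assumes nu: "is_nu \<alpha> p \<nu>" and "\<delta> > 0"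
  shows "prob_space (uniform_measure \<nu> {x. \<delta> < \<bar>x\<bar>})"
  using assms by (intro prob_space_uniform_measure) (auto simp: nu_outside[OF nu])

lemma real_distribution_limit_jump_law:
  assumes nu: "is_nu \<alpha> p \<nu>" and "\<delta> > 0"
  shows "real_distribution (limit_jump_law \<nu> \<delta>)"
  unfolding limit_jump_law_def using ident_nu_measurable[OF nu]
  by (intro prob_space.real_distribution_distr[OF prob_space_uniform_nu[OF assms]]) simp

lemma measure_limit_jump_law:
  assumes nu: "is_nu \<alpha> p \<nu>" and "\<delta> > 0" and B: "B \<in> sets borel"
  shows "measure (limit_jump_law \<nu> \<delta>) B = measure \<nu> (B \<inter> {x. \<delta> < \<bar>x\<bar>}) / \<delta> powr (- \<alpha>)"
proof -
  have A: "{x. \<delta> < \<bar>x\<bar>} \<in> sets \<nu>" using \<open>\<delta> > 0\<close> by (simp add: sets_nu[OF nu])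
  have BS: "B \<inter> space \<nu> \<in> sets \<nu>" using B by (auto simp: sets_nu[OF nu] space_nu[OF nu] Int_def)
  have "measure (limit_jump_law \<nu> \<delta>) B = measure (uniform_measure \<nu> {x. \<delta> < \<bar>x\<bar>}) (B \<inter> space \<nu>)"
    unfolding limit_jump_law_def using B ident_nu_measurable[OF nu] by (subst measure_distr) (auto simp: vimage_def)
  also have "\<dots> = measure \<nu> ({x. \<delta> < \<bar>x\<bar>} \<inter> (B \<inter> space \<nu>)) / measure \<nu> {x. \<delta> < \<bar>x\<bar>}"
    using BS \<open>\<delta> > 0\<close> by (subst measure_uniform_measure) (auto simp: nu_outside[OF nu])
  also have "{x. \<delta> < \<bar>x\<bar>} \<inter> (B \<inter> space \<nu>) = B \<inter> {x. \<delta> < \<bar>x\<bar>}"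
    using \<open>\<delta> > 0\<close> by (auto simp: space_nu[OF nu])
  also have "measure \<nu> {x. \<delta> < \<bar>x\<bar>} = \<delta> powr (- \<alpha>)"
    by (simp add: measure_def nu_outside[OF nu \<open>\<delta> > 0\<close>])
  finally show ?thesis .
qed

text \<open>
  The distribution functions converge at every point. They are determined by one-sided tails beyond
  \<open>\<delta>\<close>, and they are constant on the interval from \<open>- \<delta>\<close> to \<open>\<delta>\<close>, which carries no mass.
\<close>
lemma (in heavy_tailed_walk) jump_law_weak_conv:
  assumes nu: "is_nu \<alpha> p \<nu>" and d: "\<delta> > 0"
  shows "weak_conv_m (jump_law \<delta>) (limit_jump_law \<nu> \<delta>)"
proof -
  have lim: "(\<lambda>n. cdf (jump_law \<delta> n) x) \<longlonglongrightarrow> cdf (limit_jump_law \<nu> \<delta>) x" for x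
  proof -
    have lamp: "\<forall>\<^sub>F n in sequentially. 0 < lam n" by (rule eventually_sequentiallyI[of 1]) (rule lam_pos)
    have ne: "tail t \<noteq> 0" for t using tail_pos[of t] by simp
    have norm: "(\<lambda>n. f n / tail (\<delta> * lam n)) \<longlonglongrightarrow> c / \<delta> powr (- \<alpha>)"
      if "(\<lambda>n. f n / tail (lam n)) \<longlonglongrightarrow> c" for f c
    proof -
      have "(\<lambda>n. (f n / tail (lam n)) / (tail (\<delta> * lam n) / tail (lam n))) \<longlonglongrightarrow> c / \<delta> powr (- \<alpha>)"
        using d by (intro tendsto_divide that tail_lam_ratio) auto
      moreover have "(f n / tail (lam n)) / (tail (\<delta> * lam n) / tail (lam n)) = f n / tail (\<delta> * lam n)" for n
        using ne[of "lam n"] by simp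
      ultimately show ?thesis by (simp only:)
    qed
    consider "x < - \<delta>" | "- \<delta> \<le> x" "x < \<delta>" | "\<delta> \<le> x" by linarith
    then show ?thesis
    proof cases
      case 1
      define y where "y = - x"
      have y: "y > \<delta>" "x = - y" using 1 by (auto simp: y_def)
      have eq: "\<forall>\<^sub>F n in sequentially. prob {\<omega>\<in>space M. Z 1 \<omega> \<le> - (y * lam n)} / tail (\<delta> * lam n) = cdf (jump_law \<delta> n) x"
        using lamp
      proof eventually_elim
        case (elim n)
        have "\<delta> * lam n < y * lam n" using y elim by simp
        then have "\<delta> * lam n < \<bar>Z 1 \<omega>\<bar>" if "Z 1 \<omega> \<le> - (y * lam n)" for \<omega> using that by linarith
        moreover have "Z 1 \<omega> / lam n \<le> x \<longleftrightarrow> Z 1 \<omega> \<le> - (y * lam n)" for \<omega>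
          using elim y(2) by (simp add: pos_divide_le_eq)
        ultimately have "{\<omega>\<in>space M. \<delta> * lam n < \<bar>Z 1 \<omega>\<bar> \<and> Z 1 \<omega> / lam n \<in> {..x}} = {\<omega>\<in>space M. Z 1 \<omega> \<le> - (y * lam n)}"
          by auto
        then show ?case by (simp add: cdf_def measure_jump_law)
      qed
      have "{..x} \<inter> {x. \<delta> < \<bar>x\<bar>} = {..-y}" using y d by auto
      moreover have "measure \<nu> {..-y} = (1 - p) * y powr (- \<alpha>)"
        using nu_closed_ray[OF nu alpha_pos p_bounds, of y] y d p_bounds by (simp add: measure_def)
      ultimately have "cdf (limit_jump_law \<nu> \<delta>) x = (1 - p) * y powr (- \<alpha>) / \<delta> powr (- \<alpha>)"
        by (simp only: cdf_def measure_limit_jump_law[OF nu d atMost_borel])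
      moreover have "(\<lambda>n. prob {\<omega>\<in>space M. Z 1 \<omega> \<le> - (y * lam n)} / tail (\<delta> * lam n)) \<longlonglongrightarrow> (1 - p) * y powr (- \<alpha>) / \<delta> powr (- \<alpha>)"
        using y d by (intro norm lower_tail_limit) auto
      ultimately show ?thesis using Lim_transform_eventually[OF _ eq] by simp
    next
      case 2
      have eq: "\<forall>\<^sub>F n in sequentially. prob {\<omega>\<in>space M. Z 1 \<omega> < - (\<delta> * lam n)} / tail (\<delta> * lam n) = cdf (jump_law \<delta> n) x"
        using lamp
      proof eventually_elim
        case (elim n)
        have b: "- (\<delta> * lam n) \<le> x * lam n" "x * lam n < \<delta> * lam n"
          using mult_right_mono[OF 2(1), of "lam n"] 2(2) elim by auto
        have "\<delta> * lam n < \<bar>Z 1 \<omega>\<bar> \<and> Z 1 \<omega> / lam n \<le> x \<longleftrightarrow> Z 1 \<omega> < - (\<delta> * lam n)" for \<omega>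
          unfolding pos_divide_le_eq[OF elim] using b by linarith
        then have "{\<omega>\<in>space M. \<delta> * lam n < \<bar>Z 1 \<omega>\<bar> \<and> Z 1 \<omega> / lam n \<in> {..x}} = {\<omega>\<in>space M. Z 1 \<omega> < - (\<delta> * lam n)}"
          by (simp only: atMost_iff)
        then show ?case by (simp add: cdf_def measure_jump_law)
      qed
      have "{..x} \<inter> {x. \<delta> < \<bar>x\<bar>} = {..<-\<delta>}" using 2 d by auto
      moreover have "measure \<nu> {..<-\<delta>} = (1 - p) * \<delta> powr (- \<alpha>)"
        using nu_rays(2)[OF nu alpha_pos p_bounds d] p_bounds by (simp add: measure_def)
      ultimately have "cdf (limit_jump_law \<nu> \<delta>) x = (1 - p) * \<delta> powr (- \<alpha>) / \<delta> powr (- \<alpha>)"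
        by (simp only: cdf_def measure_limit_jump_law[OF nu d atMost_borel])
      moreover have "(\<lambda>n. prob {\<omega>\<in>space M. Z 1 \<omega> < - (\<delta> * lam n)} / tail (\<delta> * lam n)) \<longlonglongrightarrow> (1 - p) * \<delta> powr (- \<alpha>) / \<delta> powr (- \<alpha>)"
        using d by (intro norm lower_tail_limit) auto
      ultimately show ?thesis using Lim_transform_eventually[OF _ eq] by simp
    next
      case 3
      have eq: "\<forall>\<^sub>F n in sequentially. 1 - prob {\<omega>\<in>space M. x * lam n < Z 1 \<omega>} / tail (\<delta> * lam n) = cdf (jump_law \<delta> n) x"
        using lamp
      proof eventually_elim
        case (elim n)
        interpret J: real_distribution "jump_law \<delta> n" by (rule real_distribution_jump_law)
        have b: "\<delta> * lam n \<le> x * lam n" "0 < \<delta> * lam n" using 3 elim d by auto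
        have "\<delta> * lam n < \<bar>Z 1 \<omega>\<bar> \<and> x < Z 1 \<omega> / lam n \<longleftrightarrow> x * lam n < Z 1 \<omega>" for \<omega>
          unfolding pos_less_divide_eq[OF elim] using b by linarith
        then have "{\<omega>\<in>space M. \<delta> * lam n < \<bar>Z 1 \<omega>\<bar> \<and> Z 1 \<omega> / lam n \<in> {x<..}} = {\<omega>\<in>space M. x * lam n < Z 1 \<omega>}"
          by (simp only: greaterThan_iff)
        then have "measure (jump_law \<delta> n) {x<..} = prob {\<omega>\<in>space M. x * lam n < Z 1 \<omega>} / tail (\<delta> * lam n)"
          by (simp add: measure_jump_law)
        moreover have "cdf (jump_law \<delta> n) x = 1 - measure (jump_law \<delta> n) {x<..}"
        proof -
          have "measure (jump_law \<delta> n) (UNIV - {x<..}) = 1 - measure (jump_law \<delta> n) {x<..}"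
            using J.prob_compl[of "{x<..}"] by simp
          also have "UNIV - {x<..} = {..x}" by auto
          finally show ?thesis by (simp add: cdf_def)
        qed
        ultimately show ?case by simp
      qed
      interpret L: real_distribution "limit_jump_law \<nu> \<delta>" by (rule real_distribution_limit_jump_law[OF nu d])
      have "cdf (limit_jump_law \<nu> \<delta>) x = 1 - measure (limit_jump_law \<nu> \<delta>) {x<..}"
      proof -
        have "measure (limit_jump_law \<nu> \<delta>) (UNIV - {x<..}) = 1 - measure (limit_jump_law \<nu> \<delta>) {x<..}"
          using L.prob_compl[of "{x<..}"] by simp
        also have "UNIV - {x<..} = {..x}" by auto
        finally show ?thesis by (simp add: cdf_def)
      qed
      also have "measure (limit_jump_law \<nu> \<delta>) {x<..} = p * x powr (- \<alpha>) / \<delta> powr (- \<alpha>)"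
      proof -
        have "{x<..} \<inter> {x. \<delta> < \<bar>x\<bar>} = {x<..}" using 3 d by auto
        moreover have "measure \<nu> {x<..} = p * x powr (- \<alpha>)"
          using nu_rays(1)[OF nu alpha_pos p_bounds, of x] 3 d p_bounds by (simp add: measure_def)
        ultimately show ?thesis by (simp only: measure_limit_jump_law[OF nu d greaterThan_borel])
      qed
      finally have "cdf (limit_jump_law \<nu> \<delta>) x = 1 - p * x powr (- \<alpha>) / \<delta> powr (- \<alpha>)" .
      moreover have "(\<lambda>n. 1 - prob {\<omega>\<in>space M. x * lam n < Z 1 \<omega>} / tail (\<delta> * lam n)) \<longlonglongrightarrow> 1 - p * x powr (- \<alpha>) / \<delta> powr (- \<alpha>)"
        using 3 d by (intro tendsto_diff tendsto_const norm upper_tail_limit) auto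
      ultimately show ?thesis using Lim_transform_eventually[OF _ eq] by simp
    qed
  qed
  then show ?thesis by (simp add: weak_conv_m_def weak_conv_def)
qed

text \<open>
  Skorohod's representation turns weak convergence into pointwise convergence, to which the
  continuity of \<open>h_map\<close> applies outcome by outcome.
\<close>
lemma (in heavy_tailed_walk) jump_coupling:
  assumes nu: "is_nu \<alpha> p \<nu>" and d: "\<delta> > 0"
  obtains \<Omega> :: "real measure" and \<xi> :: "nat \<Rightarrow> real \<Rightarrow> real" and \<xi>' :: "real \<Rightarrow> real"
  where "prob_space \<Omega>" "\<And>n. \<xi> n \<in> borel_measurable \<Omega>" "\<And>n. distr \<Omega> borel (\<xi> n) = jump_law \<delta> n"
    "\<xi>' \<in> borel_measurable \<Omega>" "distr \<Omega> borel \<xi>' = limit_jump_law \<nu> \<delta>"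
    "\<And>w. w \<in> space \<Omega> \<Longrightarrow> (\<lambda>n. \<xi> n w) \<longlonglongrightarrow> \<xi>' w"
proof -
  have ex: "\<exists>(\<Omega> :: real measure) (Y_seq :: nat \<Rightarrow> real \<Rightarrow> real) (Y :: real \<Rightarrow> real).
    prob_space \<Omega> \<and> (\<forall>n. Y_seq n \<in> measurable \<Omega> borel) \<and> (\<forall>n. distr \<Omega> borel (Y_seq n) = jump_law \<delta> n) \<and>
    Y \<in> measurable \<Omega> lborel \<and> distr \<Omega> borel Y = limit_jump_law \<nu> \<delta> \<and>
    (\<forall>x \<in> space \<Omega>. (\<lambda>n. Y_seq n x) \<longlonglongrightarrow> Y x)"
    by (rule Skorohod[OF real_distribution_jump_law real_distribution_limit_jump_law[OF nu d] jump_law_weak_conv[OF nu d]])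
  then obtain \<Omega> \<xi> \<xi>' where o: "prob_space (\<Omega> :: real measure)" "\<forall>n. \<xi> n \<in> borel_measurable \<Omega>"
    "\<forall>n. distr \<Omega> borel (\<xi> n) = jump_law \<delta> n" "\<xi>' \<in> measurable \<Omega> lborel" "distr \<Omega> borel \<xi>' = limit_jump_law \<nu> \<delta>"
    "\<forall>x \<in> space \<Omega>. (\<lambda>n. \<xi> n x) \<longlonglongrightarrow> \<xi>' x" by auto
  show ?thesis using o by (intro that[of \<Omega> \<xi> \<xi>']) auto
qed

section \<open>Coupling the positions and sizes of the big jumps\<close>

text \<open>
  Conditioning independent coordinates to lie in \<open>A\<close> keeps them independent. It is used for the
  uniform times in the unit cube and for the limiting jumps larger than \<open>\<delta>\<close>.
\<close>
lemma PiM_uniform_measure: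
  assumes N: "sigma_finite_measure N" and A: "A \<in> sets N" "emeasure N A \<noteq> 0" "emeasure N A \<noteq> \<infinity>"
    and I: "finite I"
  shows "PiM I (\<lambda>_. uniform_measure N A) = uniform_measure (PiM I (\<lambda>_. N)) (PiE I (\<lambda>_. A))"
proof (rule sym)
  interpret N: product_sigma_finite "\<lambda>_. N" using N by (simp add: product_sigma_finite_def)
  interpret U: prob_space "uniform_measure N A" using A by (intro prob_space_uniform_measure) auto
  interpret U: product_sigma_finite "\<lambda>_. uniform_measure N A"
    by (simp add: product_sigma_finite_def U.sigma_finite_measure_axioms)
  show "uniform_measure (PiM I (\<lambda>_. N)) (PiE I (\<lambda>_. A)) = PiM I (\<lambda>_. uniform_measure N A)"
  proof (rule U.PiM_eqI[OF I])
    have "sets (PiM I (\<lambda>_. uniform_measure N A)) = sets (PiM I (\<lambda>_. N))"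
      by (intro sets_PiM_cong) auto
    then show "sets (uniform_measure (PiM I (\<lambda>_. N)) (PiE I (\<lambda>_. A))) = sets (PiM I (\<lambda>_. uniform_measure N A))"
      by simp
    fix B assume "\<And>i. i \<in> I \<Longrightarrow> B i \<in> sets (uniform_measure N A)"
    then have B: "B i \<in> sets N" if "i \<in> I" for i using that by simp
    obtain a where a: "emeasure N A = ennreal a" "0 < a"
      using A(2,3) by (cases "emeasure N A") (auto simp: less_le)
    have fin: "emeasure N (A \<inter> B i) \<noteq> \<infinity>" if "i \<in> I" for i
    proof -
      have "emeasure N (A \<inter> B i) \<le> emeasure N A" using A(1) by (intro emeasure_mono) auto
      then show ?thesis using A(3) by (simp add: neq_top_trans)
    qed
    define b where "b i = measure N (A \<inter> B i)" for i
    have b: "emeasure N (A \<inter> B i) = ennreal (b i)" if "i \<in> I" for i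
      using fin[OF that] by (simp add: b_def emeasure_eq_ennreal_measure)
    have "emeasure (uniform_measure (PiM I (\<lambda>_. N)) (PiE I (\<lambda>_. A))) (PiE I B)
        = emeasure (PiM I (\<lambda>_. N)) (PiE I (\<lambda>_. A) \<inter> PiE I B) / emeasure (PiM I (\<lambda>_. N)) (PiE I (\<lambda>_. A))"
      using A(1) B I by (intro emeasure_uniform_measure sets_PiM_I_finite) auto
    also have "PiE I (\<lambda>_. A) \<inter> PiE I B = PiE I (\<lambda>i. A \<inter> B i)" by (simp add: PiE_Int)
    also have "emeasure (PiM I (\<lambda>_. N)) (PiE I (\<lambda>i. A \<inter> B i)) = (\<Prod>i\<in>I. ennreal (b i))"
      using A(1) B I by (subst N.emeasure_PiM) (auto simp: b intro!: prod.cong)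
    also have "emeasure (PiM I (\<lambda>_. N)) (PiE I (\<lambda>_. A)) = (\<Prod>i\<in>I. ennreal a)"
      using A(1) I by (subst N.emeasure_PiM) (auto simp: a)
    also have "(\<Prod>i\<in>I. ennreal (b i)) / (\<Prod>i\<in>I. ennreal a) = ennreal ((\<Prod>i\<in>I. b i) / (\<Prod>i\<in>I. a))"
      using a by (subst (1 2) prod_ennreal) (auto simp: b_def intro!: divide_ennreal prod_nonneg prod_pos)
    also have "(\<Prod>i\<in>I. b i) / (\<Prod>i\<in>I. a) = (\<Prod>i\<in>I. b i / a)" by (simp add: prod_dividef)
    also have "ennreal \<dots> = (\<Prod>i\<in>I. ennreal (b i / a))"
      using a by (intro prod_ennreal[symmetric]) (auto simp: b_def)
    also have "\<dots> = (\<Prod>i\<in>I. emeasure (uniform_measure N A) (B i))"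
      using A(1) B a by (intro prod.cong refl) (simp add: b divide_ennreal b_def)
    finally show "emeasure (uniform_measure (PiM I (\<lambda>_. N)) (PiE I (\<lambda>_. A))) (PiE I B)
        = (\<Prod>i\<in>I. emeasure (uniform_measure N A) (B i))" .
  qed
qed

lemma PiM_distr_borel:
  fixes f :: "'b \<Rightarrow> real"
  assumes N: "prob_space N" and f: "f \<in> borel_measurable N" and I: "finite I"
  shows "PiM I (\<lambda>_. distr N borel f) = distr (PiM I (\<lambda>_. N)) (PiM I (\<lambda>_. borel)) (\<lambda>w. \<lambda>i\<in>I. f (w i))"
proof -
  \<comment> \<open>Some probability measure on the Borel sets, to serve as a target of the product map.\<close>
  let ?R = "return borel (0 :: real)"
  have "distr (PiM I (\<lambda>_. N)) (PiM I (\<lambda>_. ?R)) (compose I f) = PiM I (\<lambda>_. distr N ?R f)"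
    using N f I by (intro distr_PiM_finite_prob_space') (auto intro: prob_space_return simp: measurable_cong_sets[OF refl sets_return])
  moreover have "distr N ?R f = distr N borel f" by (intro distr_cong) auto
  moreover have "distr (PiM I (\<lambda>_. N)) (PiM I (\<lambda>_. ?R)) (compose I f) = distr (PiM I (\<lambda>_. N)) (PiM I (\<lambda>_. borel)) (\<lambda>w. \<lambda>i\<in>I. f (w i))"
    by (intro distr_cong sets_PiM_cong) (auto simp: compose_def)
  ultimately show ?thesis by simp
qed

lemma h_map_measurable_PiM:
  assumes N: "\<And>i. i \<in> {1..j} \<Longrightarrow> f \<in> borel_measurable N" and u: "u \<in> jump_times j"
  shows "(\<lambda>w. h_map j (\<lambda>i. f (w i), u)) \<in> measurable (PiM {1..j} (\<lambda>_. N)) skorohod_borel"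
proof (rule h_map_measurable_compose)
  fix i assume i: "i \<in> {1..j}"
  show "(\<lambda>w. f (w i)) \<in> borel_measurable (PiM {1..j} (\<lambda>_. N))"
    using measurable_compose[OF measurable_component_singleton[OF i] N[OF i]] .
qed (use u in auto)

text \<open>The choices of \<open>j\<close> among \<open>n\<close> steps. Increasing extensional maps represent each choice exactly once.\<close>
definition inc :: "nat \<Rightarrow> nat \<Rightarrow> (nat \<Rightarrow> nat) set" where
  "inc j n = {k \<in> {1..j} \<rightarrow>\<^sub>E {1..n}. strict_mono_on {1..j} k}"

lemma finite_inc: "finite (inc j n)"
  unfolding inc_def by (rule finite_subset[of _ "{1..j} \<rightarrow>\<^sub>E {1..n}"]) (auto intro: finite_PiE)

lemma card_inc: "card (inc j n) \<le> n ^ j"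
proof -
  have "card (inc j n) \<le> card ({1..j} \<rightarrow>\<^sub>E {1..n})"
    unfolding inc_def by (intro card_mono finite_PiE) auto
  then show ?thesis by (simp add: card_PiE)
qed

lemma inc_range: "k \<in> inc j n \<Longrightarrow> i \<in> {1..j} \<Longrightarrow> 1 \<le> k i \<and> k i \<le> n"
  by (auto simp: inc_def PiE_iff)

lemma inc_inj: "k \<in> inc j n \<Longrightarrow> inj_on k {1..j}"
  by (auto simp: inc_def intro: strict_mono_on_imp_inj_on)

lemma inc_jump_times: "k \<in> inc j n \<Longrightarrow> 1 \<le> n \<Longrightarrow> (\<lambda>i. grid n (k i)) \<in> jump_times j"
  using inc_range[of k j n]
  by (auto simp: jump_times_def grid_def inc_def strict_mono_on_def divide_strict_right_mono)

lemma jump_times_less: "u \<in> jump_times j \<Longrightarrow> r \<in> {1..j} \<Longrightarrow> s \<in> {1..j} \<Longrightarrow> r < s \<Longrightarrow> u r < u s"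
  unfolding jump_times_def by (blast dest: strict_mono_onD)

text \<open>The index of the cell \<open>((m - 1) / n, m / n]\<close> in which a time lies.\<close>
definition cell :: "nat \<Rightarrow> (nat \<Rightarrow> real) \<Rightarrow> nat \<Rightarrow> nat" where
  "cell n u i = nat \<lceil>real n * u i\<rceil>"

text \<open>The walk has no step at time \<open>0\<close>, and rounding up to the grid never yields a step index for it.\<close>
definition pos_times :: "nat \<Rightarrow> (nat \<Rightarrow> real) set" where
  "pos_times j = {u \<in> jump_times j. \<forall>i\<in>{1..j}. 0 < u i}"

lemma cell_inc_imp_pos_times:
  assumes n: "1 \<le> n" and k: "restrict (cell n u) {1..j} \<in> inc j n"
  shows "u \<in> pos_times j"
proof -
  have c: "1 \<le> cell n u i" "cell n u i \<le> n" if "i \<in> {1..j}" for i using inc_range[OF k that] that by auto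
  have pos: "0 < u i" if "i \<in> {1..j}" for i
  proof -
    have "0 < real n * u i" using c(1)[OF that] unfolding cell_def by linarith
    then show ?thesis using n by (simp add: zero_less_mult_iff)
  qed
  have le: "u i \<le> 1" if "i \<in> {1..j}" for i
  proof -
    have "real n * u i \<le> real n" using c(2)[OF that] unfolding cell_def by linarith
    then show ?thesis using n by simp
  qed
  have "u r < u s" if "r \<in> {1..j}" "s \<in> {1..j}" "r < s" for r s
  proof (rule ccontr)
    assume "\<not> u r < u s"
    then have "real n * u s \<le> real n * u r" by (intro mult_left_mono) auto
    then have "cell n u s \<le> cell n u r" unfolding cell_def by (intro nat_mono ceiling_mono)
    moreover have "cell n u r < cell n u s" using k that unfolding inc_def strict_mono_on_def by auto
    ultimately show False by simp
  qed
  then show ?thesis using pos le by (auto simp: pos_times_def jump_times_def strict_mono_on_def intro: less_imp_le)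
qed

lemma grid_cell_tendsto:
  assumes "0 \<le> u i"
  shows "(\<lambda>n. grid n (cell n u i)) \<longlonglongrightarrow> u i"
proof (rule LIM_zero_cancel, rule tendsto_0_le[OF lim_1_over_n, of _ 1])
  show "\<forall>\<^sub>F n in sequentially. norm (grid n (cell n u i) - u i) \<le> norm (1 / real n) * 1"
  proof (rule eventually_sequentiallyI[of 1])
    fix n :: nat assume n: "1 \<le> n"
    have "0 \<le> real n * u i" using assms by simp
    then have "\<bar>real (cell n u i) - real n * u i\<bar> \<le> 1" unfolding cell_def by linarith
    moreover have "grid n (cell n u i) - u i = (real (cell n u i) - real n * u i) / real n"
      using n by (simp add: grid_def field_simps)
    ultimately show "norm (grid n (cell n u i) - u i) \<le> norm (1 / real n) * 1"
      using n by (simp add: divide_right_mono)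
  qed
qed

lemma cell_eventually_inc:
  assumes u: "u \<in> pos_times j"
  shows "\<forall>\<^sub>F n in sequentially. restrict (cell n u) {1..j} \<in> inc j n"
proof -
  have b: "0 < u i" "u i \<le> 1" if "i \<in> {1..j}" for i using u that by (auto simp: pos_times_def jump_times_def)
  have "\<forall>\<^sub>F n in sequentially. \<forall>r\<in>{1..j}. \<forall>s\<in>{1..j}. r < s \<longrightarrow> grid n (cell n u r) < grid n (cell n u s)"
  proof (intro eventually_ball_finite ballI finite_atLeastAtMost)
    fix r s assume rs: "r \<in> {1..j}" "s \<in> {1..j}"
    show "\<forall>\<^sub>F n in sequentially. r < s \<longrightarrow> grid n (cell n u r) < grid n (cell n u s)"
    proof (cases "r < s")
      case True
      then have "u r < u s" using u rs jump_times_less[of u j r s] by (simp add: pos_times_def)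
      moreover have "(\<lambda>n. grid n (cell n u s) - grid n (cell n u r)) \<longlonglongrightarrow> u s - u r"
        by (intro tendsto_diff grid_cell_tendsto less_imp_le b rs)
      ultimately have "\<forall>\<^sub>F n in sequentially. 0 < grid n (cell n u s) - grid n (cell n u r)"
        by (intro order_tendstoD(1)[of _ "u s - u r"]) auto
      then show ?thesis by eventually_elim simp
    qed simp
  qed
  then show ?thesis using eventually_ge_at_top[of 1]
  proof eventually_elim
    case (elim n)
    have "cell n u i \<in> {1..n}" if "i \<in> {1..j}" for i
    proof -
      have "0 < real n * u i" "real n * u i \<le> real n * 1" using b[OF that] elim by (auto intro: mult_left_mono)
      then show ?thesis unfolding cell_def by (simp, linarith)
    qed
    moreover have "cell n u r < cell n u s" if "r \<in> {1..j}" "s \<in> {1..j}" "r < s" for r s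
    proof -
      have "grid n (cell n u r) < grid n (cell n u s)" using elim(1) that by blast
      then show ?thesis using elim(2) by (simp add: grid_def divide_less_cancel)
    qed
    ultimately show ?case by (auto simp: inc_def strict_mono_on_def)
  qed
qed

abbreviation unif :: "real measure" where
  "unif \<equiv> uniform_measure lborel {0..1}"

lemma prob_space_unif: "prob_space unif"
  by (intro prob_space_uniform_measure) auto

lemma unif_cell:
  assumes "1 \<le> n" "m \<in> {1..n}"
  shows "emeasure unif {x. nat \<lceil>real n * x\<rceil> = m} = ennreal (1 / real n)"
proof -
  have "{x. nat \<lceil>real n * x\<rceil> = m} = {(real m - 1) / real n <.. real m / real n}"
  proof (intro set_eqI)
    fix x
    have "nat \<lceil>real n * x\<rceil> = m \<longleftrightarrow> \<lceil>real n * x\<rceil> = int m" using assms by auto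
    also have "\<dots> \<longleftrightarrow> real m - 1 < real n * x \<and> real n * x \<le> real m" by (simp add: ceiling_eq_iff)
    also have "\<dots> \<longleftrightarrow> x \<in> {(real m - 1) / real n <.. real m / real n}"
      using assms by (simp add: field_simps)
    finally show "x \<in> {x. nat \<lceil>real n * x\<rceil> = m} \<longleftrightarrow> x \<in> {(real m - 1) / real n <.. real m / real n}" by simp
  qed
  moreover have "{0..1} \<inter> {(real m - 1) / real n <.. real m / real n} = {(real m - 1) / real n <.. real m / real n}"
  proof -
    have "0 \<le> (real m - 1) / real n" "real m / real n \<le> 1" using assms by (auto simp: field_simps)
    then show ?thesis by auto
  qed
  moreover have "real m / real n - (real m - 1) / real n = 1 / real n" by (simp add: diff_divide_distrib[symmetric])
  moreover have "(real m - 1) / real n \<le> real m / real n" by (simp add: divide_right_mono)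
  ultimately show ?thesis by (simp add: divide_ennreal_def)
qed

text \<open>
  The probability space of the coupling: independent copies of the variables of Skorohod's theorem
  for the sizes, and independent uniform times, which are rounded up to the grid for finite \<open>n\<close>.
\<close>
definition coupling :: "nat \<Rightarrow> real measure \<Rightarrow> ((nat \<Rightarrow> real) \<times> (nat \<Rightarrow> real)) measure" where
  "coupling j \<Omega> = PiM {1..j} (\<lambda>_. \<Omega>) \<Otimes>\<^sub>M PiM {1..j} (\<lambda>_. unif)"

text \<open>
  The uniform times are unordered and two of them may fall into the same cell. Only the outcomes with
  cells in increasing order count, so that every choice of positions contributes \<open>n powr (- j)\<close>.
\<close>
definition grid_event :: "nat \<Rightarrow> real measure \<Rightarrow> (real \<Rightarrow> real) \<Rightarrow> nat \<Rightarrow> (real \<Rightarrow> real) set \<Rightarrow> ((nat \<Rightarrow> real) \<times> (nat \<Rightarrow> real)) set" where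
  "grid_event j \<Omega> \<xi> n B = {(w, u) \<in> space (coupling j \<Omega>). restrict (cell n u) {1..j} \<in> inc j n \<and>
      h_map j (\<lambda>i. \<xi> (w i), \<lambda>i. grid n (cell n u i)) \<in> B}"

definition limit_event :: "nat \<Rightarrow> real measure \<Rightarrow> (real \<Rightarrow> real) \<Rightarrow> (real \<Rightarrow> real) set \<Rightarrow> ((nat \<Rightarrow> real) \<times> (nat \<Rightarrow> real)) set" where
  "limit_event j \<Omega> \<xi> B = {(w, u) \<in> space (coupling j \<Omega>). u \<in> pos_times j \<and> h_map j (\<lambda>i. \<xi> (w i), u) \<in> B}"

lemma prob_space_coupling:
  assumes "prob_space \<Omega>" shows "prob_space (coupling j \<Omega>)"
proof -
  interpret A: prob_space "PiM {1..j} (\<lambda>_. \<Omega>)" by (intro prob_space_PiM assms)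
  interpret B: prob_space "PiM {1..j} (\<lambda>_. unif)" by (intro prob_space_PiM prob_space_unif)
  interpret pair_prob_space "PiM {1..j} (\<lambda>_. \<Omega>)" "PiM {1..j} (\<lambda>_. unif)" ..
  show ?thesis unfolding coupling_def by (rule prob_space_axioms)
qed

text \<open>
  The event splits according to the cells of the times, and within each part the sizes and times are
  independent.
\<close>
lemma grid_event_measure:
  assumes O: "prob_space \<Omega>" and xi: "\<xi> \<in> borel_measurable \<Omega>" and n: "1 \<le> n" and B: "B \<in> sets skorohod_borel"
  shows "grid_event j \<Omega> \<xi> n B \<in> sets (coupling j \<Omega>)"
    and "emeasure (coupling j \<Omega>) (grid_event j \<Omega> \<xi> n B) = (\<Sum>k\<in>inc j n. ennreal ((1 / real n) ^ j) *
      emeasure (PiM {1..j} (\<lambda>_. \<Omega>)) {w \<in> space (PiM {1..j} (\<lambda>_. \<Omega>)). h_map j (\<lambda>i. \<xi> (w i), \<lambda>i. grid n (k i)) \<in> B})"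
proof -
  let ?W = "PiM {1..j} (\<lambda>_. \<Omega>)" and ?U = "PiM {1..j} (\<lambda>_. unif)"
  interpret U: prob_space ?U by (intro prob_space_PiM prob_space_unif)
  interpret u1: prob_space unif by (rule prob_space_unif)
  interpret up: product_sigma_finite "\<lambda>_::nat. unif"
    by (simp add: product_sigma_finite_def u1.sigma_finite_measure_axioms)
  define S where "S k = {w \<in> space ?W. h_map j (\<lambda>i. \<xi> (w i), \<lambda>i. grid n (k i)) \<in> B}" for k
  define C where "C k = PiE {1..j} (\<lambda>i. {x::real. nat \<lceil>real n * x\<rceil> = k i})" for k
  have S: "S k \<in> sets ?W" if "k \<in> inc j n" for k
    using measurable_sets[OF h_map_measurable_PiM[OF xi inc_jump_times[OF that n]] B]
    by (simp add: S_def vimage_def Int_def conj_commute)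
  have C: "C k \<in> sets ?U" for k unfolding C_def
  proof (intro sets_PiM_I_finite finite_atLeastAtMost)
    fix i
    have "{x\<in>space borel. nat \<lceil>real n * x\<rceil> = k i} \<in> sets (borel :: real measure)" by measurable
    then show "{x::real. nat \<lceil>real n * x\<rceil> = k i} \<in> sets unif" by simp
  qed
  have spU: "u \<in> space ?U \<longleftrightarrow> u \<in> extensional {1..j}" for u by (auto simp: space_PiM PiE_def)
  have eq: "grid_event j \<Omega> \<xi> n B = (\<Union>k\<in>inc j n. S k \<times> C k)"
  proof (intro set_eqI iffI)
    fix q assume "q \<in> grid_event j \<Omega> \<xi> n B"
    then obtain w u where q: "q = (w, u)" "w \<in> space ?W" "u \<in> space ?U" "restrict (cell n u) {1..j} \<in> inc j n"
        "h_map j (\<lambda>i. \<xi> (w i), \<lambda>i. grid n (cell n u i)) \<in> B"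
      by (auto simp: grid_event_def coupling_def space_pair_measure)
    let ?k = "restrict (cell n u) {1..j}"
    have "h_map j (\<lambda>i. \<xi> (w i), \<lambda>i. grid n (?k i)) = h_map j (\<lambda>i. \<xi> (w i), \<lambda>i. grid n (cell n u i))"
      by (rule h_map_cong) auto
    then have "w \<in> S ?k" using q by (simp add: S_def)
    moreover have "u \<in> C ?k" using q(3) by (auto simp: C_def spU PiE_def cell_def)
    ultimately show "q \<in> (\<Union>k\<in>inc j n. S k \<times> C k)" using q by blast
  next
    fix q assume "q \<in> (\<Union>k\<in>inc j n. S k \<times> C k)"
    then obtain w u k where q: "q = (w, u)" "k \<in> inc j n" "w \<in> S k" "u \<in> C k" by blast
    have ce: "cell n u i = k i" if "i \<in> {1..j}" for i
      using q(4) that by (auto simp: C_def cell_def PiE_iff)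
    have "restrict (cell n u) {1..j} = k"
    proof (rule extensionalityI[of _ "{1..j}"])
      show "k \<in> extensional {1..j}" using q(2) by (auto simp: inc_def PiE_def)
    qed (auto simp: ce)
    moreover have "h_map j (\<lambda>i. \<xi> (w i), \<lambda>i. grid n (cell n u i)) = h_map j (\<lambda>i. \<xi> (w i), \<lambda>i. grid n (k i))"
      by (rule h_map_cong) (auto simp: ce)
    moreover have "u \<in> space ?U" using q(4) by (auto simp: C_def spU PiE_def)
    ultimately show "q \<in> grid_event j \<Omega> \<xi> n B"
      using q by (auto simp: grid_event_def coupling_def space_pair_measure S_def)
  qed
  have disj: "disjoint_family_on (\<lambda>k. S k \<times> C k) (inc j n)"
    unfolding disjoint_family_on_def
  proof (intro ballI impI)
    fix k l assume kl: "k \<in> inc j n" "l \<in> inc j n" "k \<noteq> l"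
    have "C k \<inter> C l = {}"
    proof (rule ccontr)
      assume "C k \<inter> C l \<noteq> {}"
      then obtain u where "u \<in> C k" "u \<in> C l" by blast
      then have "k i = l i" if "i \<in> {1..j}" for i using that by (auto simp: C_def PiE_iff)
      moreover have "k \<in> extensional {1..j}" "l \<in> extensional {1..j}" using kl by (auto simp: inc_def PiE_def)
      ultimately have "k = l" by (intro extensionalityI[of _ "{1..j}"])
      then show False using kl by simp
    qed
    then show "(S k \<times> C k) \<inter> (S l \<times> C l) = {}" by blast
  qed
  have SC: "S k \<times> C k \<in> sets (coupling j \<Omega>)" if "k \<in> inc j n" for k
    unfolding coupling_def using S[OF that] C by (intro pair_measureI)
  show "grid_event j \<Omega> \<xi> n B \<in> sets (coupling j \<Omega>)"
    unfolding eq using finite_inc SC by (intro sets.finite_UN) auto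
  have "emeasure (coupling j \<Omega>) (grid_event j \<Omega> \<xi> n B) = (\<Sum>k\<in>inc j n. emeasure (coupling j \<Omega>) (S k \<times> C k))"
    unfolding eq using finite_inc SC disj by (intro sum_emeasure[symmetric]) auto
  also have "\<dots> = (\<Sum>k\<in>inc j n. ennreal ((1 / real n) ^ j) * emeasure ?W (S k))"
  proof (intro sum.cong refl)
    fix k assume k: "k \<in> inc j n"
    have "emeasure ?U (C k) = (\<Prod>i\<in>{1..j}. emeasure unif {x::real. nat \<lceil>real n * x\<rceil> = k i})"
      unfolding C_def
    proof (intro up.emeasure_PiM finite_atLeastAtMost)
      fix i
      have "{x\<in>space borel. nat \<lceil>real n * x\<rceil> = k i} \<in> sets (borel :: real measure)" by measurable
      then show "{x::real. nat \<lceil>real n * x\<rceil> = k i} \<in> sets unif" by simp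
    qed
    also have "\<dots> = (\<Prod>i\<in>{1..j}. ennreal (1 / real n))"
      using inc_range[OF k] by (intro prod.cong refl unif_cell n) auto
    also have "\<dots> = ennreal ((1 / real n) ^ j)" by (simp add: ennreal_power)
    finally show "emeasure (coupling j \<Omega>) (S k \<times> C k) = ennreal ((1 / real n) ^ j) * emeasure ?W (S k)"
      unfolding coupling_def using S[OF k] C by (subst U.emeasure_pair_measure_Times) (auto simp: mult.commute)
  qed
  finally show "emeasure (coupling j \<Omega>) (grid_event j \<Omega> \<xi> n B) = (\<Sum>k\<in>inc j n. ennreal ((1 / real n) ^ j) *
      emeasure ?W {w \<in> space ?W. h_map j (\<lambda>i. \<xi> (w i), \<lambda>i. grid n (k i)) \<in> B})" by (simp only: S_def)
qed

lemma pos_times_borel: "pos_times j \<in> sets borel"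
proof -
  have "{u\<in>space borel. \<forall>i\<in>{1..j}. 0 < u i} \<in> sets (borel :: (nat \<Rightarrow> real) measure)" by measurable
  from sets.Int[OF jump_times_borel this] show ?thesis
    by (simp add: pos_times_def Int_def)
qed

lemma times_event_measurable:
  fixes V :: "'b \<Rightarrow> nat \<Rightarrow> real"
  assumes V: "\<And>i. i \<in> {1..j} \<Longrightarrow> (\<lambda>x. V x i) \<in> borel_measurable N"
    and T: "T \<in> sets borel" "\<And>u u'. (\<And>i. i \<in> {1..j} \<Longrightarrow> u i = u' i) \<Longrightarrow> u \<in> T \<Longrightarrow> u' \<in> T"
  shows "{x \<in> space N. V x \<in> T} \<in> sets N"
proof -
  let ?V = "\<lambda>x i. if i \<in> {1..j} then V x i else (0::real)"
  have VT: "V x \<in> T \<longleftrightarrow> ?V x \<in> T" for x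
    using T(2)[of "V x" "?V x"] T(2)[of "?V x" "V x"] by auto
  have "{x \<in> space N. V x \<in> T} = ?V -` T \<inter> space N" by (auto simp: VT)
  also have "\<dots> \<in> sets N" by (rule measurable_sets[OF measurable_extend_zero[OF V] T(1)])
  finally show ?thesis .
qed

lemma h_map_event_measurable:
  assumes X: "\<And>i. i \<in> {1..j} \<Longrightarrow> (\<lambda>x. X x i) \<in> borel_measurable N"
    and V: "\<And>i. i \<in> {1..j} \<Longrightarrow> (\<lambda>x. V x i) \<in> borel_measurable N"
    and T: "T \<in> sets borel" "T \<subseteq> jump_times j" "\<And>u u'. (\<And>i. i \<in> {1..j} \<Longrightarrow> u i = u' i) \<Longrightarrow> u \<in> T \<Longrightarrow> u' \<in> T"
    and B: "B \<in> sets skorohod_borel"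
  shows "{x \<in> space N. V x \<in> T \<and> h_map j (X x, V x) \<in> B} \<in> sets N"
proof -
  have D: "{x \<in> space N. V x \<in> T} \<in> sets N" by (rule times_event_measurable[OF V T(1,3)])
  let ?N = "restrict_space N {x \<in> space N. V x \<in> T}"
  have "(\<lambda>x. h_map j (X x, V x)) \<in> measurable ?N skorohod_borel"
    using X V T(2) by (intro h_map_measurable_compose measurable_restrict_space1) (auto simp: space_restrict_space)
  from measurable_sets[OF this B] have "(\<lambda>x. h_map j (X x, V x)) -` B \<inter> space ?N \<in> sets ?N" .
  then have "(\<lambda>x. h_map j (X x, V x)) -` B \<inter> space ?N \<in> sets N"
    using D by (subst (asm) sets_restrict_space_iff) auto
  moreover have "(\<lambda>x. h_map j (X x, V x)) -` B \<inter> space ?N = {x \<in> space N. V x \<in> T \<and> h_map j (X x, V x) \<in> B}"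
    by (auto simp: space_restrict_space)
  ultimately show ?thesis by simp
qed

lemma pos_times_cong: "(\<And>i. i \<in> {1..j} \<Longrightarrow> u i = u' i) \<Longrightarrow> u \<in> pos_times j \<Longrightarrow> u' \<in> pos_times j"
  by (auto simp: pos_times_def jump_times_def strict_mono_on_def)

lemma jump_times_cong: "(\<And>i. i \<in> {1..j} \<Longrightarrow> u i = u' i) \<Longrightarrow> u \<in> jump_times j \<Longrightarrow> u' \<in> jump_times j"
  by (auto simp: jump_times_def strict_mono_on_def)

lemma limit_event_measurable:
  assumes xi: "\<xi> \<in> borel_measurable \<Omega>" and B: "B \<in> sets skorohod_borel"
  shows "limit_event j \<Omega> \<xi> B \<in> sets (coupling j \<Omega>)"
proof -
  have "{q \<in> space (coupling j \<Omega>). snd q \<in> pos_times j \<and> h_map j (\<lambda>i. \<xi> (fst q i), snd q) \<in> B} \<in> sets (coupling j \<Omega>)"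
  proof (rule h_map_event_measurable[where T = "pos_times j"])
    show "pos_times j \<subseteq> jump_times j" by (auto simp: pos_times_def)
    fix i assume i: "i \<in> {1..j}"
    have "(\<lambda>q. fst q i) \<in> measurable (coupling j \<Omega>) \<Omega>"
      unfolding coupling_def by (rule measurable_compose[OF measurable_fst measurable_component_singleton[OF i]])
    then show "(\<lambda>q. \<xi> (fst q i)) \<in> borel_measurable (coupling j \<Omega>)" by (rule measurable_compose[OF _ xi])
    have "(\<lambda>q. snd q i) \<in> measurable (coupling j \<Omega>) unif"
      unfolding coupling_def by (rule measurable_compose[OF measurable_snd measurable_component_singleton[OF i]])
    then show "(\<lambda>q. snd q i) \<in> borel_measurable (coupling j \<Omega>)" by (simp add: measurable_cong_sets[OF refl sets_uniform_measure])
  next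
    fix u u' :: "nat \<Rightarrow> real"
    assume "\<And>i. i \<in> {1..j} \<Longrightarrow> u i = u' i" "u \<in> pos_times j"
    then show "u' \<in> pos_times j" by (rule pos_times_cong)
  qed (rule pos_times_borel B)+
  also have "{q \<in> space (coupling j \<Omega>). snd q \<in> pos_times j \<and> h_map j (\<lambda>i. \<xi> (fst q i), snd q) \<in> B} = limit_event j \<Omega> \<xi> B"
    by (auto simp: limit_event_def)
  finally show ?thesis .
qed

text \<open>Rounding up fixes a jump time \<open>1\<close>, and no jump time is \<open>0\<close>, so that \<open>h_map_continuous\<close> applies.\<close>
lemma coupling_eventually:
  assumes q: "(w, u) \<in> space (coupling j \<Omega>)" and u: "u \<in> pos_times j"
    and lim: "\<And>w. w \<in> space \<Omega> \<Longrightarrow> (\<lambda>n. \<xi> n w) \<longlonglongrightarrow> \<xi>' w" and e: "e > 0"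
  shows "\<forall>\<^sub>F n in sequentially. restrict (cell n u) {1..j} \<in> inc j n \<and>
    d_J1 (h_map j (\<lambda>i. \<xi>' (w i), u)) (h_map j (\<lambda>i. \<xi> n (w i), \<lambda>i. grid n (cell n u i))) < e"
proof -
  have "\<forall>\<^sub>F n in sequentially. d_J1 (h_map j (\<lambda>i. \<xi>' (w i), u)) (h_map j (\<lambda>i. \<xi> n (w i), \<lambda>i. grid n (cell n u i))) < e"
  proof (rule h_map_continuous[OF _ _ _ _ e])
    show "u \<in> jump_times j" using u by (simp add: pos_times_def)
    fix i assume i: "i \<in> {1..j}"
    have "w i \<in> space \<Omega>" using q i by (auto simp: coupling_def space_pair_measure space_PiM)
    then show "(\<lambda>n. \<xi> n (w i)) \<longlonglongrightarrow> \<xi>' (w i)" by (rule lim)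
    show "(\<lambda>n. grid n (cell n u i)) \<longlonglongrightarrow> u i"
      using u i by (intro grid_cell_tendsto) (auto simp: pos_times_def intro: less_imp_le)
  next
    have "grid n (cell n u i) = u i" if "1 \<le> n" "i \<in> {1..j}" "u i = 0 \<or> u i = 1" for n i
      using that u by (auto simp: pos_times_def grid_def cell_def)
    then show "\<forall>\<^sub>F n in sequentially. \<forall>i\<in>{1..j}. u i = 0 \<or> u i = 1 \<longrightarrow> grid n (cell n u i) = u i"
      by (intro eventually_sequentiallyI[of 1]) blast
  qed
  with cell_eventually_inc[OF u] show ?thesis by eventually_elim blast
qed

text \<open>
  This is the reverse Fatou lemma: the unions of \<open>B\<close> with the tails of the sequence \<open>A\<close> decrease
  to \<open>B\<close>.
\<close>
lemma (in finite_measure) eventually_measure_less: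
  assumes A: "\<And>n. n \<ge> 1 \<Longrightarrow> A n \<in> sets M" and B: "B \<in> sets M"
    and ev: "\<And>x. x \<in> space M \<Longrightarrow> x \<notin> B \<Longrightarrow> \<forall>\<^sub>F n in sequentially. x \<notin> A n" and y: "measure M B < y"
  shows "\<forall>\<^sub>F n in sequentially. measure M (A n) < y"
proof -
  define T where "T m = B \<union> (\<Union>n\<in>{max 1 m..}. A n)" for m
  have T: "T m \<in> sets M" for m unfolding T_def using A B by (intro sets.Un sets.countable_UN') auto
  have "decseq T" unfolding T_def by (intro decseq_SucI) fastforce
  have "(\<Inter>m. T m) = B"
  proof (intro equalityI subsetI)
    fix x assume x: "x \<in> (\<Inter>m. T m)"
    show "x \<in> B"
    proof (rule ccontr)
      assume "x \<notin> B"
      moreover have "x \<in> space M" using x T sets.sets_into_space by blast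
      ultimately obtain N where "\<forall>n\<ge>N. x \<notin> A n" using ev by (auto simp: eventually_sequentially)
      then have "x \<notin> T N" using \<open>x \<notin> B\<close> by (auto simp: T_def)
      then show False using x by blast
    qed
  qed (auto simp: T_def)
  moreover have "(\<lambda>m. measure M (T m)) \<longlonglongrightarrow> measure M (\<Inter>m. T m)"
    using T \<open>decseq T\<close> by (intro finite_Lim_measure_decseq) auto
  ultimately have "\<forall>\<^sub>F m in sequentially. measure M (T m) < y" using y by (intro order_tendstoD) auto
  then show ?thesis using eventually_ge_at_top[of 1]
  proof eventually_elim
    case (elim m)
    have "A m \<subseteq> T m" using elim(2) by (auto simp: T_def)
    then have "measure M (A m) \<le> measure M (T m)" using T by (rule finite_measure_mono)
    then show ?case using elim by linarith
  qed
qed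

lemma (in finite_measure) eventually_measure_greater:
  assumes A: "\<And>n. n \<ge> 1 \<Longrightarrow> A n \<in> sets M" and B: "B \<in> sets M"
    and ev: "\<And>x. x \<in> B \<Longrightarrow> \<forall>\<^sub>F n in sequentially. x \<in> A n" and y: "y < measure M B"
  shows "\<forall>\<^sub>F n in sequentially. y < measure M (A n)"
proof -
  have "\<forall>\<^sub>F n in sequentially. measure M (space M - A n) < measure M (space M) - y"
  proof (rule eventually_measure_less[of _ "space M - B"])
    fix x assume "x \<in> space M" "x \<notin> space M - B"
    then have "x \<in> B" by simp
    from ev[OF this] show "\<forall>\<^sub>F n in sequentially. x \<notin> space M - A n" by eventually_elim simp
  qed (use A B y in \<open>auto simp: finite_measure_compl\<close>)
  then show ?thesis using eventually_ge_at_top[of 1]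
    by eventually_elim (use A in \<open>simp add: finite_measure_compl\<close>)
qed

context
  fixes \<Omega> :: "real measure" and \<xi> :: "nat \<Rightarrow> real \<Rightarrow> real" and \<xi>' :: "real \<Rightarrow> real" and j :: nat
  assumes O: "prob_space \<Omega>" and xi: "\<And>n. \<xi> n \<in> borel_measurable \<Omega>" and xi': "\<xi>' \<in> borel_measurable \<Omega>"
    and lim: "\<And>w. w \<in> space \<Omega> \<Longrightarrow> (\<lambda>n. \<xi> n w) \<longlonglongrightarrow> \<xi>' w"
begin

text \<open>
  If the coupled paths lie in the \<open>e\<close>-neighbourhood of \<open>A\<close> infinitely often, their limit lies in the
  \<open>2 * e\<close>-neighbourhood. Enlarging the radius replaces the usual discussion of boundaries.
\<close>
lemma coupling_nbhd_upper:
  assumes e: "e > 0" and y: "measure (coupling j \<Omega>) (limit_event j \<Omega> \<xi>' (nbhd A (2 * e))) < y"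
  shows "\<forall>\<^sub>F n in sequentially. measure (coupling j \<Omega>) (grid_event j \<Omega> (\<xi> n) n (nbhd A e)) < y"
proof -
  interpret C: prob_space "coupling j \<Omega>" by (rule prob_space_coupling[OF O])
  show ?thesis
  proof (rule C.eventually_measure_less[OF _ _ _ y])
    show "limit_event j \<Omega> \<xi>' (nbhd A (2 * e)) \<in> sets (coupling j \<Omega>)"
      by (rule limit_event_measurable[OF xi' nbhd_borel])
    show "grid_event j \<Omega> (\<xi> n) n (nbhd A e) \<in> sets (coupling j \<Omega>)" if "n \<ge> 1" for n
      by (rule grid_event_measure[OF O xi that nbhd_borel])
    fix q assume q: "q \<in> space (coupling j \<Omega>)" "q \<notin> limit_event j \<Omega> \<xi>' (nbhd A (2 * e))"
    obtain w u where wu: "q = (w, u)" by force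
    show "\<forall>\<^sub>F n in sequentially. q \<notin> grid_event j \<Omega> (\<xi> n) n (nbhd A e)"
    proof (cases "u \<in> pos_times j")
      case False
      then show ?thesis using cell_inc_imp_pos_times[of _ u j]
        by (intro eventually_sequentiallyI[of 1]) (auto simp: grid_event_def wu)
    next
      case True
      have "\<forall>\<^sub>F n in sequentially. restrict (cell n u) {1..j} \<in> inc j n \<and>
          d_J1 (h_map j (\<lambda>i. \<xi>' (w i), u)) (h_map j (\<lambda>i. \<xi> n (w i), \<lambda>i. grid n (cell n u i))) < e"
        by (rule coupling_eventually[OF _ True lim e]) (use q(1) wu in simp)
      then show ?thesis
      proof eventually_elim
        case (elim n)
        have close: "d_J1 (h_map j (\<lambda>i. \<xi> n (w i), \<lambda>i. grid n (cell n u i))) (h_map j (\<lambda>i. \<xi>' (w i), u)) < e"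
          using elim by (subst d_J1_commute) simp
        show ?case
        proof
          assume "q \<in> grid_event j \<Omega> (\<xi> n) n (nbhd A e)"
          then have "h_map j (\<lambda>i. \<xi> n (w i), \<lambda>i. grid n (cell n u i)) \<in> nbhd A e" by (simp add: grid_event_def wu)
          then have "h_map j (\<lambda>i. \<xi>' (w i), u) \<in> nbhd (nbhd A e) e"
            by (rule in_nbhdI[OF _ h_map_skorohod h_map_skorohod close])
          then have "h_map j (\<lambda>i. \<xi>' (w i), u) \<in> nbhd A (2 * e)" using nbhd_trans[of A e e] by auto
          then show False using q True by (simp add: limit_event_def wu)
        qed
      qed
    qed
  qed
qed

text \<open>If the limit lies deep inside \<open>A\<close>, so do the coupled paths eventually.\<close>
lemma coupling_core_lower:
  assumes e: "e > 0" and y: "y < measure (coupling j \<Omega>) (limit_event j \<Omega> \<xi>' (core_nbhd A (2 * e)))"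
  shows "\<forall>\<^sub>F n in sequentially. y < measure (coupling j \<Omega>) (grid_event j \<Omega> (\<xi> n) n (core_nbhd A e))"
proof -
  interpret C: prob_space "coupling j \<Omega>" by (rule prob_space_coupling[OF O])
  show ?thesis
  proof (rule C.eventually_measure_greater[OF _ _ _ y])
    show "limit_event j \<Omega> \<xi>' (core_nbhd A (2 * e)) \<in> sets (coupling j \<Omega>)"
      by (rule limit_event_measurable[OF xi' core_nbhd_borel])
    show "grid_event j \<Omega> (\<xi> n) n (core_nbhd A e) \<in> sets (coupling j \<Omega>)" if "n \<ge> 1" for n
      by (rule grid_event_measure[OF O xi that core_nbhd_borel])
    fix q assume q: "q \<in> limit_event j \<Omega> \<xi>' (core_nbhd A (2 * e))"
    obtain w u where wu: "q = (w, u)" by force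
    have sp: "(w, u) \<in> space (coupling j \<Omega>)" and u: "u \<in> pos_times j"
      and h: "h_map j (\<lambda>i. \<xi>' (w i), u) \<in> core_nbhd A (2 * e)"
      using q by (simp_all add: limit_event_def wu)
    have "\<forall>\<^sub>F n in sequentially. restrict (cell n u) {1..j} \<in> inc j n \<and>
        d_J1 (h_map j (\<lambda>i. \<xi>' (w i), u)) (h_map j (\<lambda>i. \<xi> n (w i), \<lambda>i. grid n (cell n u i))) < e"
      by (rule coupling_eventually[OF sp u lim e])
    then show "\<forall>\<^sub>F n in sequentially. q \<in> grid_event j \<Omega> (\<xi> n) n (core_nbhd A e)"
    proof eventually_elim
      case (elim n)
      have close: "d_J1 (h_map j (\<lambda>i. \<xi> n (w i), \<lambda>i. grid n (cell n u i))) (h_map j (\<lambda>i. \<xi>' (w i), u)) < e"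
        using elim by (subst d_J1_commute) simp
      let ?g = "h_map j (\<lambda>i. \<xi> n (w i), \<lambda>i. grid n (cell n u i))"
      have "?g \<in> core_nbhd A e"
      proof (rule ccontr)
        assume "?g \<notin> core_nbhd A e"
        then have "?g \<in> nbhd (skorohod - A) e" by (simp add: core_nbhd_def h_map_skorohod)
        then have "h_map j (\<lambda>i. \<xi>' (w i), u) \<in> nbhd (nbhd (skorohod - A) e) e"
          by (rule in_nbhdI[OF _ h_map_skorohod h_map_skorohod close])
        then have "h_map j (\<lambda>i. \<xi>' (w i), u) \<in> nbhd (skorohod - A) (2 * e)"
          using nbhd_trans[of "skorohod - A" e e] by auto
        then show False using h by (simp add: core_nbhd_def)
      qed
      then show ?case using elim sp by (simp add: grid_event_def wu)
    qed
  qed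
qed

end

section \<open>The limit measure in terms of the coupling\<close>

lemma emeasure_coupling_limit_event:
  assumes f: "f \<in> borel_measurable N" and A: "A \<in> sets skorohod_borel"
  shows "(\<lambda>w. emeasure (PiM {1..j} (\<lambda>_. unif)) (Pair w -` limit_event j N f A)) \<in> borel_measurable (PiM {1..j} (\<lambda>_. N))"
    and "emeasure (coupling j N) (limit_event j N f A)
      = (\<integral>\<^sup>+ w. emeasure (PiM {1..j} (\<lambda>_. unif)) (Pair w -` limit_event j N f A) \<partial>(PiM {1..j} (\<lambda>_. N)))"
proof -
  interpret U: prob_space "PiM {1..j} (\<lambda>_. unif)" by (intro prob_space_PiM prob_space_unif)
  have L: "limit_event j N f A \<in> sets (PiM {1..j} (\<lambda>_. N) \<Otimes>\<^sub>M PiM {1..j} (\<lambda>_. unif))"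
    using limit_event_measurable[OF f A, of j] unfolding coupling_def .
  show "(\<lambda>w. emeasure (PiM {1..j} (\<lambda>_. unif)) (Pair w -` limit_event j N f A)) \<in> borel_measurable (PiM {1..j} (\<lambda>_. N))"
    using L by (rule U.measurable_emeasure_Pair)
  show "emeasure (coupling j N) (limit_event j N f A)
      = (\<integral>\<^sup>+ w. emeasure (PiM {1..j} (\<lambda>_. unif)) (Pair w -` limit_event j N f A) \<partial>(PiM {1..j} (\<lambda>_. N)))"
    unfolding coupling_def using L by (rule U.emeasure_pair_measure_alt)
qed

lemma limit_event_slice:
  assumes "w \<in> space (PiM {1..j} (\<lambda>_. N))"
  shows "Pair w -` limit_event j N f A
    = {u \<in> space (PiM {1..j} (\<lambda>_. unif)). u \<in> pos_times j \<and> h_map j (\<lambda>i. f (w i), u) \<in> A}"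
  using assms by (auto simp: limit_event_def coupling_def space_pair_measure)

text \<open>The event depends on the outcome in \<open>N\<close> only through \<open>f\<close>, so that \<open>N\<close> may be replaced by the law of \<open>f\<close>.\<close>
lemma limit_event_distr:
  assumes N: "prob_space N" and f: "f \<in> borel_measurable N" and A: "A \<in> sets skorohod_borel"
  shows "emeasure (coupling j N) (limit_event j N f A)
    = emeasure (coupling j (distr N borel f)) (limit_event j (distr N borel f) (\<lambda>x. x) A)"
proof -
  let ?D = "distr N borel f" and ?U = "PiM {1..j} (\<lambda>_. unif)"
  let ?B = "PiM {1..j} (\<lambda>_. borel) :: (nat \<Rightarrow> real) measure"
  let ?g = "\<lambda>w. \<lambda>i\<in>{1..j}. f (w i)"
  define \<phi> where "\<phi> w = emeasure ?U (Pair w -` limit_event j ?D (\<lambda>x. x) A)" for w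
  have sB: "sets (PiM {1..j} (\<lambda>_. ?D)) = sets ?B" by (intro sets_PiM_cong) auto
  have g: "?g \<in> measurable (PiM {1..j} (\<lambda>_. N)) ?B"
  proof (rule measurable_restrict)
    fix i assume i: "i \<in> {1..j}"
    show "(\<lambda>w. f (w i)) \<in> borel_measurable (PiM {1..j} (\<lambda>_. N))"
      by (rule measurable_compose[OF measurable_component_singleton[OF i] f])
  qed
  have phi: "\<phi> \<in> borel_measurable (PiM {1..j} (\<lambda>_. ?D))"
    unfolding \<phi>_def by (rule emeasure_coupling_limit_event(1)[OF _ A]) simp
  then have phi': "\<phi> \<in> borel_measurable ?B" using measurable_cong_sets[OF sB refl] by blast
  have "emeasure (coupling j ?D) (limit_event j ?D (\<lambda>x. x) A) = (\<integral>\<^sup>+ w. \<phi> w \<partial>(PiM {1..j} (\<lambda>_. ?D)))"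
    unfolding \<phi>_def by (rule emeasure_coupling_limit_event(2)[OF _ A]) simp
  also have "\<dots> = (\<integral>\<^sup>+ w. \<phi> (?g w) \<partial>(PiM {1..j} (\<lambda>_. N)))"
    unfolding PiM_distr_borel[OF N f finite_atLeastAtMost] using g phi' by (intro nn_integral_distr) simp_all
  also have "\<dots> = (\<integral>\<^sup>+ w. emeasure ?U (Pair w -` limit_event j N f A) \<partial>(PiM {1..j} (\<lambda>_. N)))"
  proof (rule nn_integral_cong)
    fix w assume w: "w \<in> space (PiM {1..j} (\<lambda>_. N))"
    then have "?g w \<in> space ?B" using measurable_space[OF g] by blast
    then have gw: "?g w \<in> space (PiM {1..j} (\<lambda>_. ?D))" using sets_eq_imp_space_eq[OF sB] by blast
    have "h_map j (\<lambda>i. ?g w i, u) = h_map j (\<lambda>i. f (w i), u)" for u by (rule h_map_cong) auto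
    then show "\<phi> (?g w) = emeasure ?U (Pair w -` limit_event j N f A)"
      unfolding \<phi>_def limit_event_slice[OF gw] limit_event_slice[OF w] by simp
  qed
  also have "\<dots> = emeasure (coupling j N) (limit_event j N f A)"
    by (rule emeasure_coupling_limit_event(2)[OF f A, symmetric])
  finally show ?thesis by simp
qed

text \<open>Deleting a jump costs at most its size and leaves a path with fewer jumps.\<close>
lemma few_jumps_near:
  assumes u: "u \<in> jump_times j" and i: "i \<in> {1..j}"
  shows "\<exists>c\<in>D_le (j - 1). d_J1 c (h_map j (z, u)) \<le> \<bar>z i\<bar>"
proof
  let ?z = "z(i := 0)"
  have "{k\<in>{1..j}. ?z k \<noteq> 0} \<subseteq> {1..j} - {i}" by auto
  then have "card {k\<in>{1..j}. ?z k \<noteq> 0} \<le> card ({1..j} - {i})" by (intro card_mono) auto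
  also have "\<dots> = j - 1" using i by simp
  finally show "h_map j (?z, u) \<in> D_le (j - 1)" by (rule h_map_in_D_le[OF u])
  have "d_J1 (h_map j (?z, u)) (h_map j (z, u)) \<le> (\<Sum>k=1..j. \<bar>?z k - z k\<bar>)" by (rule d_J1_h_map_jumps)
  also have "\<dots> = (\<Sum>k\<in>{i}. \<bar>?z k - z k\<bar>)" using i by (intro sum.mono_neutral_right) auto
  finally show "d_J1 (h_map j (?z, u)) (h_map j (z, u)) \<le> \<bar>z i\<bar>" by simp
qed

lemma sigma_finite_nu:
  assumes nu: "is_nu \<alpha> p \<nu>"
  shows "sigma_finite_measure \<nu>"
proof
  define A where "A k = {x. 1 / real (Suc k) < \<bar>x\<bar>}" for k
  show "\<exists>A. countable A \<and> A \<subseteq> sets \<nu> \<and> \<Union> A = space \<nu> \<and> (\<forall>a\<in>A. emeasure \<nu> a \<noteq> \<infinity>)"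
  proof (intro exI[of _ "range A"] conjI)
    show "range A \<subseteq> sets \<nu>" by (auto simp: sets_nu[OF nu] A_def)
    show "\<forall>a\<in>range A. emeasure \<nu> a \<noteq> \<infinity>" unfolding A_def using nu_outside[OF nu] by auto
    have "\<exists>k. x \<in> A k" if "x \<noteq> 0" for x
    proof -
      obtain k where "1 / \<bar>x\<bar> < real k" using reals_Archimedean2 by blast
      then have "1 / \<bar>x\<bar> < real (Suc k)" by simp
      then have "1 / real (Suc k) < \<bar>x\<bar>" using that by (simp add: field_simps)
      then show ?thesis by (auto simp: A_def)
    qed
    then show "\<Union> (range A) = space \<nu>" by (auto simp: space_nu[OF nu] A_def)
  qed simp
qed

lemma AE_unif_pos:
  fixes j :: nat
  shows "AE u in PiM {1..j} (\<lambda>_. unif). \<forall>i\<in>{1..j}. 0 < u i"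
proof (rule AE_finite_allI)
  fix i assume i: "i \<in> {1..j}"
  have "AE x in lborel. x \<in> {0..1} \<longrightarrow> (0::real) < x"
    using AE_lborel_singleton[of 0] by eventually_elim auto
  then have "AE x in unif. 0 < x" by (intro AE_uniform_measureI) auto
  then show "AE u in PiM {1..j} (\<lambda>_. unif). 0 < u i"
    by (intro AE_PiM_component prob_space_unif i)
qed simp

lemma U_up_eq: "U_up j = {u \<in> extensional {1..j}. u \<in> jump_times j}"
  by (auto simp: U_up_def jump_times_def PiE_def)

text \<open>
  The increasing time vectors lie in the unit cube, where Lebesgue measure is the joint law of
  independent uniform times. The vectors with a time \<open>0\<close> form a null set.
  
  In this lemma \<open>coupling\<close> is formed with the infinite measure \<open>\<nu>\<close> in place of a law.
\<close>
lemma limit_measure_eq_coupling: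
  assumes nu: "is_nu \<alpha> p \<nu>" and A: "A \<in> sets skorohod_borel"
  shows "emeasure (limit_measure \<nu> j) A = emeasure (coupling j \<nu>) (limit_event j \<nu> (\<lambda>x. x) A)"
proof -
  let ?N1 = "PiM {1..j} (\<lambda>_. \<nu>)" and ?N2 = "PiM {1..j} (\<lambda>_. lborel) :: (nat \<Rightarrow> real) measure"
  let ?U = "PiM {1..j} (\<lambda>_. unif)"
  let ?N = "?N1 \<Otimes>\<^sub>M ?N2"
  let ?dom = "({1..j} \<rightarrow>\<^sub>E - {0}) \<times> U_up j"
  interpret L: product_sigma_finite "\<lambda>_::nat. lborel :: real measure"
    by (simp add: product_sigma_finite_def lborel.sigma_finite_measure_axioms)
  interpret N2: sigma_finite_measure ?N2 by (intro L.sigma_finite) simp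
  have id: "(\<lambda>x. x) \<in> borel_measurable \<nu>" by (rule ident_nu_measurable[OF nu])
  have fst: "(\<lambda>q. fst q i) \<in> borel_measurable ?N" if "i \<in> {1..j}" for i
    by (rule measurable_compose[OF measurable_compose[OF measurable_fst measurable_component_singleton[OF that]] id])
  have snd: "(\<lambda>q. snd q i) \<in> borel_measurable ?N" if "i \<in> {1..j}" for i
    using measurable_compose[OF measurable_snd measurable_component_singleton[OF that], of ?N1 "\<lambda>_. lborel"] by simp
  have dom_eq: "?dom = {q \<in> space ?N. snd q \<in> jump_times j}"
    by (auto simp: space_pair_measure space_PiM U_up_eq space_nu[OF nu] PiE_def)
  have dom: "?dom \<in> sets ?N"
    unfolding dom_eq by (rule times_event_measurable[OF snd jump_times_borel]) (auto elim: jump_times_cong[rotated])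
  define X where "X = {q \<in> space ?N. snd q \<in> jump_times j \<and> h_map j (fst q, snd q) \<in> A}"
  have X: "X \<in> sets ?N" unfolding X_def
    by (rule h_map_event_measurable[where T = "jump_times j" and X = fst and V = snd, OF fst snd jump_times_borel subset_refl _ A])
       (auto elim: jump_times_cong[rotated])
  have meas: "h_map j \<in> measurable (restrict_space ?N ?dom) skorohod_borel"
  proof -
    have "(\<lambda>q. h_map j (fst q, snd q)) \<in> measurable (restrict_space ?N ?dom) skorohod_borel"
      by (rule h_map_measurable_compose)
         (use fst snd in \<open>auto simp: space_restrict_space U_up_eq intro: measurable_restrict_space1\<close>)
    then show ?thesis by simp
  qed
  have "emeasure (limit_measure \<nu> j) A = emeasure (restrict_space ?N ?dom) (h_map j -` A \<inter> space (restrict_space ?N ?dom))"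
    unfolding limit_measure_def using meas A by (rule emeasure_distr)
  also have "h_map j -` A \<inter> space (restrict_space ?N ?dom) = X"
    unfolding space_restrict_space dom_eq X_def by auto
  also have "emeasure (restrict_space ?N ?dom) X = emeasure ?N X"
    using dom by (intro emeasure_restrict_space) (auto simp: dom_eq X_def)
  also have "\<dots> = (\<integral>\<^sup>+ z. emeasure ?N2 (Pair z -` X) \<partial>?N1)"
    by (rule N2.emeasure_pair_measure_alt[OF X])
  also have "\<dots> = (\<integral>\<^sup>+ z. emeasure ?U (Pair z -` limit_event j \<nu> (\<lambda>x. x) A) \<partial>?N1)"
  proof (rule nn_integral_cong)
    fix z assume z: "z \<in> space ?N1"
    define Y where "Y = Pair z -` X"
    have YN: "Y \<in> sets ?N2" unfolding Y_def by (rule sets_Pair1[OF X])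
    have Y: "Y = {u \<in> space ?N2. u \<in> jump_times j \<and> h_map j (z, u) \<in> A}"
      using z by (auto simp: Y_def X_def space_pair_measure)
    have box: "Y \<subseteq> PiE {1..j} (\<lambda>_. {0..1})" by (auto simp: Y space_PiM PiE_def jump_times_def)
    have U_eq: "?U = uniform_measure ?N2 (PiE {1..j} (\<lambda>_. {0..1}))"
      by (rule PiM_uniform_measure) (auto simp: lborel.sigma_finite_measure_axioms)
    have one: "emeasure ?N2 (PiE {1..j} (\<lambda>_. {0..1})) = 1" by (subst L.emeasure_PiM) auto
    have "emeasure ?U Y = emeasure ?N2 (PiE {1..j} (\<lambda>_. {0..1}) \<inter> Y) / 1"
      unfolding U_eq using YN by (subst emeasure_uniform_measure) (auto intro!: sets_PiM_I_finite simp: one)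
    also have "PiE {1..j} (\<lambda>_. {0..1}) \<inter> Y = Y" using box by blast
    finally have "emeasure ?N2 Y = emeasure ?U Y" by (simp add: divide_ennreal_def)
    also have "\<dots> = emeasure ?U (Pair z -` limit_event j \<nu> (\<lambda>x. x) A)"
    proof (rule emeasure_eq_AE)
      have sp: "space ?U = space ?N2" by (simp add: space_PiM)
      show "AE u in ?U. u \<in> Y \<longleftrightarrow> u \<in> Pair z -` limit_event j \<nu> (\<lambda>x. x) A"
        using AE_unif_pos by eventually_elim (auto simp: Y limit_event_slice[OF z] sp pos_times_def)
      have "sets ?U = sets ?N2" by (intro sets_PiM_cong) auto
      then show "Y \<in> sets ?U" using YN by simp
      show "Pair z -` limit_event j \<nu> (\<lambda>x. x) A \<in> sets ?U"
        using limit_event_measurable[OF id A, of j] unfolding coupling_def by (rule sets_Pair1)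
    qed
    finally show "emeasure ?N2 (Pair z -` X) = emeasure ?U (Pair z -` limit_event j \<nu> (\<lambda>x. x) A)"
      by (simp only: Y_def)
  qed
  also have "\<dots> = emeasure (coupling j \<nu>) (limit_event j \<nu> (\<lambda>x. x) A)"
    by (rule emeasure_coupling_limit_event(2)[OF id A, symmetric])
  finally show ?thesis .
qed

text \<open>
  A path that is farther than \<open>\<delta>\<close> from all paths with fewer jumps has only jumps larger than \<open>\<delta>\<close>, by
  \<open>few_jumps_near\<close>. So \<open>\<nu>\<close> may be restricted to such jumps, which have mass \<open>\<delta> powr (- \<alpha>)\<close>, and normalized
  to the law of the variable \<open>\<xi>\<close> of the coupling.
\<close>
lemma emeasure_limit_measure:
  assumes nu: "is_nu \<alpha> p \<nu>" and d: "\<delta> > 0" and A: "A \<in> sets skorohod_borel"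
    and far: "\<And>f c. f \<in> A \<Longrightarrow> c \<in> D_le (j - 1) \<Longrightarrow> \<delta> < d_J1 c f"
    and O: "prob_space \<Omega>" and xi: "\<xi> \<in> borel_measurable \<Omega>" and law: "distr \<Omega> borel \<xi> = limit_jump_law \<nu> \<delta>"
  shows "emeasure (limit_measure \<nu> j) A
    = ennreal ((\<delta> powr (- \<alpha>)) ^ j * measure (coupling j \<Omega>) (limit_event j \<Omega> \<xi> A))"
proof -
  let ?N1 = "PiM {1..j} (\<lambda>_. \<nu>)" and ?U = "PiM {1..j} (\<lambda>_. unif)"
  let ?S = "{x. \<delta> < \<bar>x\<bar>}"
  let ?\<nu>' = "uniform_measure \<nu> ?S"
  let ?E = "PiE {1..j} (\<lambda>_. ?S)"
  define \<phi> where "\<phi> w = emeasure ?U (Pair w -` limit_event j \<nu> (\<lambda>x. x) A)" for w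
  have id: "(\<lambda>x. x) \<in> borel_measurable \<nu>" by (rule ident_nu_measurable[OF nu])
  have id': "(\<lambda>x. x) \<in> borel_measurable ?\<nu>'" using id by simp
  have S: "?S \<in> sets \<nu>" using d by (simp add: sets_nu[OF nu])
  have Sm: "emeasure \<nu> ?S = ennreal (\<delta> powr (- \<alpha>))" by (rule nu_outside[OF nu d])
  interpret V: product_sigma_finite "\<lambda>_::nat. \<nu>"
    using sigma_finite_nu[OF nu] by (simp add: product_sigma_finite_def)
  interpret O: prob_space "coupling j \<Omega>" by (rule prob_space_coupling[OF O])
  have E: "?E \<in> sets ?N1" using S by (intro sets_PiM_I_finite) auto
  have Em: "emeasure ?N1 ?E = ennreal ((\<delta> powr (- \<alpha>)) ^ j)"
    using S by (subst V.emeasure_PiM) (auto simp: Sm ennreal_power)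
  have phi: "\<phi> \<in> borel_measurable ?N1"
    unfolding \<phi>_def by (rule emeasure_coupling_limit_event(1)[OF id A])
  have zero: "\<phi> w = 0" if w: "w \<in> space ?N1" "w \<notin> ?E" for w
  proof -
    have "w \<in> extensional {1..j}" using w(1) by (simp add: space_PiM PiE_def)
    then have "\<exists>i\<in>{1..j}. \<not> \<delta> < \<bar>w i\<bar>" using w(2) by (auto simp: PiE_iff)
    then obtain i where i: "i \<in> {1..j}" "\<bar>w i\<bar> \<le> \<delta>" by (auto simp: not_less)
    have "Pair w -` limit_event j \<nu> (\<lambda>x. x) A = {}"
    proof (rule equals0I)
      fix u assume "u \<in> Pair w -` limit_event j \<nu> (\<lambda>x. x) A"
      then have u: "u \<in> jump_times j" "h_map j (w, u) \<in> A" by (auto simp: limit_event_def pos_times_def)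
      obtain c where "c \<in> D_le (j - 1)" "d_J1 c (h_map j (w, u)) \<le> \<bar>w i\<bar>"
        using few_jumps_near[OF u(1) i(1), of w] by blast
      then show False using far[OF u(2)] i(2) by fastforce
    qed
    then show ?thesis by (simp add: \<phi>_def)
  qed
  have "emeasure (limit_measure \<nu> j) A = (\<integral>\<^sup>+ w. \<phi> w \<partial>?N1)"
    unfolding \<phi>_def limit_measure_eq_coupling[OF nu A] by (rule emeasure_coupling_limit_event(2)[OF id A])
  also have "\<dots> = (\<integral>\<^sup>+ w. \<phi> w * indicator ?E w \<partial>?N1)"
    by (intro nn_integral_cong) (auto simp: indicator_def zero)
  also have "\<dots> = emeasure ?N1 ?E * (\<integral>\<^sup>+ w. \<phi> w \<partial>(uniform_measure ?N1 ?E))"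
  proof -
    have pos: "0 < (\<delta> powr (- \<alpha>)) ^ j" using d by simp
    have quot: "(\<integral>\<^sup>+ w. \<phi> w \<partial>(uniform_measure ?N1 ?E)) = (\<integral>\<^sup>+ w. \<phi> w * indicator ?E w \<partial>?N1) / emeasure ?N1 ?E"
      using phi E pos unfolding Em by (subst nn_integral_uniform_measure) (auto simp: Em)
    have cancel: "c * (x / c) = x" if "c \<noteq> 0" "c \<noteq> \<infinity>" for c x :: ennreal
      using that ennreal_mult_divide_eq[of c x] by (simp add: ennreal_times_divide mult.commute)
    have ne: "emeasure ?N1 ?E \<noteq> 0" "emeasure ?N1 ?E \<noteq> \<infinity>"
      unfolding Em using pos by (simp_all del: zero_less_power_eq add: ennreal_eq_0_iff not_le)
    show ?thesis unfolding quot by (rule cancel[OF ne, symmetric])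
  qed
  also have "uniform_measure ?N1 ?E = PiM {1..j} (\<lambda>_. ?\<nu>')"
    using S d by (intro PiM_uniform_measure[symmetric] sigma_finite_nu[OF nu]) (auto simp: Sm)
  also have "(\<integral>\<^sup>+ w. \<phi> w \<partial>PiM {1..j} (\<lambda>_. ?\<nu>')) = emeasure (coupling j ?\<nu>') (limit_event j ?\<nu>' (\<lambda>x. x) A)"
  proof -
    have "limit_event j ?\<nu>' (\<lambda>x. x) A = limit_event j \<nu> (\<lambda>x. x) A"
      by (simp add: limit_event_def coupling_def space_pair_measure space_PiM)
    then show ?thesis unfolding \<phi>_def using emeasure_coupling_limit_event(2)[OF id' A, of j] by simp
  qed
  also have "\<dots> = emeasure (coupling j (limit_jump_law \<nu> \<delta>)) (limit_event j (limit_jump_law \<nu> \<delta>) (\<lambda>x. x) A)"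
    unfolding limit_jump_law_def by (rule limit_event_distr[OF prob_space_uniform_nu[OF nu d] id' A])
  also have "\<dots> = emeasure (coupling j \<Omega>) (limit_event j \<Omega> \<xi> A)"
    unfolding law[symmetric] by (rule limit_event_distr[OF O xi A, symmetric])
  also have "\<dots> = ennreal (measure (coupling j \<Omega>) (limit_event j \<Omega> \<xi> A))" by (rule O.emeasure_eq_measure)
  finally show ?thesis using d by (simp add: Em ennreal_mult)
qed

section \<open>Conditioning on the positions of the big jumps\<close>

context heavy_tailed_walk
begin

lemma prob_distinct_coordinates:
  fixes k :: "nat \<Rightarrow> nat" and j :: nat
  assumes inj: "inj_on k {1..j}" and k: "\<And>i. i \<in> {1..j} \<Longrightarrow> 1 \<le> k i" and B: "\<And>i. i \<in> {1..j} \<Longrightarrow> B i \<in> sets borel"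
  shows "prob {\<omega>\<in>space M. \<forall>i\<in>{1..j}. Z (k i) \<omega> \<in> B i} = (\<Prod>i\<in>{1..j}. prob {\<omega>\<in>space M. Z 1 \<omega> \<in> B i})"
proof (cases "j = 0")
  case True
  then show ?thesis by (simp add: prob_space)
next
  case False
  define l where "l = inv_into {1..j} k"
  have lk: "l (k i) = i" if "i \<in> {1..j}" for i using inj that by (simp add: l_def)
  have "{\<omega>\<in>space M. \<forall>i\<in>{1..j}. Z (k i) \<omega> \<in> B i} = (\<Inter>m\<in>k ` {1..j}. Z m -` B (l m) \<inter> space M)"
    using False by (auto simp: lk)
  also have "prob \<dots> = (\<Prod>m\<in>k ` {1..j}. prob (Z m -` B (l m) \<inter> space M))"
    using False k B by (intro indep_varsD[OF indep]) (auto simp: lk)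
  also have "\<dots> = (\<Prod>i\<in>{1..j}. prob (Z (k i) -` B (l (k i)) \<inter> space M))"
    using inj by (simp add: prod.reindex)
  also have "\<dots> = (\<Prod>i\<in>{1..j}. prob {\<omega>\<in>space M. Z 1 \<omega> \<in> B i})"
  proof (rule prod.cong[OF refl])
    fix i assume i: "i \<in> {1..j}"
    have "Z (k i) -` B (l (k i)) \<inter> space M = {\<omega>\<in>space M. Z (k i) \<omega> \<in> B i}" using lk[OF i] by auto
    then show "prob (Z (k i) -` B (l (k i)) \<inter> space M) = prob {\<omega>\<in>space M. Z 1 \<omega> \<in> B i}"
      using prob_Z[OF k[OF i] B[OF i]] by simp
  qed
  finally show ?thesis .
qed

text \<open>
  Steps other than those at \<open>k\<close> may be large too, so these events overlap. The overlap has probability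
  of order \<open>big_rate n ^ Suc j\<close>.
\<close>
definition big_at :: "real \<Rightarrow> nat \<Rightarrow> nat \<Rightarrow> (nat \<Rightarrow> nat) \<Rightarrow> 'a set" where
  "big_at \<delta> n j k = {\<omega>\<in>space M. \<forall>i\<in>{1..j}. \<delta> * lam n < \<bar>Z (k i) \<omega>\<bar>}"

definition big_path :: "nat \<Rightarrow> nat \<Rightarrow> (nat \<Rightarrow> nat) \<Rightarrow> 'a \<Rightarrow> real \<Rightarrow> real" where
  "big_path n j k \<omega> = h_map j (\<lambda>i. Z (k i) \<omega> / lam n, \<lambda>i. grid n (k i))"

lemma big_at_sets: "(\<And>i. i \<in> {1..j} \<Longrightarrow> 1 \<le> k i) \<Longrightarrow> big_at \<delta> n j k \<in> sets M"
  unfolding big_at_def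
proof (intro sets.sets_Collect_finite_All finite_atLeastAtMost)
  fix i assume "\<And>i. i \<in> {1..j} \<Longrightarrow> 1 \<le> k i" "i \<in> {1..j}"
  then have [measurable]: "Z (k i) \<in> borel_measurable M" by (intro Z_measurable)
  show "{\<omega>\<in>space M. \<delta> * lam n < \<bar>Z (k i) \<omega>\<bar>} \<in> sets M" by measurable
qed

lemma prob_big_at:
  assumes "inj_on k {1..j}" "\<And>i. i \<in> {1..j} \<Longrightarrow> 1 \<le> k i"
  shows "prob (big_at \<delta> n j k) = tail (\<delta> * lam n) ^ j"
  using prob_distinct_coordinates[OF assms, of "\<lambda>_. {x. \<delta> * lam n < \<bar>x\<bar>}"]
  by (simp add: big_at_def tail_def)

lemma big_path_measurable:
  assumes k: "k \<in> inc j n" and n: "1 \<le> n"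
  shows "big_path n j k \<in> measurable M skorohod_borel"
  unfolding big_path_def
proof (rule h_map_measurable_compose)
  fix i assume "i \<in> {1..j}"
  then have [measurable]: "Z (k i) \<in> borel_measurable M" using inc_range[OF k] by (intro Z_measurable) auto
  show "(\<lambda>\<omega>. Z (k i) \<omega> / lam n) \<in> borel_measurable M" by measurable
qed (use inc_jump_times[OF k n] in auto)

text \<open>
  By independence, given that certain steps are large, these steps are independent with the
  conditional law of a single large step.
\<close>
lemma conditional_jumps_law:
  assumes inj: "inj_on k {1..j}" and k: "\<And>i. i \<in> {1..j} \<Longrightarrow> 1 \<le> k i"
  shows "distr (uniform_measure M (big_at \<delta> n j k)) (PiM {1..j} (\<lambda>_. borel)) (\<lambda>\<omega>. \<lambda>i\<in>{1..j}. Z (k i) \<omega> / lam n)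
    = PiM {1..j} (\<lambda>_. jump_law \<delta> n)"
proof -
  interpret J: real_distribution "jump_law \<delta> n" by (rule real_distribution_jump_law)
  interpret product_sigma_finite "\<lambda>_::nat. jump_law \<delta> n"
    by (simp add: product_sigma_finite_def J.sigma_finite_measure_axioms)
  let ?E = "big_at \<delta> n j k" and ?V = "\<lambda>\<omega>. \<lambda>i\<in>{1..j}. Z (k i) \<omega> / lam n"
  let ?P = "PiM {1..j} (\<lambda>_. borel) :: (nat \<Rightarrow> real) measure"
  have E: "?E \<in> sets M" by (rule big_at_sets[OF k])
  have V: "?V \<in> measurable M ?P"
  proof (rule measurable_restrict)
    fix i assume "i \<in> {1..j}"
    then have [measurable]: "Z (k i) \<in> borel_measurable M" by (intro Z_measurable k)
    show "(\<lambda>\<omega>. Z (k i) \<omega> / lam n) \<in> borel_measurable M" by measurable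
  qed
  have tp: "tail (\<delta> * lam n) > 0" by (rule tail_pos)
  show ?thesis
  proof (rule PiM_eqI)
    show "sets (distr (uniform_measure M ?E) ?P ?V) = sets (PiM {1..j} (\<lambda>_. jump_law \<delta> n))"
      unfolding sets_distr by (intro sets_PiM_cong) auto
    fix B assume B: "\<And>i. i \<in> {1..j} \<Longrightarrow> B i \<in> sets (jump_law \<delta> n)"
    then have Bb: "B i \<in> sets borel" if "i \<in> {1..j}" for i using that by simp
    let ?C = "\<lambda>i. {x. \<delta> * lam n < \<bar>x\<bar> \<and> x / lam n \<in> B i}"
    have C: "?C i \<in> sets borel" if "i \<in> {1..j}" for i
    proof -
      have [measurable]: "B i \<in> sets borel" by (rule Bb[OF that])
      have "{x\<in>space borel. \<delta> * lam n < \<bar>x\<bar> \<and> x / lam n \<in> B i} \<in> sets borel" by measurable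
      then show ?thesis by simp
    qed
    have box: "PiE {1..j} B \<in> sets ?P" by (intro sets_PiM_I_finite Bb) auto
    have VB: "?V -` PiE {1..j} B \<inter> space M \<in> sets M" by (rule measurable_sets[OF V box])
    have "emeasure (distr (uniform_measure M ?E) ?P ?V) (PiE {1..j} B)
        = emeasure (uniform_measure M ?E) (?V -` PiE {1..j} B \<inter> space M)"
      using V box by (subst emeasure_distr) auto
    also have "\<dots> = emeasure M (?E \<inter> (?V -` PiE {1..j} B \<inter> space M)) / emeasure M ?E"
      by (rule emeasure_uniform_measure[OF E VB])
    also have "?E \<inter> (?V -` PiE {1..j} B \<inter> space M) = {\<omega>\<in>space M. \<forall>i\<in>{1..j}. Z (k i) \<omega> \<in> ?C i}"
      by (auto simp: big_at_def PiE_iff)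
    also have "emeasure M \<dots> = ennreal (\<Prod>i\<in>{1..j}. prob {\<omega>\<in>space M. Z 1 \<omega> \<in> ?C i})"
      unfolding emeasure_eq_measure using prob_distinct_coordinates[OF inj k C] by simp
    also have "emeasure M ?E = ennreal (\<Prod>i\<in>{1..j}. tail (\<delta> * lam n))"
    proof -
      have "prob ?E = tail (\<delta> * lam n) ^ j" by (rule prob_big_at[OF inj k])
      then show ?thesis by (simp add: emeasure_eq_measure)
    qed
    also have "ennreal (\<Prod>i\<in>{1..j}. prob {\<omega>\<in>space M. Z 1 \<omega> \<in> ?C i}) / ennreal (\<Prod>i\<in>{1..j}. tail (\<delta> * lam n))
        = ennreal ((\<Prod>i\<in>{1..j}. prob {\<omega>\<in>space M. Z 1 \<omega> \<in> ?C i}) / (\<Prod>i\<in>{1..j}. tail (\<delta> * lam n)))"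
      using tp by (intro divide_ennreal prod_nonneg prod_pos) auto
    also have "(\<Prod>i\<in>{1..j}. prob {\<omega>\<in>space M. Z 1 \<omega> \<in> ?C i}) / (\<Prod>i\<in>{1..j}. tail (\<delta> * lam n))
        = (\<Prod>i\<in>{1..j}. measure (jump_law \<delta> n) (B i))"
      unfolding prod_dividef[symmetric] by (intro prod.cong refl) (simp add: measure_jump_law[OF Bb])
    also have "ennreal \<dots> = (\<Prod>i\<in>{1..j}. emeasure (jump_law \<delta> n) (B i))"
      by (simp add: J.emeasure_eq_measure prod_ennreal)
    finally show "emeasure (distr (uniform_measure M ?E) ?P ?V) (PiE {1..j} B) = (\<Prod>i\<in>{1..j}. emeasure (jump_law \<delta> n) (B i))" .
  qed simp
qed

text \<open>
  The steps at the positions \<open>k\<close> are all large with probability \<open>tail (\<delta> * lam n) ^ j\<close>, and the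
  coupling gives these positions the weight \<open>(1 / n) ^ j\<close>. The conditional probability of \<open>B\<close> is the same for both,
  which leaves the ratio of these weights as a factor.
\<close>
lemma sum_big_paths:
  assumes n: "1 \<le> n" and B: "B \<in> sets skorohod_borel"
    and O: "prob_space \<Omega>" and xi: "\<xi> \<in> borel_measurable \<Omega>" and law: "distr \<Omega> borel \<xi> = jump_law \<delta> n"
  shows "(\<Sum>k\<in>inc j n. prob {\<omega> \<in> big_at \<delta> n j k. big_path n j k \<omega> \<in> B})
    = (real n * tail (\<delta> * lam n)) ^ j * measure (coupling j \<Omega>) (grid_event j \<Omega> \<xi> n B)"
proof -
  let ?W = "PiM {1..j} (\<lambda>_. \<Omega>)"
  interpret W: prob_space ?W by (intro prob_space_PiM O)
  interpret C: prob_space "coupling j \<Omega>" by (rule prob_space_coupling[OF O])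
  let ?P = "PiM {1..j} (\<lambda>_. borel) :: (nat \<Rightarrow> real) measure"
  define S where "S k = {w \<in> space ?W. h_map j (\<lambda>i. \<xi> (w i), \<lambda>i. grid n (k i)) \<in> B}" for k
  define t where "t = tail (\<delta> * lam n)"
  have t: "t > 0" by (simp add: t_def tail_pos)
  have one: "prob {\<omega> \<in> big_at \<delta> n j k. big_path n j k \<omega> \<in> B} = t ^ j * W.prob (S k)" if k: "k \<in> inc j n" for k
  proof -
    let ?E = "big_at \<delta> n j k" and ?V = "\<lambda>\<omega>. \<lambda>i\<in>{1..j}. Z (k i) \<omega> / lam n"
    have ki: "1 \<le> k i" if "i \<in> {1..j}" for i using inc_range[OF k that] by simp
    have E: "?E \<in> sets M" by (rule big_at_sets[OF ki])
    have Em: "emeasure M ?E = ennreal (t ^ j)"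
    proof -
      have "prob ?E = t ^ j" unfolding t_def by (rule prob_big_at[OF inc_inj[OF k] ki])
      then show ?thesis by (simp add: emeasure_eq_measure)
    qed
    define T where "T = {x \<in> space ?P. h_map j (x, \<lambda>i. grid n (k i)) \<in> B}"
    have T: "T \<in> sets ?P"
      using measurable_sets[OF h_map_measurable_PiM[of j "\<lambda>x. x" borel, OF _ inc_jump_times[OF k n]] B]
      by (simp add: T_def vimage_def Int_def conj_commute)
    have V: "?V \<in> measurable M ?P"
    proof (rule measurable_restrict)
      fix i assume "i \<in> {1..j}"
      then have [measurable]: "Z (k i) \<in> borel_measurable M" by (intro Z_measurable ki)
      show "(\<lambda>\<omega>. Z (k i) \<omega> / lam n) \<in> borel_measurable M" by measurable
    qed
    have VT: "?V -` T \<inter> space M = {\<omega>\<in>space M. big_path n j k \<omega> \<in> B}"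
    proof -
      have "h_map j (?V \<omega>, \<lambda>i. grid n (k i)) = big_path n j k \<omega>" for \<omega>
        unfolding big_path_def by (rule h_map_cong) auto
      then show ?thesis using measurable_space[OF V] by (auto simp: T_def)
    qed
    have path: "{\<omega>\<in>space M. big_path n j k \<omega> \<in> B} \<in> sets M"
      unfolding VT[symmetric] by (rule measurable_sets[OF V T])
    have "measure (PiM {1..j} (\<lambda>_. jump_law \<delta> n)) T = measure (uniform_measure M ?E) (?V -` T \<inter> space M)"
    proof -
      have "distr (uniform_measure M ?E) ?P ?V = PiM {1..j} (\<lambda>_. jump_law \<delta> n)"
        by (rule conditional_jumps_law[OF inc_inj[OF k] ki])
      moreover have "measure (distr (uniform_measure M ?E) ?P ?V) T = measure (uniform_measure M ?E) (?V -` T \<inter> space M)"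
        using V T by (subst measure_distr) auto
      ultimately show ?thesis by simp
    qed
    also have "\<dots> = prob (?E \<inter> {\<omega>\<in>space M. big_path n j k \<omega> \<in> B}) / prob ?E"
      unfolding VT using path t by (intro measure_uniform_measure) (auto simp: Em)
    also have "prob ?E = t ^ j" using t by (simp add: measure_def Em)
    also have "?E \<inter> {\<omega>\<in>space M. big_path n j k \<omega> \<in> B} = {\<omega> \<in> ?E. big_path n j k \<omega> \<in> B}"
      by (auto simp: big_at_def)
    finally have "prob {\<omega> \<in> ?E. big_path n j k \<omega> \<in> B} = t ^ j * measure (PiM {1..j} (\<lambda>_. jump_law \<delta> n)) T"
      using t by simp
    also have "measure (PiM {1..j} (\<lambda>_. jump_law \<delta> n)) T = W.prob (S k)"
    proof -
      let ?g = "\<lambda>w. \<lambda>i\<in>{1..j}. \<xi> (w i)"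
      have g: "?g \<in> measurable ?W ?P"
      proof (rule measurable_restrict)
        fix i assume i: "i \<in> {1..j}"
        show "(\<lambda>w. \<xi> (w i)) \<in> borel_measurable ?W"
          by (rule measurable_compose[OF measurable_component_singleton[OF i] xi])
      qed
      have "measure (PiM {1..j} (\<lambda>_. jump_law \<delta> n)) T = W.prob (?g -` T \<inter> space ?W)"
        unfolding law[symmetric] PiM_distr_borel[OF O xi finite_atLeastAtMost] using g T by (rule measure_distr)
      also have "?g -` T \<inter> space ?W = S k"
      proof -
        have "h_map j (?g w, \<lambda>i. grid n (k i)) = h_map j (\<lambda>i. \<xi> (w i), \<lambda>i. grid n (k i))" for w
          by (rule h_map_cong) auto
        then show ?thesis using measurable_space[OF g] by (auto simp: T_def S_def)
      qed
      finally show ?thesis .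
    qed
    finally show ?thesis .
  qed
  have "ennreal (C.prob (grid_event j \<Omega> \<xi> n B)) = (\<Sum>k\<in>inc j n. ennreal ((1 / real n) ^ j) * emeasure ?W (S k))"
    unfolding C.emeasure_eq_measure[symmetric] S_def by (rule grid_event_measure(2)[OF O xi n B])
  also have "\<dots> = (\<Sum>k\<in>inc j n. ennreal ((1 / real n) ^ j * W.prob (S k)))"
    by (intro sum.cong refl) (simp add: W.emeasure_eq_measure ennreal_mult)
  also have "\<dots> = ennreal (\<Sum>k\<in>inc j n. (1 / real n) ^ j * W.prob (S k))" by (intro sum_ennreal) simp
  finally have "C.prob (grid_event j \<Omega> \<xi> n B) = (\<Sum>k\<in>inc j n. (1 / real n) ^ j * W.prob (S k))"
    by (subst (asm) ennreal_inj) (auto intro!: sum_nonneg)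
  then have g: "real n ^ j * C.prob (grid_event j \<Omega> \<xi> n B) = (\<Sum>k\<in>inc j n. W.prob (S k))"
    using n by (simp only: sum_distrib_left[symmetric]) (simp add: power_divide)
  have "(\<Sum>k\<in>inc j n. prob {\<omega> \<in> big_at \<delta> n j k. big_path n j k \<omega> \<in> B}) = t ^ j * (\<Sum>k\<in>inc j n. W.prob (S k))"
    by (simp add: one sum_distrib_left)
  also have "\<dots> = (real n * t) ^ j * C.prob (grid_event j \<Omega> \<xi> n B)"
    unfolding g[symmetric] by (simp add: power_mult_distrib)
  finally show ?thesis by (simp only: t_def)
qed

end

section \<open>Reduction to the big jumps\<close>

lemma inc_eqI:
  assumes k: "k \<in> inc j n" and l: "l \<in> inc j n" and img: "k ` {1..j} = l ` {1..j}"
  shows "k = l"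
proof -
  have set: "set [1..<Suc j] = {1..j}" by auto
  have srt: "sorted (map m [1..<Suc j])" "distinct (map m [1..<Suc j])" if m: "m \<in> inc j n" for m
  proof -
    have "strict_mono_on {1..j} m" using m by (simp add: inc_def)
    then have "mono_on {1..j} m" by (rule strict_mono_on_imp_mono_on)
    then show "sorted (map m [1..<Suc j])"
      unfolding sorted_map by (intro sorted_wrt_mono_rel[OF _ sorted_upt]) (auto simp: mono_on_def)
    show "distinct (map m [1..<Suc j])" 
      unfolding distinct_map set using inc_inj[OF m] by simp
  qed
  have "set (map k [1..<Suc j]) = set (map l [1..<Suc j])"
    unfolding set_map set by (rule img)
  then have "map k [1..<Suc j] = map l [1..<Suc j]"
    by (intro sorted_distinct_set_unique srt k l)
  then have "\<forall>i\<in>set [1..<Suc j]. k i = l i" by (simp only: map_eq_conv)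
  then have "k i = l i" if "i \<in> {1..j}" for i using that unfolding set by blast
  then show ?thesis
    using k l by (intro extensionalityI[of _ "{1..j}"]) (auto simp: inc_def PiE_def)
qed

context heavy_tailed_walk
begin

definition walk_path :: "nat \<Rightarrow> 'a \<Rightarrow> real \<Rightarrow> real" where
  "walk_path n \<omega> = h_map n (\<lambda>i. Z i \<omega> / lam n, grid n)"

definition big_part :: "real \<Rightarrow> nat \<Rightarrow> 'a \<Rightarrow> real \<Rightarrow> real" where
  "big_part \<delta> n \<omega> = h_map n (\<lambda>i. if \<delta> * lam n < \<bar>Z i \<omega>\<bar> then Z i \<omega> / lam n else 0, grid n)"

definition big_set :: "real \<Rightarrow> nat \<Rightarrow> 'a \<Rightarrow> nat set" where
  "big_set \<delta> n \<omega> = {i\<in>{1..n}. \<delta> * lam n < \<bar>Z i \<omega>\<bar>}"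

definition small_large :: "real \<Rightarrow> real \<Rightarrow> nat \<Rightarrow> 'a set" where
  "small_large \<epsilon> \<delta> n = {\<omega>\<in>space M. \<exists>k\<in>{1..n}. \<epsilon> * lam n < \<bar>\<Sum>i=1..k. trunc \<delta> n i \<omega>\<bar>}"

lemma walk_path_measurable: "walk_path n \<in> measurable M skorohod_borel"
  unfolding walk_path_def
proof (rule h_map_measurable_compose)
  fix i assume "i \<in> {1..n}"
  then have [measurable]: "Z i \<in> borel_measurable M" by (intro Z_measurable) auto
  show "(\<lambda>\<omega>. Z i \<omega> / lam n) \<in> borel_measurable M" by measurable
qed (auto simp: grid_jump_times)

lemma walk_path_event: "A \<in> sets skorohod_borel \<Longrightarrow> {\<omega>\<in>space M. walk_path n \<omega> \<in> A} \<in> sets M"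
  using measurable_sets[OF walk_path_measurable] by (simp add: vimage_def Int_def conj_commute)

lemma small_large_sets: "small_large \<epsilon> \<delta> n \<in> sets M"
  unfolding small_large_def
proof (intro sets.sets_Collect_finite_Ex)
  fix k assume "k \<in> {1..n}"
  have [measurable]: "(\<lambda>\<omega>. \<Sum>i=1..k. trunc \<delta> n i \<omega>) \<in> borel_measurable M"
    by (intro borel_measurable_sum trunc_measurable) auto
  show "{\<omega>\<in>space M. \<epsilon> * lam n < \<bar>\<Sum>i=1..k. trunc \<delta> n i \<omega>\<bar>} \<in> sets M" by measurable
qed auto

lemma big_part_skorohod: "big_part \<delta> n \<omega> \<in> skorohod" and walk_path_skorohod: "walk_path n \<omega> \<in> skorohod"
  by (simp_all add: big_part_def walk_path_def h_map_skorohod)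

text \<open>
  The walk and its big part differ by the partial sums of the small jumps, uniformly in time, without
  any change of time.
\<close>
lemma big_part_close:
  assumes n: "1 \<le> n" and e: "0 \<le> \<epsilon>" and w: "\<omega> \<in> space M" "\<omega> \<notin> small_large \<epsilon> \<delta> n"
  shows "d_J1 (big_part \<delta> n \<omega>) (walk_path n \<omega>) \<le> \<epsilon>"
proof (rule d_J1_le_sup)
  fix t :: real assume t: "t \<in> {0..1}"
  have lam: "lam n > 0" by (rule lam_pos[OF n])
  define k where "k = nat \<lfloor>real n * t\<rfloor>"
  have "real n * t \<le> real n * 1" using t by (intro mult_left_mono) auto
  then have k: "k \<le> n" unfolding k_def by linarith
  have "big_part \<delta> n \<omega> t - walk_path n \<omega> t
      = (\<Sum>i=1..k. if \<delta> * lam n < \<bar>Z i \<omega>\<bar> then Z i \<omega> / lam n else 0) - (\<Sum>i=1..k. Z i \<omega> / lam n)"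
    unfolding big_part_def walk_path_def h_map_at[OF t] grid_apply_sum[OF t] k_def ..
  also have "\<dots> = (\<Sum>i=1..k. - (trunc \<delta> n i \<omega> / lam n))"
    unfolding sum_subtractf[symmetric] by (intro sum.cong refl) (simp add: trunc_def)
  also have "\<dots> = - ((\<Sum>i=1..k. trunc \<delta> n i \<omega>) / lam n)" by (simp add: sum_negf sum_divide_distrib)
  finally have eq: "\<bar>big_part \<delta> n \<omega> t - walk_path n \<omega> t\<bar> = \<bar>\<Sum>i=1..k. trunc \<delta> n i \<omega>\<bar> / lam n"
    using lam by (simp add: abs_divide)
  have "\<bar>\<Sum>i=1..k. trunc \<delta> n i \<omega>\<bar> \<le> \<epsilon> * lam n"
  proof (cases "k = 0")
    case True
    then show ?thesis using e lam by simp
  next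
    case False
    then show ?thesis using w k by (force simp: small_large_def not_less)
  qed
  then show "\<bar>big_part \<delta> n \<omega> t - walk_path n \<omega> t\<bar> \<le> \<epsilon>"
    unfolding eq using lam by (simp add: pos_divide_le_eq)
qed

lemma big_part_eq_big_path:
  assumes k: "k \<in> inc j n" and img: "k ` {1..j} = big_set \<delta> n \<omega>"
  shows "big_part \<delta> n \<omega> = big_path n j k \<omega>"
proof -
  have "big_part \<delta> n \<omega> = h_map j (\<lambda>i. if \<delta> * lam n < \<bar>Z (k i) \<omega>\<bar> then Z (k i) \<omega> / lam n else 0, \<lambda>i. grid n (k i))"
    unfolding big_part_def
    by (rule h_map_reindex[OF inc_inj[OF k]]) (use img in \<open>auto simp: big_set_def\<close>)
  also have "\<dots> = big_path n j k \<omega>"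
    unfolding big_path_def
  proof (rule h_map_cong)
    fix i assume "i \<in> {1..j}"
    then have "k i \<in> big_set \<delta> n \<omega>" using img by blast
    then show "(if \<delta> * lam n < \<bar>Z (k i) \<omega>\<bar> then Z (k i) \<omega> / lam n else 0) = Z (k i) \<omega> / lam n"
      by (simp add: big_set_def)
  qed simp
  finally show ?thesis .
qed

lemma big_set_enumeration:
  obtains k where "k \<in> inc (card (big_set \<delta> n \<omega>)) n" "k ` {1..card (big_set \<delta> n \<omega>)} = big_set \<delta> n \<omega>"
proof -
  let ?K = "big_set \<delta> n \<omega>"
  have "finite ?K" by (simp add: big_set_def)
  then obtain k where k: "bij_betw k {1..card ?K} ?K" "strict_mono_on {1..card ?K} k"
    by (rule strict_mono_enumeration)
  let ?k = "restrict k {1..card ?K}"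
  have img: "?k ` {1..card ?K} = ?K" using k(1) by (simp add: bij_betw_def)
  moreover have "?k \<in> inc (card ?K) n"
  proof -
    have "k i \<in> {1..n}" if "i \<in> {1..card ?K}" for i
      using k(1) that by (auto simp: bij_betw_def big_set_def)
    then show ?thesis using k(2) by (auto simp: inc_def strict_mono_on_def)
  qed
  ultimately show ?thesis using that by blast
qed

lemma inc_restrict:
  assumes k: "k \<in> inc m n" and "j \<le> m"
  shows "restrict k {1..j} \<in> inc j n"
  using assms inc_range[OF k] by (auto simp: inc_def strict_mono_on_def)

lemma prob_more_jumps: "(\<Sum>k\<in>inc j n. prob (big_at \<delta> n j k)) \<le> (real n * tail (\<delta> * lam n)) ^ j"
proof -
  have "prob (big_at \<delta> n j k) = tail (\<delta> * lam n) ^ j" if "k \<in> inc j n" for k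
    using inc_range[OF that] by (intro prob_big_at inc_inj[OF that]) auto
  then have "(\<Sum>k\<in>inc j n. prob (big_at \<delta> n j k)) = real (card (inc j n)) * tail (\<delta> * lam n) ^ j" by simp
  also have "\<dots> \<le> real (n ^ j) * tail (\<delta> * lam n) ^ j"
    using card_inc[of j n] tail_pos[of "\<delta> * lam n"] by (intro mult_right_mono) (auto simp del: of_nat_power)
  finally show ?thesis by (simp add: power_mult_distrib)
qed

text \<open>
  Let the small jumps be negligible. If there were fewer than \<open>j\<close> big jumps, the walk would be within
  \<open>\<epsilon>\<close> of \<open>D_le (j - 1)\<close> and so outside \<open>A\<close>. If there are more than \<open>j\<close>, then some \<open>j + 1\<close> steps are large.
  Otherwise the walk is close to the path made of its \<open>j\<close> big jumps.
\<close>
lemma prob_path_upper: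
  assumes j: "1 \<le> j" and n: "1 \<le> n" and A: "A \<in> sets skorohod_borel" and e: "0 < \<epsilon>" "\<epsilon> < r"
    and far: "\<And>f c. f \<in> A \<Longrightarrow> c \<in> D_le (j - 1) \<Longrightarrow> r \<le> d_J1 c f"
  shows "prob {\<omega>\<in>space M. walk_path n \<omega> \<in> A} \<le> prob (small_large (\<epsilon> / 2) \<delta> n) + (real n * tail (\<delta> * lam n)) ^ Suc j
    + (\<Sum>k\<in>inc j n. prob {\<omega> \<in> big_at \<delta> n j k. big_path n j k \<omega> \<in> nbhd A \<epsilon>})"
proof -
  let ?S = "small_large (\<epsilon> / 2) \<delta> n"
  let ?T = "\<Union>k\<in>inc (Suc j) n. big_at \<delta> n (Suc j) k"
  let ?P = "\<lambda>k. {\<omega> \<in> big_at \<delta> n j k. big_path n j k \<omega> \<in> nbhd A \<epsilon>}"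
  have T: "big_at \<delta> n m k \<in> sets M" if "k \<in> inc m n" for k m
    using inc_range[OF that] by (intro big_at_sets) auto
  have P: "?P k \<in> sets M" if k: "k \<in> inc j n" for k
  proof -
    have "big_path n j k -` nbhd A \<epsilon> \<inter> space M \<in> sets M"
      by (rule measurable_sets[OF big_path_measurable[OF k n] nbhd_borel])
    then have "big_at \<delta> n j k \<inter> (big_path n j k -` nbhd A \<epsilon> \<inter> space M) \<in> sets M" using T[OF k] by blast
    also have "big_at \<delta> n j k \<inter> (big_path n j k -` nbhd A \<epsilon> \<inter> space M) = ?P k" by (auto simp: big_at_def)
    finally show ?thesis .
  qed
  have sub: "{\<omega>\<in>space M. walk_path n \<omega> \<in> A} \<subseteq> (?S \<union> ?T) \<union> (\<Union>k\<in>inc j n. ?P k)"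
  proof
    fix \<omega> assume "\<omega> \<in> {\<omega>\<in>space M. walk_path n \<omega> \<in> A}"
    then have w: "\<omega> \<in> space M" "walk_path n \<omega> \<in> A" by auto
    show "\<omega> \<in> (?S \<union> ?T) \<union> (\<Union>k\<in>inc j n. ?P k)"
    proof (cases "\<omega> \<in> ?S")
      case False
      have close: "d_J1 (big_part \<delta> n \<omega>) (walk_path n \<omega>) \<le> \<epsilon> / 2"
        using e by (intro big_part_close n w(1) False) simp
      define m where "m = card (big_set \<delta> n \<omega>)"
      obtain k where k: "k \<in> inc m n" "k ` {1..m} = big_set \<delta> n \<omega>"
        unfolding m_def by (rule big_set_enumeration)
      have big: "\<delta> * lam n < \<bar>Z (k i) \<omega>\<bar>" if "i \<in> {1..m}" for i
      proof -
        have "k i \<in> big_set \<delta> n \<omega>" using k(2) that by blast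
        then show ?thesis by (simp add: big_set_def)
      qed
      have "\<not> m < j"
      proof
        assume "m < j"
        have "card {i\<in>{1..n}. (if \<delta> * lam n < \<bar>Z i \<omega>\<bar> then Z i \<omega> / lam n else 0) \<noteq> 0} \<le> m"
          unfolding m_def by (intro card_mono) (auto simp: big_set_def split: if_splits)
        then have "big_part \<delta> n \<omega> \<in> D_le (j - 1)"
          unfolding big_part_def using \<open>m < j\<close> by (intro h_map_in_D_le grid_jump_times) linarith
        then have "r \<le> d_J1 (big_part \<delta> n \<omega>) (walk_path n \<omega>)" by (rule far[OF w(2)])
        then show False using close e by linarith
      qed
      then consider "m = j" | "Suc j \<le> m" by linarith
      then show ?thesis
      proof cases
        case 1
        have "\<omega> \<in> big_at \<delta> n j k" using w(1) big 1 by (simp add: big_at_def)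
        moreover have "big_path n j k \<omega> \<in> nbhd A \<epsilon>"
        proof -
          have "big_part \<delta> n \<omega> \<in> nbhd A \<epsilon>"
          proof (rule in_nbhdI[OF w(2) walk_path_skorohod big_part_skorohod])
            show "d_J1 (walk_path n \<omega>) (big_part \<delta> n \<omega>) < \<epsilon>" using close e by (subst d_J1_commute) simp
          qed
          then show ?thesis using big_part_eq_big_path[of k j n \<delta> \<omega>] k 1 by simp
        qed
        ultimately show ?thesis using k(1) 1 by blast
      next
        case 2
        have "\<omega> \<in> big_at \<delta> n (Suc j) (restrict k {1..Suc j})" using w(1) big 2 by (simp add: big_at_def)
        moreover have "restrict k {1..Suc j} \<in> inc (Suc j) n" using k(1) 2 by (rule inc_restrict)
        ultimately show ?thesis by blast
      qed
    qed simp
  qed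
  have "prob {\<omega>\<in>space M. walk_path n \<omega> \<in> A} \<le> prob ((?S \<union> ?T) \<union> (\<Union>k\<in>inc j n. ?P k))"
    using sub finite_inc T P small_large_sets by (intro finite_measure_mono sets.Un sets.finite_UN) auto
  also have "\<dots> \<le> prob (?S \<union> ?T) + prob (\<Union>k\<in>inc j n. ?P k)"
    using finite_inc T P small_large_sets by (intro measure_Un_le sets.Un sets.finite_UN) auto
  also have "prob (?S \<union> ?T) \<le> prob ?S + prob ?T"
    using finite_inc T small_large_sets by (intro measure_Un_le sets.finite_UN) auto
  also have "prob ?T \<le> (\<Sum>k\<in>inc (Suc j) n. prob (big_at \<delta> n (Suc j) k))"
    using finite_inc T by (intro measure_UNION_le) auto
  also have "\<dots> \<le> (real n * tail (\<delta> * lam n)) ^ Suc j" by (rule prob_more_jumps)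
  also have "prob (\<Union>k\<in>inc j n. ?P k) \<le> (\<Sum>k\<in>inc j n. prob (?P k))"
    using finite_inc P by (intro measure_UNION_le) auto
  finally show ?thesis by simp
qed

text \<open>
  The events of the sum overlap. Removing from the event for \<open>k\<close> the event \<open>F k\<close> of a further big jump
  makes \<open>k\<close> the exact set of positions of big jumps, hence the remainders are disjoint, and each removal
  costs at most \<open>n * tail (\<delta> * lam n) ^ Suc j\<close>.
\<close>
lemma prob_path_lower:
  assumes n: "1 \<le> n" and A: "A \<in> sets skorohod_borel" and e: "0 < \<epsilon>"
  shows "(\<Sum>k\<in>inc j n. prob {\<omega> \<in> big_at \<delta> n j k. big_path n j k \<omega> \<in> core_nbhd A \<epsilon>})
    \<le> prob {\<omega>\<in>space M. walk_path n \<omega> \<in> A} + prob (small_large (\<epsilon> / 2) \<delta> n) + (real n * tail (\<delta> * lam n)) ^ Suc j"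
proof -
  let ?S = "small_large (\<epsilon> / 2) \<delta> n"
  define P where "P k = {\<omega> \<in> big_at \<delta> n j k. big_path n j k \<omega> \<in> core_nbhd A \<epsilon>}" for k
  define F where "F k = (\<Union>l\<in>{1..n} - k ` {1..j}. big_at \<delta> n (Suc j) (k(Suc j := l)))" for k
  have T: "big_at \<delta> n j k \<in> sets M" if "k \<in> inc j n" for k
    using inc_range[OF that] by (intro big_at_sets) auto
  have P: "P k \<in> sets M" if k: "k \<in> inc j n" for k
  proof -
    have "big_path n j k -` core_nbhd A \<epsilon> \<inter> space M \<in> sets M"
      by (rule measurable_sets[OF big_path_measurable[OF k n] core_nbhd_borel])
    then have "big_at \<delta> n j k \<inter> (big_path n j k -` core_nbhd A \<epsilon> \<inter> space M) \<in> sets M" using T[OF k] by blast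
    also have "big_at \<delta> n j k \<inter> (big_path n j k -` core_nbhd A \<epsilon> \<inter> space M) = P k" by (auto simp: P_def big_at_def)
    finally show ?thesis .
  qed
  have ext_pos: "1 \<le> (k(Suc j := l)) i" if "k \<in> inc j n" "l \<in> {1..n} - k ` {1..j}" "i \<in> {1..Suc j}" for k l i
    using inc_range[OF that(1), of i] that(2,3) by (cases "i = Suc j") auto
  have ext_inj: "inj_on (k(Suc j := l)) {1..Suc j}" if "k \<in> inc j n" "l \<in> {1..n} - k ` {1..j}" for k l
  proof -
    have "{1..Suc j} = insert (Suc j) {1..j}" by auto
    moreover have "inj_on (k(Suc j := l)) {1..j} = inj_on k {1..j}" by (rule inj_on_cong) auto
    then have "inj_on (k(Suc j := l)) {1..j}" using inc_inj[OF that(1)] by blast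
    moreover have "(k(Suc j := l)) ` {1..j} = k ` {1..j}" by auto
    ultimately show ?thesis using that(2) by (simp add: inj_on_insert)
  qed
  have ext: "big_at \<delta> n (Suc j) (k(Suc j := l)) \<in> sets M"
    "prob (big_at \<delta> n (Suc j) (k(Suc j := l))) = tail (\<delta> * lam n) ^ Suc j"
    if "k \<in> inc j n" "l \<in> {1..n} - k ` {1..j}" for k l
    by (rule big_at_sets ext_pos[OF that] | assumption)+
       (rule prob_big_at[OF ext_inj[OF that] ext_pos[OF that]])
  have F: "F k \<in> sets M" if "k \<in> inc j n" for k
    unfolding F_def using ext(1)[OF that] by (intro sets.finite_UN) auto
  have pF: "prob (F k) \<le> real n * tail (\<delta> * lam n) ^ Suc j" if k: "k \<in> inc j n" for k
  proof -
    have "prob (F k) \<le> (\<Sum>l\<in>{1..n} - k ` {1..j}. prob (big_at \<delta> n (Suc j) (k(Suc j := l))))"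
      unfolding F_def using ext(1)[OF k] by (intro measure_UNION_le) auto
    also have "\<dots> = real (card ({1..n} - k ` {1..j})) * tail (\<delta> * lam n) ^ Suc j"
      using ext(2)[OF k] by simp
    also have "\<dots> \<le> real n * tail (\<delta> * lam n) ^ Suc j"
    proof (intro mult_right_mono)
      have "card ({1..n} - k ` {1..j}) \<le> card {1..n}" by (intro card_mono) auto
      then show "real (card ({1..n} - k ` {1..j})) \<le> real n" by simp
    qed (use tail_pos[of "\<delta> * lam n"] in simp)
    finally show ?thesis .
  qed
  have exact: "k ` {1..j} = big_set \<delta> n \<omega>" if k: "k \<in> inc j n" and w: "\<omega> \<in> P k - F k" for k \<omega>
  proof
    have b: "\<omega> \<in> space M" "\<And>i. i \<in> {1..j} \<Longrightarrow> \<delta> * lam n < \<bar>Z (k i) \<omega>\<bar>"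
      using w by (auto simp: P_def big_at_def)
    show "k ` {1..j} \<subseteq> big_set \<delta> n \<omega>" using b(2) inc_range[OF k] by (auto simp: big_set_def)
    show "big_set \<delta> n \<omega> \<subseteq> k ` {1..j}"
    proof
      fix l assume l: "l \<in> big_set \<delta> n \<omega>"
      show "l \<in> k ` {1..j}"
      proof (rule ccontr)
        assume nl: "l \<notin> k ` {1..j}"
        have "\<delta> * lam n < \<bar>Z ((k(Suc j := l)) i) \<omega>\<bar>" if i: "i \<in> {1..Suc j}" for i
        proof (cases "i = Suc j")
          case True
          then show ?thesis using l by (simp add: big_set_def)
        next
          case False
          then have "i \<in> {1..j}" using i by auto
          then show ?thesis using b(2) False by simp
        qed
        then have "\<omega> \<in> big_at \<delta> n (Suc j) (k(Suc j := l))" using b(1) by (simp only: big_at_def mem_Collect_eq) blast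
        then have "\<omega> \<in> F k" using l nl by (auto simp: F_def big_set_def)
        then show False using w by blast
      qed
    qed
  qed
  have disj: "disjoint_family_on (\<lambda>k. P k - F k) (inc j n)"
    unfolding disjoint_family_on_def
  proof (intro ballI impI)
    fix k l assume kl: "k \<in> inc j n" "l \<in> inc j n" "k \<noteq> l"
    show "(P k - F k) \<inter> (P l - F l) = {}"
    proof (rule equals0I)
      fix \<omega> assume "\<omega> \<in> (P k - F k) \<inter> (P l - F l)"
      then have "k ` {1..j} = l ` {1..j}" using exact[OF kl(1), of \<omega>] exact[OF kl(2), of \<omega>] by simp
      then show False using inc_eqI[OF kl(1,2)] kl(3) by blast
    qed
  qed
  have sub: "(\<Union>k\<in>inc j n. P k - F k) \<subseteq> {\<omega>\<in>space M. walk_path n \<omega> \<in> A} \<union> ?S"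
  proof
    fix \<omega> assume "\<omega> \<in> (\<Union>k\<in>inc j n. P k - F k)"
    then obtain k where k: "k \<in> inc j n" "\<omega> \<in> P k - F k" by blast
    then have w: "\<omega> \<in> space M" "big_path n j k \<omega> \<in> core_nbhd A \<epsilon>" by (auto simp: P_def big_at_def)
    show "\<omega> \<in> {\<omega>\<in>space M. walk_path n \<omega> \<in> A} \<union> ?S"
    proof (cases "\<omega> \<in> ?S")
      case False
      have "d_J1 (big_part \<delta> n \<omega>) (walk_path n \<omega>) \<le> \<epsilon> / 2"
        using e by (intro big_part_close n w(1) False) simp
      moreover have "big_part \<delta> n \<omega> \<in> core_nbhd A \<epsilon>"
        using w(2) big_part_eq_big_path[OF k(1) exact[OF k]] by simp
      ultimately have "walk_path n \<omega> \<in> A" using e by (intro core_nbhdD[OF _ walk_path_skorohod]) auto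
      then show ?thesis using w by simp
    qed simp
  qed
  have "(\<Sum>k\<in>inc j n. prob (P k)) \<le> (\<Sum>k\<in>inc j n. prob (P k - F k) + real n * tail (\<delta> * lam n) ^ Suc j)"
  proof (rule sum_mono)
    fix k assume k: "k \<in> inc j n"
    have "prob (P k) \<le> prob ((P k - F k) \<union> F k)" using P[OF k] F[OF k] by (intro finite_measure_mono) auto
    also have "\<dots> \<le> prob (P k - F k) + prob (F k)" using P[OF k] F[OF k] by (intro measure_Un_le) auto
    finally show "prob (P k) \<le> prob (P k - F k) + real n * tail (\<delta> * lam n) ^ Suc j" using pF[OF k] by linarith
  qed
  also have "\<dots> = (\<Sum>k\<in>inc j n. prob (P k - F k)) + real (card (inc j n)) * (real n * tail (\<delta> * lam n) ^ Suc j)"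
    by (simp add: sum.distrib)
  also have "(\<Sum>k\<in>inc j n. prob (P k - F k)) = prob (\<Union>k\<in>inc j n. P k - F k)"
    using P F disj finite_inc by (intro finite_measure_finite_Union[symmetric]) auto
  also have "\<dots> \<le> prob ({\<omega>\<in>space M. walk_path n \<omega> \<in> A} \<union> ?S)"
    using sub walk_path_event[OF A] small_large_sets by (intro finite_measure_mono) auto
  also have "\<dots> \<le> prob {\<omega>\<in>space M. walk_path n \<omega> \<in> A} + prob ?S"
    using walk_path_event[OF A] small_large_sets by (intro measure_Un_le) auto
  also have "real (card (inc j n)) * (real n * tail (\<delta> * lam n) ^ Suc j) \<le> real (n ^ j) * (real n * tail (\<delta> * lam n) ^ Suc j)"
    using card_inc[of j n] tail_pos[of "\<delta> * lam n"] by (intro mult_right_mono) (auto simp del: of_nat_power)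
  also have "\<dots> = (real n * tail (\<delta> * lam n)) ^ Suc j" by (simp add: power_mult_distrib)
  finally show ?thesis by (simp add: P_def)
qed

section \<open>Asymptotic bounds for sets away from paths with few jumps\<close>

text \<open>A further big jump costs a factor of order \<open>big_rate n\<close>, which tends to zero.\<close>
lemma error_negligible:
  assumes small: "(\<lambda>n. prob (small_large (\<epsilon> / 2) \<delta> n) / big_rate n ^ j) \<longlonglongrightarrow> 0" and d: "\<delta> > 0"
  shows "(\<lambda>n. (prob (small_large (\<epsilon> / 2) \<delta> n) + (real n * tail (\<delta> * lam n)) ^ Suc j) / big_rate n ^ j) \<longlonglongrightarrow> 0"
proof -
  have "(\<lambda>n. (tail (\<delta> * lam n) / tail (lam n)) ^ Suc j * big_rate n) \<longlonglongrightarrow> (\<delta> powr (- \<alpha>)) ^ Suc j * 0"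
    by (intro tendsto_intros tail_lam_ratio d big_rate_tendsto_0)
  moreover have "\<forall>\<^sub>F n in sequentially. (tail (\<delta> * lam n) / tail (lam n)) ^ Suc j * big_rate n
      = (real n * tail (\<delta> * lam n)) ^ Suc j / big_rate n ^ j"
  proof (rule eventually_sequentiallyI[of 1])
    fix n :: nat assume n: "1 \<le> n"
    have b: "big_rate n > 0" by (rule big_rate_pos[OF n])
    have "real n * tail (\<delta> * lam n) = tail (\<delta> * lam n) / tail (lam n) * big_rate n"
      using tail_pos[of "lam n"] by (simp add: big_rate_def)
    then have "(real n * tail (\<delta> * lam n)) ^ Suc j = (tail (\<delta> * lam n) / tail (lam n)) ^ Suc j * big_rate n ^ Suc j"
      by (simp only: power_mult_distrib)
    then show "(tail (\<delta> * lam n) / tail (lam n)) ^ Suc j * big_rate n = (real n * tail (\<delta> * lam n)) ^ Suc j / big_rate n ^ j"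
      using b by simp
  qed
  ultimately have "(\<lambda>n. (real n * tail (\<delta> * lam n)) ^ Suc j / big_rate n ^ j) \<longlonglongrightarrow> 0"
    using Lim_transform_eventually by fastforce
  from tendsto_add[OF small this] show ?thesis by (simp add: add_divide_distrib)
qed

lemma scale_limit:
  assumes d: "\<delta> > 0"
  shows "(\<lambda>n. (real n * tail (\<delta> * lam n)) ^ j / big_rate n ^ j) \<longlonglongrightarrow> (\<delta> powr (- \<alpha>)) ^ j"
proof -
  have "(\<lambda>n. (tail (\<delta> * lam n) / tail (lam n)) ^ j) \<longlonglongrightarrow> (\<delta> powr (- \<alpha>)) ^ j"
    by (intro tendsto_intros tail_lam_ratio d)
  moreover have "\<forall>\<^sub>F n in sequentially. (tail (\<delta> * lam n) / tail (lam n)) ^ j = (real n * tail (\<delta> * lam n)) ^ j / big_rate n ^ j"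
    by (rule eventually_sequentiallyI[of 1])
       (simp add: big_rate_def power_divide power_mult_distrib)
  ultimately show ?thesis by (rule Lim_transform_eventually)
qed

text \<open>
  The truncation level \<open>\<delta>\<close> is at most \<open>\<epsilon>\<close>, and \<open>3 * \<epsilon> < r\<close>, so the \<open>2 * \<epsilon>\<close>-neighbourhood of \<open>A\<close> is farther than
  \<open>\<delta>\<close> from \<open>D_le (j - 1)\<close>. By \<open>emeasure_limit_measure\<close> its limit mass is \<open>c * m\<close>, with \<open>c\<close> the limit of
  \<open>(n * tail (\<delta> * lam n)) ^ j / big_rate n ^ j\<close> and \<open>m\<close> a probability of the coupling. The walk has the
  same two factors before the limit, by \<open>prob_path_upper\<close> and \<open>sum_big_paths\<close>.
\<close>
lemma limsup_path_le:
  assumes nu: "is_nu \<alpha> p \<nu>" and j: "1 \<le> j" and A: "A \<in> sets skorohod_borel" and e: "0 < \<epsilon>" "3 * \<epsilon> < r"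
    and far: "\<And>f c. f \<in> A \<Longrightarrow> c \<in> D_le (j - 1) \<Longrightarrow> r \<le> d_J1 c f"
  shows "limsup (\<lambda>n. ennreal (prob {\<omega>\<in>space M. walk_path n \<omega> \<in> A} / big_rate n ^ j))
    \<le> emeasure (limit_measure \<nu> j) (nbhd A (2 * \<epsilon>))"
proof -
  have "\<epsilon> / 2 > 0" using e by simp
  from small_jumps_negligible[OF this, of j] obtain \<delta>0 where d0: "\<delta>0 > 0"
    "\<And>\<delta>. 0 < \<delta> \<Longrightarrow> \<delta> \<le> \<delta>0 \<Longrightarrow> (\<lambda>n. prob (small_large (\<epsilon> / 2) \<delta> n) / big_rate n ^ j) \<longlonglongrightarrow> 0"
    unfolding small_large_def by blast
  define \<delta> where "\<delta> = min \<delta>0 \<epsilon>"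
  have d: "0 < \<delta>" "\<delta> \<le> \<delta>0" "\<delta> \<le> \<epsilon>" using d0 e by (auto simp: \<delta>_def)
  obtain \<Omega> \<xi> \<xi>' where O: "prob_space (\<Omega> :: real measure)" and xi: "\<And>n. \<xi> n \<in> borel_measurable \<Omega>"
    and law: "\<And>n. distr \<Omega> borel (\<xi> n) = jump_law \<delta> n" and xi': "\<xi>' \<in> borel_measurable \<Omega>"
    and law': "distr \<Omega> borel \<xi>' = limit_jump_law \<nu> \<delta>"
    and lim: "\<And>w. w \<in> space \<Omega> \<Longrightarrow> (\<lambda>n. \<xi> n w) \<longlonglongrightarrow> \<xi>' w"
    using jump_coupling[OF nu d(1)] by metis
  define m where "m = measure (coupling j \<Omega>) (limit_event j \<Omega> \<xi>' (nbhd A (2 * \<epsilon>)))"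
  define c where "c = (\<delta> powr (- \<alpha>)) ^ j"
  have c: "c > 0" using d by (simp add: c_def)
  have lm: "emeasure (limit_measure \<nu> j) (nbhd A (2 * \<epsilon>)) = ennreal (c * m)"
    unfolding c_def m_def
  proof (rule emeasure_limit_measure[OF nu d(1) nbhd_borel _ O xi' law'])
    fix f h assume f: "f \<in> nbhd A (2 * \<epsilon>)" and h: "h \<in> D_le (j - 1)"
    obtain g where g: "g \<in> A" "g \<in> skorohod" "f \<in> skorohod" "d_J1 g f < 2 * \<epsilon>" using f by (auto simp: nbhd_def)
    have "r \<le> d_J1 h g" using far g h by blast
    also have "\<dots> \<le> d_J1 h f + d_J1 f g" using D_le_subset h g by (intro J1.triangle) auto
    finally show "\<delta> < d_J1 h f" using g(4) e d(3) by (simp add: d_J1_commute[of f g])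
  qed
  have "\<forall>\<^sub>F n in sequentially. ennreal (prob {\<omega>\<in>space M. walk_path n \<omega> \<in> A} / big_rate n ^ j) < y"
    if y: "ennreal (c * m) < y" for y
  proof -
    obtain x where x: "c * m < x" "ennreal x < y"
    proof -
      obtain z where z: "ennreal (c * m) < z" "z < y" using dense[OF y] by blast
      then have "z \<noteq> \<top>" by auto
      then obtain x where "z = ennreal x" "0 \<le> x" by (cases z) auto
      then show ?thesis using that[of x] z c by (simp add: ennreal_less_iff m_def)
    qed
    \<comment> \<open>Halfway between \<open>m\<close> and \<open>x / c\<close>: both inequalities below are strict.\<close>
    define m' where "m' = (m + x / c) / 2"
    have m': "m < m'" "c * m' < x" using x(1) c by (auto simp: m'_def field_simps)
    have "(\<lambda>n. (prob (small_large (\<epsilon> / 2) \<delta> n) + (real n * tail (\<delta> * lam n)) ^ Suc j) / big_rate n ^ j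
        + (real n * tail (\<delta> * lam n)) ^ j / big_rate n ^ j * m') \<longlonglongrightarrow> 0 + c * m'"
      unfolding c_def by (intro tendsto_add tendsto_mult tendsto_const error_negligible scale_limit d0(2) d)
    then have ev: "\<forall>\<^sub>F n in sequentially. (prob (small_large (\<epsilon> / 2) \<delta> n) + (real n * tail (\<delta> * lam n)) ^ Suc j) / big_rate n ^ j
        + (real n * tail (\<delta> * lam n)) ^ j / big_rate n ^ j * m' < x"
      using m'(2) by (intro order_tendstoD) auto
    have "\<forall>\<^sub>F n in sequentially. measure (coupling j \<Omega>) (grid_event j \<Omega> (\<xi> n) n (nbhd A \<epsilon>)) < m'"
      using m'(1) unfolding m_def by (intro coupling_nbhd_upper[OF O xi xi' lim e(1)])
    with ev show ?thesis using eventually_ge_at_top[of 1]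
    proof eventually_elim
      case (elim n)
      have b: "big_rate n > 0" by (rule big_rate_pos[OF elim(3)])
      have "prob {\<omega>\<in>space M. walk_path n \<omega> \<in> A} \<le> prob (small_large (\<epsilon> / 2) \<delta> n) + (real n * tail (\<delta> * lam n)) ^ Suc j
          + (\<Sum>k\<in>inc j n. prob {\<omega> \<in> big_at \<delta> n j k. big_path n j k \<omega> \<in> nbhd A \<epsilon>})"
        using e by (intro prob_path_upper[OF j elim(3) A e(1) _ far]) auto
      also have "(\<Sum>k\<in>inc j n. prob {\<omega> \<in> big_at \<delta> n j k. big_path n j k \<omega> \<in> nbhd A \<epsilon>})
          = (real n * tail (\<delta> * lam n)) ^ j * measure (coupling j \<Omega>) (grid_event j \<Omega> (\<xi> n) n (nbhd A \<epsilon>))"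
        by (rule sum_big_paths[OF elim(3) nbhd_borel O xi law])
      also have "\<dots> \<le> (real n * tail (\<delta> * lam n)) ^ j * m'"
        using elim(2) tail_pos[of "\<delta> * lam n"] by (intro mult_left_mono) auto
      finally have "prob {\<omega>\<in>space M. walk_path n \<omega> \<in> A} / big_rate n ^ j
          \<le> (prob (small_large (\<epsilon> / 2) \<delta> n) + (real n * tail (\<delta> * lam n)) ^ Suc j
          + (real n * tail (\<delta> * lam n)) ^ j * m') / big_rate n ^ j"
        using b by (intro divide_right_mono) auto
      also have "\<dots> < x" using elim(1) by (simp add: add_divide_distrib)
      finally have "ennreal (prob {\<omega>\<in>space M. walk_path n \<omega> \<in> A} / big_rate n ^ j) \<le> ennreal x" by (intro ennreal_leI) simp
      then show ?case using x(2) by simp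
    qed
  qed
  then show ?thesis unfolding lm by (simp add: Limsup_le_iff)
qed

text \<open>The counterpart for the lower bound, with the inner parallel set in place of the neighbourhood.\<close>
lemma liminf_path_ge:
  assumes nu: "is_nu \<alpha> p \<nu>" and j: "1 \<le> j" and A: "A \<in> sets skorohod_borel" and e: "0 < \<epsilon>" "\<epsilon> < r"
    and far: "\<And>f c. f \<in> A \<Longrightarrow> c \<in> D_le (j - 1) \<Longrightarrow> r \<le> d_J1 c f"
  shows "emeasure (limit_measure \<nu> j) (core_nbhd A (2 * \<epsilon>))
    \<le> liminf (\<lambda>n. ennreal (prob {\<omega>\<in>space M. walk_path n \<omega> \<in> A} / big_rate n ^ j))"
proof -
  have "\<epsilon> / 2 > 0" using e by simp
  from small_jumps_negligible[OF this, of j] obtain \<delta>0 where d0: "\<delta>0 > 0"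
    "\<And>\<delta>. 0 < \<delta> \<Longrightarrow> \<delta> \<le> \<delta>0 \<Longrightarrow> (\<lambda>n. prob (small_large (\<epsilon> / 2) \<delta> n) / big_rate n ^ j) \<longlonglongrightarrow> 0"
    unfolding small_large_def by blast
  define \<delta> where "\<delta> = min \<delta>0 \<epsilon>"
  have d: "0 < \<delta>" "\<delta> \<le> \<delta>0" "\<delta> \<le> \<epsilon>" using d0 e by (auto simp: \<delta>_def)
  obtain \<Omega> \<xi> \<xi>' where O: "prob_space (\<Omega> :: real measure)" and xi: "\<And>n. \<xi> n \<in> borel_measurable \<Omega>"
    and law: "\<And>n. distr \<Omega> borel (\<xi> n) = jump_law \<delta> n" and xi': "\<xi>' \<in> borel_measurable \<Omega>"
    and law': "distr \<Omega> borel \<xi>' = limit_jump_law \<nu> \<delta>"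
    and lim: "\<And>w. w \<in> space \<Omega> \<Longrightarrow> (\<lambda>n. \<xi> n w) \<longlonglongrightarrow> \<xi>' w"
    using jump_coupling[OF nu d(1)] by metis
  define m where "m = measure (coupling j \<Omega>) (limit_event j \<Omega> \<xi>' (core_nbhd A (2 * \<epsilon>)))"
  define c where "c = (\<delta> powr (- \<alpha>)) ^ j"
  have c: "c > 0" using d by (simp add: c_def)
  have lm: "emeasure (limit_measure \<nu> j) (core_nbhd A (2 * \<epsilon>)) = ennreal (c * m)"
    unfolding c_def m_def
  proof (rule emeasure_limit_measure[OF nu d(1) core_nbhd_borel _ O xi' law'])
    fix f h assume f: "f \<in> core_nbhd A (2 * \<epsilon>)" and h: "h \<in> D_le (j - 1)"
    have "2 * \<epsilon> > 0" using e by simp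
    then have "f \<in> A" using f core_nbhd_subset by blast
    then show "\<delta> < d_J1 h f" using far[of f h] h e d(3) by linarith
  qed
  have "\<forall>\<^sub>F n in sequentially. y < ennreal (prob {\<omega>\<in>space M. walk_path n \<omega> \<in> A} / big_rate n ^ j)"
    if y: "y < ennreal (c * m)" for y
  proof -
    obtain x where x: "0 \<le> x" "x < c * m" "y = ennreal x"
    proof -
      have "y \<noteq> \<top>" using y by auto
      then obtain x where "y = ennreal x" "0 \<le> x" by (cases y) auto
      then show ?thesis using that[of x] y by (simp add: ennreal_less_iff)
    qed
    \<comment> \<open>Halfway between \<open>m\<close> and \<open>x / c\<close>: both inequalities below are strict.\<close>
    define m' where "m' = (m + x / c) / 2"
    have m': "m' < m" "x < c * m'" using x(2) c by (auto simp: m'_def field_simps)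
    have "(\<lambda>n. (real n * tail (\<delta> * lam n)) ^ j / big_rate n ^ j * m'
        - (prob (small_large (\<epsilon> / 2) \<delta> n) + (real n * tail (\<delta> * lam n)) ^ Suc j) / big_rate n ^ j) \<longlonglongrightarrow> c * m' - 0"
      unfolding c_def by (intro tendsto_diff tendsto_mult tendsto_const error_negligible scale_limit d0(2) d)
    then have ev: "\<forall>\<^sub>F n in sequentially. x < (real n * tail (\<delta> * lam n)) ^ j / big_rate n ^ j * m'
        - (prob (small_large (\<epsilon> / 2) \<delta> n) + (real n * tail (\<delta> * lam n)) ^ Suc j) / big_rate n ^ j"
      using m'(2) by (intro order_tendstoD) auto
    have "\<forall>\<^sub>F n in sequentially. m' < measure (coupling j \<Omega>) (grid_event j \<Omega> (\<xi> n) n (core_nbhd A \<epsilon>))"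
      using m'(1) unfolding m_def by (intro coupling_core_lower[OF O xi xi' lim e(1)])
    with ev show ?thesis using eventually_ge_at_top[of 1]
    proof eventually_elim
      case (elim n)
      have b: "big_rate n > 0" by (rule big_rate_pos[OF elim(3)])
      have "(real n * tail (\<delta> * lam n)) ^ j * m'
          \<le> (real n * tail (\<delta> * lam n)) ^ j * measure (coupling j \<Omega>) (grid_event j \<Omega> (\<xi> n) n (core_nbhd A \<epsilon>))"
        using elim(2) tail_pos[of "\<delta> * lam n"] by (intro mult_left_mono) auto
      also have "\<dots> = (\<Sum>k\<in>inc j n. prob {\<omega> \<in> big_at \<delta> n j k. big_path n j k \<omega> \<in> core_nbhd A \<epsilon>})"
        by (rule sum_big_paths[OF elim(3) core_nbhd_borel O xi law, symmetric])
      also have "\<dots> \<le> prob {\<omega>\<in>space M. walk_path n \<omega> \<in> A} + prob (small_large (\<epsilon> / 2) \<delta> n) + (real n * tail (\<delta> * lam n)) ^ Suc j"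
        by (rule prob_path_lower[OF elim(3) A e(1)])
      finally have "(real n * tail (\<delta> * lam n)) ^ j * m' - (prob (small_large (\<epsilon> / 2) \<delta> n) + (real n * tail (\<delta> * lam n)) ^ Suc j)
          \<le> prob {\<omega>\<in>space M. walk_path n \<omega> \<in> A}" by linarith
      then have "((real n * tail (\<delta> * lam n)) ^ j * m' - (prob (small_large (\<epsilon> / 2) \<delta> n) + (real n * tail (\<delta> * lam n)) ^ Suc j)) / big_rate n ^ j
          \<le> prob {\<omega>\<in>space M. walk_path n \<omega> \<in> A} / big_rate n ^ j"
        using b by (intro divide_right_mono) auto
      then have "x < prob {\<omega>\<in>space M. walk_path n \<omega> \<in> A} / big_rate n ^ j"
        using elim(1) by (simp add: diff_divide_distrib)
      then show ?case using x(1,3) by (simp add: ennreal_less_iff)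
    qed
  qed
  then show ?thesis unfolding lm by (simp add: le_Liminf_iff)
qed

end

section \<open>Convergence away from paths with few jumps\<close>

text \<open>The trace of the Borel sets on an open set is generated by the trace of the open sets.\<close>
lemma sets_restrict_skorohod_borel:
  assumes "openin J1.mtopology W" "sets N = sets skorohod_borel"
  shows "sets (restrict_space N W) = sets (borel_of (subtopology J1.mtopology W))"
proof -
  have W: "W \<subseteq> skorohod" using openin_subset[OF assms(1)] by simp
  have Ws: "W \<in> sigma_sets skorohod {U. openin J1.mtopology U}"
    using open_in_skorohod_borel[OF assms(1)] by (simp only: sets_skorohod_borel)
  have top: "topspace (subtopology J1.mtopology W) = W" using W by (simp add: Int_absorb1)
  have gen: "{U. openin (subtopology J1.mtopology W) U} = (\<inter>) W ` {U. openin J1.mtopology U}"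
    by (auto simp: openin_subtopology Int_commute)
  have "sets (borel_of (subtopology J1.mtopology W)) = sigma_sets W {U. openin (subtopology J1.mtopology W) U}"
  proof -
    have "{U. openin (subtopology J1.mtopology W) U} \<subseteq> Pow W"
      using openin_subset[of "subtopology J1.mtopology W"] unfolding top by blast
    then show ?thesis unfolding borel_of_def top by (rule sets_measure_of)
  qed
  also have "\<dots> = (\<inter>) W ` sigma_sets skorohod {U. openin J1.mtopology U}"
    unfolding gen by (rule sigma_sets_Int[OF Ws W, symmetric])
  also have "\<dots> = sets (restrict_space N W)"
    unfolding sets_restrict_space assms(2) sets_skorohod_borel ..
  finally show ?thesis ..
qed

lemma bounded_awayD:
  assumes "bounded_away d C A"
  shows "\<exists>r>0. \<forall>c\<in>C. \<forall>a\<in>A. r \<le> d c a"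
proof -
  obtain r where r: "0 < ereal r" "ereal r < (INF (x, y)\<in>C \<times> A. ereal (d x y))"
    using assms ereal_dense2[of 0] unfolding bounded_away_def by blast
  have "r \<le> d c a" if "c \<in> C" "a \<in> A" for c a
  proof -
    have "(INF (x, y)\<in>C \<times> A. ereal (d x y)) \<le> ereal (d c a)"
      using that INF_lower[of "(c, a)" "C \<times> A" "\<lambda>(x, y). ereal (d x y)"] by simp
    with r(2) have "ereal r < ereal (d c a)" by (rule order.strict_trans2)
    then show ?thesis by simp
  qed
  then show ?thesis using r(1) by (intro exI[of _ r]) auto
qed

text \<open>A set that stays away from the removed set cannot accumulate there.\<close>
lemma closedin_if_bounded_away:
  assumes F: "closedin (subtopology J1.mtopology (skorohod - C)) F" and r: "r > 0"
    and far: "\<And>c f. c \<in> C \<Longrightarrow> f \<in> F \<Longrightarrow> r \<le> d_J1 c f"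
  shows "closedin J1.mtopology F"
proof -
  obtain T where T: "closedin J1.mtopology T" "F = T \<inter> (skorohod - C)"
    using F by (auto simp: closedin_subtopology)
  show ?thesis
    unfolding J1.closedin_metric
  proof (intro conjI allI impI)
    show "F \<subseteq> skorohod" using T(2) by blast
    fix x assume x: "x \<in> skorohod - F"
    show "\<exists>r>0. disjnt F (J1.mball x r)"
    proof (cases "x \<in> C")
      case True
      have "disjnt F (J1.mball x r)"
        unfolding disjnt_iff
      proof (intro allI notI)
        fix f assume "f \<in> F \<and> f \<in> J1.mball x r"
        then show False using far[OF True, of f] by auto
      qed
      then show ?thesis using r by blast
    next
      case False
      then have "x \<in> skorohod - T" using x T(2) by blast
      then obtain s where "s > 0" "disjnt T (J1.mball x s)" using T(1) unfolding J1.closedin_metric by blast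
      then show ?thesis using T(2) by (auto simp: disjnt_def)
    qed
  qed
qed

context heavy_tailed_walk
begin

lemma limit_measure_finite:
  assumes nu: "is_nu \<alpha> p \<nu>" and A: "A \<in> sets skorohod_borel" and d: "\<delta> > 0"
    and far: "\<And>f c. f \<in> A \<Longrightarrow> c \<in> D_le (j - 1) \<Longrightarrow> \<delta> < d_J1 c f"
  shows "emeasure (limit_measure \<nu> j) A < \<infinity>"
proof -
  obtain \<Omega> \<xi> \<xi>' where O: "prob_space (\<Omega> :: real measure)" and "\<And>n. \<xi> n \<in> borel_measurable \<Omega>"
    and "\<And>n. distr \<Omega> borel (\<xi> n) = jump_law \<delta> n" and xi': "\<xi>' \<in> borel_measurable \<Omega>"
    and law': "distr \<Omega> borel \<xi>' = limit_jump_law \<nu> \<delta>"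
    and "\<And>w. w \<in> space \<Omega> \<Longrightarrow> (\<lambda>n. \<xi> n w) \<longlonglongrightarrow> \<xi>' w"
    using jump_coupling[OF nu d] by metis
  have "emeasure (limit_measure \<nu> j) A = ennreal ((\<delta> powr (- \<alpha>)) ^ j * measure (coupling j \<Omega>) (limit_event j \<Omega> \<xi>' A))"
    by (rule emeasure_limit_measure[OF nu d A far O xi' law'])
  then show ?thesis by simp
qed

lemma scaled_law_eq: "scaled_law M Z lam n = distr M skorohod_borel (walk_path n)"
  unfolding scaled_law_def walk_path_def scaled_walk_eq_h_map ..

lemma emeasure_scaled_law:
  assumes "A \<in> sets skorohod_borel"
  shows "emeasure (scale_measure (ennreal (gamma_seq M Z lam j n)) (scaled_law M Z lam n)) A
    = ennreal (prob {\<omega>\<in>space M. walk_path n \<omega> \<in> A} / big_rate n ^ j)"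
proof -
  have "emeasure (scaled_law M Z lam n) A = emeasure M (walk_path n -` A \<inter> space M)"
    unfolding scaled_law_eq by (rule emeasure_distr[OF walk_path_measurable assms])
  also have "walk_path n -` A \<inter> space M = {\<omega>\<in>space M. walk_path n \<omega> \<in> A}" by blast
  finally have "emeasure (scaled_law M Z lam n) A = ennreal (prob {\<omega>\<in>space M. walk_path n \<omega> \<in> A})"
    by (simp add: emeasure_eq_measure)
  moreover have "0 \<le> gamma_seq M Z lam j n"
    by (simp add: gamma_seq_eq big_rate_def tail_def)
  ultimately show ?thesis
    by (simp add: gamma_seq_eq ennreal_mult[symmetric] divide_inverse mult.commute)
qed

text \<open>
  A closed set is the intersection of its shrinking neighbourhoods, an open set the union of its
  growing inner parallel sets. Both bounds therefore follow from \<open>limsup_path_le\<close> and \<open>liminf_path_ge\<close>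
  by continuity of the limit measure, which is finite at a positive distance from \<open>D_le (j - 1)\<close>.
\<close>
lemma M_converges_scaled_law:
  assumes nu: "is_nu \<alpha> p \<nu>" and j: "1 \<le> j"
  shows "M_converges skorohod d_J1 (D_le (j - 1))
    (\<lambda>n. restrict_space (scale_measure (ennreal (gamma_seq M Z lam j n)) (scaled_law M Z lam n))
           (skorohod - D_le (j - 1)))
    (restrict_space (limit_measure \<nu> j) (skorohod - D_le (j - 1)))"
proof -
  let ?C = "D_le (j - 1)" and ?W = "skorohod - D_le (j - 1)"
  let ?m = "\<lambda>n. scale_measure (ennreal (gamma_seq M Z lam j n)) (scaled_law M Z lam n)"
  let ?l = "limit_measure \<nu> j"
  have W: "openin J1.mtopology ?W" using closedin_D_le[of "j - 1"] by (simp add: closedin_def)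
  have WB: "?W \<in> sets skorohod_borel" by (rule open_in_skorohod_borel[OF W])
  have sm: "sets (?m n) = sets skorohod_borel" for n by (simp add: scaled_law_def)
  have sl: "sets ?l = sets skorohod_borel" by (simp add: limit_measure_def)
  have in_borel: "A \<in> sets skorohod_borel \<and> A \<subseteq> ?W" if "A \<in> sets (restrict_space N ?W)" "sets N = sets skorohod_borel" for A and N :: "(real \<Rightarrow> real) measure"
    using that WB by (auto simp: sets_restrict_space)
  have em: "emeasure (restrict_space (?m n) ?W) A = ennreal (prob {\<omega>\<in>space M. walk_path n \<omega> \<in> A} / big_rate n ^ j)"
    if "A \<in> sets skorohod_borel" "A \<subseteq> ?W" for n A
  proof -
    have "?W \<inter> space (?m n) \<in> sets (?m n)"
      using WB unfolding sm sets_eq_imp_space_eq[OF sm] space_skorohod_borel by (simp add: Int_absorb2)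
    then have "emeasure (restrict_space (?m n) ?W) A = emeasure (?m n) A"
      using that(2) by (rule emeasure_restrict_space)
    then show ?thesis using emeasure_scaled_law[OF that(1)] by (rule trans)
  qed
  have el: "emeasure (restrict_space ?l ?W) A = emeasure ?l A" if "A \<subseteq> ?W" for A
  proof -
    have "?W \<inter> space ?l \<in> sets ?l"
      using WB unfolding sl sets_eq_imp_space_eq[OF sl] space_skorohod_borel by (simp add: Int_absorb2)
    then show ?thesis using that by (rule emeasure_restrict_space)
  qed
  show ?thesis
    unfolding M_converges_def
  proof (intro conjI allI impI)
    fix n
    show "restrict_space (?m n) ?W \<in> M_space skorohod d_J1 ?C"
      unfolding M_space_def
    proof (intro CollectI conjI ballI impI)
      show "sets (restrict_space (?m n) ?W) = sets (borel_of (subtopology J1.mtopology ?W))"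
        by (rule sets_restrict_skorohod_borel[OF W sm])
      fix A assume "A \<in> sets (restrict_space (?m n) ?W)"
      then show "emeasure (restrict_space (?m n) ?W) A < \<infinity>" using em in_borel[OF _ sm] by simp
    qed
  next
    show "restrict_space ?l ?W \<in> M_space skorohod d_J1 ?C"
      unfolding M_space_def
    proof (intro CollectI conjI ballI impI)
      show "sets (restrict_space ?l ?W) = sets (borel_of (subtopology J1.mtopology ?W))"
        by (rule sets_restrict_skorohod_borel[OF W sl])
      fix A assume A: "A \<in> sets (restrict_space ?l ?W)" and "bounded_away d_J1 ?C A"
      then obtain r where r: "r > 0" "\<And>c a. c \<in> ?C \<Longrightarrow> a \<in> A \<Longrightarrow> r \<le> d_J1 c a"
        using bounded_awayD by blast
      have "emeasure ?l A < \<infinity>"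
      proof (rule limit_measure_finite[OF nu, of _ "r / 2"])
        fix f c assume "f \<in> A" "c \<in> ?C"
        then show "r / 2 < d_J1 c f" using r(1) r(2)[of c f] by linarith
      qed (use r in_borel[OF A sl] in auto)
      then show "emeasure (restrict_space ?l ?W) A < \<infinity>" using el in_borel[OF A sl] by simp
    qed
  next
    fix F assume F: "closedin (subtopology J1.mtopology ?W) F" and ba: "bounded_away d_J1 ?C F"
    obtain r where r: "r > 0" "\<And>c a. c \<in> ?C \<Longrightarrow> a \<in> F \<Longrightarrow> r \<le> d_J1 c a"
      using bounded_awayD[OF ba] by blast
    have cl: "closedin J1.mtopology F" by (rule closedin_if_bounded_away[OF F r])
    have FB: "F \<in> sets skorohod_borel" by (rule closed_in_skorohod_borel[OF cl])
    have FW: "F \<subseteq> ?W" using closedin_subset[OF F] by simp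
    define T where "T k = nbhd F (r / 2 / real (Suc k))" for k
    let ?L = "limsup (\<lambda>n. ennreal (prob {\<omega>\<in>space M. walk_path n \<omega> \<in> F} / big_rate n ^ j))"
    have le: "?L \<le> emeasure ?l (T k)" for k
    proof -
      have e: "0 < r / 4 / real (Suc k)" using r by simp
      have "r / 4 / real (Suc k) \<le> r / 4 / 1" using r by (intro divide_left_mono) auto
      then have "3 * (r / 4 / real (Suc k)) < r" using r by linarith
      moreover have "2 * (r / 4 / real (Suc k)) = r / 2 / real (Suc k)" by (simp del: of_nat_Suc)
      ultimately show ?thesis unfolding T_def using limsup_path_le[OF nu j FB e _ r(2)] by metis
    qed
    have "(\<lambda>k. emeasure ?l (T k)) \<longlonglongrightarrow> emeasure ?l (\<Inter>k. T k)"
    proof (rule Lim_emeasure_decseq)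
      show "range T \<subseteq> sets ?l" using nbhd_borel by (auto simp: T_def sl)
      show "decseq T" unfolding decseq_def T_def
        using r by (intro allI impI nbhd_mono divide_left_mono) auto
      show "emeasure ?l (T k) \<noteq> \<infinity>" for k
      proof -
        have "emeasure ?l (T k) < \<infinity>"
        proof (rule limit_measure_finite[OF nu, of _ "r / 4"])
          show "T k \<in> sets skorohod_borel" unfolding T_def by (rule nbhd_borel)
          fix f c assume f: "f \<in> T k" and c: "c \<in> ?C"
          have "r / 2 / real (Suc k) \<le> r / 2 / 1" using r by (intro divide_left_mono) auto
          then have "f \<in> nbhd F (r / 2)" using f nbhd_mono[of "r / 2 / real (Suc k)" "r / 2" F] by (auto simp: T_def)
          then obtain g where g: "g \<in> F" "g \<in> skorohod" "f \<in> skorohod" "d_J1 g f < r / 2"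
            by (auto simp: nbhd_def)
          have "r \<le> d_J1 c g" using r(2) c g by blast
          also have "\<dots> \<le> d_J1 c f + d_J1 f g" using D_le_subset c g by (intro J1.triangle) auto
          finally show "r / 4 < d_J1 c f" using g(4) r(1) by (simp add: d_J1_commute[of f g])
        qed (use r in simp)
        then show ?thesis by simp
      qed
    qed
    also have "(\<Inter>k. T k) = F" unfolding T_def using r by (intro closed_eq_Inter_nbhd[symmetric] cl) simp
    finally have "?L \<le> emeasure ?l F" using le by (intro LIMSEQ_le_const) auto
    then show "limsup (\<lambda>n. emeasure (restrict_space (?m n) ?W) F) \<le> emeasure (restrict_space ?l ?W) F"
      by (simp add: em[OF FB FW] el[OF FW])
  next
    fix G assume G: "openin (subtopology J1.mtopology ?W) G" and ba: "bounded_away d_J1 ?C G"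
    obtain r where r: "r > 0" "\<And>c a. c \<in> ?C \<Longrightarrow> a \<in> G \<Longrightarrow> r \<le> d_J1 c a"
      using bounded_awayD[OF ba] by blast
    have op: "openin J1.mtopology G" using openin_trans_full[OF G W] .
    have GB: "G \<in> sets skorohod_borel" by (rule open_in_skorohod_borel[OF op])
    have GW: "G \<subseteq> ?W" using openin_subset[OF G] by simp
    define T where "T k = core_nbhd G (r / 2 / real (Suc k))" for k
    let ?L = "liminf (\<lambda>n. ennreal (prob {\<omega>\<in>space M. walk_path n \<omega> \<in> G} / big_rate n ^ j))"
    have le: "emeasure ?l (T k) \<le> ?L" for k
    proof -
      have e: "0 < r / 4 / real (Suc k)" using r by simp
      have "r / 4 / real (Suc k) \<le> r / 4 / 1" using r by (intro divide_left_mono) auto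
      then have "r / 4 / real (Suc k) < r" using r by linarith
      moreover have "2 * (r / 4 / real (Suc k)) = r / 2 / real (Suc k)" by (simp del: of_nat_Suc)
      ultimately show ?thesis unfolding T_def using liminf_path_ge[OF nu j GB e _ r(2)] by metis
    qed
    have "(\<lambda>k. emeasure ?l (T k)) \<longlonglongrightarrow> emeasure ?l (\<Union>k. T k)"
    proof (rule Lim_emeasure_incseq)
      show "range T \<subseteq> sets ?l" using core_nbhd_borel by (auto simp: T_def sl)
      show "incseq T" unfolding incseq_def T_def
        using r by (intro allI impI core_nbhd_anti divide_left_mono) auto
    qed
    also have "(\<Union>k. T k) = G" unfolding T_def using r by (intro open_eq_Union_core[symmetric] op) simp
    finally have "emeasure ?l G \<le> ?L" using le by (intro LIMSEQ_le_const2) auto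
    then show "liminf (\<lambda>n. emeasure (restrict_space (?m n) ?W) G) \<ge> emeasure (restrict_space ?l ?W) G"
      by (simp add: em[OF GB GW] el[OF GW])
  qed
qed

end

theorem theorem3p5:
  fixes M :: "'a measure" and Z :: "nat \<Rightarrow> 'a \<Rightarrow> real" and lam :: "nat \<Rightarrow> real"
    and \<alpha> \<rho> p :: real and \<nu> :: "real measure" and j :: nat
  assumes "j \<ge> 1"
    and "prob_space M"
    and "prob_space.indep_vars M (\<lambda>_. borel) Z {1..}"
    and "\<forall>i\<ge>1. distr M borel (Z i) = distr M borel (Z 1)"
    and "\<alpha> > 0"
    and "regularly_varying_rv M (Z 1) \<alpha> p"
    and "integrable M (Z 1) \<longrightarrow> integral\<^sup>L M (Z 1) = 0"
    and "is_nu \<alpha> p \<nu>"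
    and "regularly_varying_seq lam \<rho>"
    and "filterlim lam at_top sequentially"
    and "finite_variance M (Z 1) \<longrightarrow> \<rho> > 1 / 2"
    and "\<not> finite_variance M (Z 1) \<longrightarrow> \<alpha> * \<rho> > 1"
  shows "M_converges skorohod d_J1 (D_le (j - 1))
    (\<lambda>n. restrict_space (scale_measure (ennreal (gamma_seq M Z lam j n)) (scaled_law M Z lam n))
           (skorohod - D_le (j - 1)))
    (restrict_space (limit_measure \<nu> j) (skorohod - D_le (j - 1)))"
proof -
  have walk: "heavy_tailed_walk M Z lam \<alpha> \<rho> p"
    using assms(2-7,9-12) unfolding heavy_tailed_walk_def heavy_tailed_walk_axioms_def by blast
  show ?thesis by (rule heavy_tailed_walk.M_converges_scaled_law[OF walk assms(8,1)])
qed

end
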